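(* Let $S$ be a countable set, let $p\in(1,\infty)$, and let $X=\{X(s),\ s\in S\}$ be a simple max-stable process with $\ell^p$ norm based representation $$X(\cdot)=_d\frac{U^{(p)}(\cdot)}{\Gamma(1-p^{-1})}\,\|\mathbf{A}\circ\mathbf{W}^{(p)}(\cdot)\|_p ,$$ where $\{U^{(p)}(s)\}_{s\in S}$ is a collection of independent $\Phi_p$ random variables, $\{A_i\}_{i\in\mathbb{N}}$ are the points of a Poisson point process on $(0,\infty)$ with intensity measure $a^{-2}\,\mathrm{d}a$, and $W^{(p)}_i$, $i\in\mathbb{N}$, are independent copies of a non-negative process $\{W^{(p)}(s),\ s\in S\}$ with $\mathbb{E}\{W^{(p)}(s)\}=1$ for all $s\in S$, all three families being independent of each other. Then the following holds. 1. The process $X$ allows for the spectral representation $X(\cdot)=_d\max_{i\in\mathbb{N}}A_iV_i(\cdot)$, where $V_i$, $i\in\mathbb{N}$, are independent copies (independent of $\{A_i\}_{i\in\mathbb{N}}$) of a process $V$ with $$V(\cdot)=_d\frac{U^{(p)}(\cdot)}{\Gamma(1-p^{-1})}\,W^{(p)}(\cdot),$$ with $U^{(p)}$ and $W^{(p)}$ independent. 2. For $q\in(p,\infty)$, the process $X$ satisfies $$X(\cdot)=_d\frac{U^{(q)}(\cdot)}{\Gamma(1-q^{-1})}\,\|\mathbf{A}\circ\mathbf{W}^{(q)}(\cdot)\|_q,$$ where $\{U^{(q)}(s)\}_{s\in S}$ is a collection of independent $\Phi_q$ random variables and $W^{(q)}_i$, $i\in\mathbb{N}$, are independent copies of the process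 $\{W^{(q)}(s),\ s\in S\}$ given by $$W^{(q)}(s)=\frac{\Gamma(1-q^{-1})}{\Gamma(1-p^{-1})}\,\bigl(T_{(p/q)}(s)\bigr)^{1/q}\cdot W^{(p)}(s),\qquad s\in S,$$ with $\{U^{(q)}(s)\}_{s\in S}$, $\{A_i\}_{i\in\mathbb{N}}$ and $\{W^{(q)}_i\}_{i\in\mathbb{N}}$ independent of each other. Here, independently of the process $W^{(p)}$, the collection $\{T_{(p/q)}(s)\}_{s\in S}$ consists of independent (positive) stable random variables whose law is given by the Laplace transform $\mathbb{E}\bigl(e^{-tT_{(p/q)}(s)}\bigr)=e^{-t^{p/q}}$, $t\ge 0$.
   Context: For $\alpha\in(0,\infty)$, $\Phi_\alpha(x)=\exp(-x^{-\alpha})$, $x>0$, is the $\alpha$-Fréchet distribution function. The symbol $=_d$ between processes on the countable set $S$ means equality in distribution (equality of all finite-dimensional distributions). For $r\in(1,\infty)$ and sequences $\mathbf{A}=\{A_i\}_{i\in\mathbb{N}}$, $\mathbf{W}^{(r)}(s)=\{W^{(r)}_i(s)\}_{i\in\mathbb{N}}$ of non-negative numbers, $\|\mathbf{A}\circ\mathbf{W}^{(r)}(s)\|_r=\left[\sum_{i\in\mathbb{N}}(A_iW^{(r)}_i(s))^r\right]^{1/r}$. A stochastic process $X=\{X(s),\ s\in S\}$ is called max-stable if there exist functions $a_n:S\to(0,\infty)$ and $b_n:S\to\mathbb{R}$, $n\in\mathbb{N}$, such that for every $n\in\mathbb{N}$ the process $\max_{i=1}^n (X_i-b_n)/a_n$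 (pointwise maximum; $X_1,X_2,\ldots$ independent copies of $X$) has the same law as $X$. It is called simple max-stable if in addition $X(s)$ has distribution function $\Phi_1$ for every $s\in S$. *)

theory Defs
  imports "HOL-Probability.Probability"
begin

section \<open>Processes, equality in law, independence\<close>

definition process :: "'w measure \<Rightarrow> 's set \<Rightarrow> ('s \<Rightarrow> 'w \<Rightarrow> real) \<Rightarrow> bool" where
  "process M S X \<longleftrightarrow> prob_space M \<and> (\<forall>s\<in>S. X s \<in> borel_measurable M)"

definition path :: "'s set \<Rightarrow> ('s \<Rightarrow> 'w \<Rightarrow> real) \<Rightarrow> 'w \<Rightarrow> 's \<Rightarrow> real" where
  "path S X \<omega> = (\<lambda>s\<in>S. X s \<omega>)"

text \<open>Equality of all finite-dimensional distributions; the two processes may live on different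
  probability spaces.\<close>

definition eq_law ::
  "'s set \<Rightarrow> 'v measure \<Rightarrow> ('s \<Rightarrow> 'v \<Rightarrow> real) \<Rightarrow> 'w measure \<Rightarrow> ('s \<Rightarrow> 'w \<Rightarrow> real) \<Rightarrow> bool" where
  "eq_law S M X N Y \<longleftrightarrow> process M S X \<and> process N S Y \<and>
     (\<forall>F. finite F \<and> F \<subseteq> S \<longrightarrow>
        distr M (\<Pi>\<^sub>M s\<in>F. borel) (path F X) = distr N (\<Pi>\<^sub>M s\<in>F. borel) (path F Y))"

text \<open>The processes \<open>Y 0, Y 1, \<dots>\<close> on \<open>M\<close> are independent copies of the process \<open>Z\<close> on \<open>N\<close>.\<close>

definition indep_copies ::
  "'s set \<Rightarrow> 'v measure \<Rightarrow> (nat \<Rightarrow> 's \<Rightarrow> 'v \<Rightarrow> real) \<Rightarrow> 'w measure \<Rightarrow> ('s \<Rightarrow> 'w \<Rightarrow> real) \<Rightarrow> bool" where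
  "indep_copies S M Y N Z \<longleftrightarrow> (\<forall>i. eq_law S M (Y i) N Z) \<and>
     prob_space.indep_vars M (\<lambda>i. \<Pi>\<^sub>M s\<in>S. borel) (\<lambda>i. path S (Y i)) UNIV"

text \<open>The events generated by a family of random variables. Independence of families whose index
  sets have different types is stated through these, since \<^const>\<open>prob_space.indep_vars\<close> requires a
  common value type.\<close>

definition gen_events :: "'w measure \<Rightarrow> 'i set \<Rightarrow> ('i \<Rightarrow> 'w \<Rightarrow> real) \<Rightarrow> 'w set set" where
  "gen_events M I Y = {path I Y -` B \<inter> space M | B. B \<in> sets (\<Pi>\<^sub>M i\<in>I. borel)}"

definition copies_events :: "'w measure \<Rightarrow> 's set \<Rightarrow> (nat \<Rightarrow> 's \<Rightarrow> 'w \<Rightarrow> real) \<Rightarrow> 'w set set" where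
  "copies_events M S Y = gen_events M (UNIV \<times> S) (\<lambda>(i, s). Y i s)"


section \<open>Max-stable processes\<close>

definition frechet_cdf :: "real \<Rightarrow> real \<Rightarrow> real" where
  "frechet_cdf \<alpha> x = (if x > 0 then exp (- (x powr - \<alpha>)) else 0)"

text \<open>The independent copies of \<open>X\<close> are realized as the coordinates of a product space.\<close>

definition max_stable :: "'w measure \<Rightarrow> 's set \<Rightarrow> ('s \<Rightarrow> 'w \<Rightarrow> real) \<Rightarrow> bool" where
  "max_stable M S X \<longleftrightarrow> process M S X \<and>
     (\<exists>(a :: nat \<Rightarrow> 's \<Rightarrow> real) b :: nat \<Rightarrow> 's \<Rightarrow> real.
        (\<forall>n\<ge>1. \<forall>s\<in>S. a n s > 0) \<and>
        (\<forall>n\<ge>1. eq_law S (\<Pi>\<^sub>M i\<in>{1..n}. M)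
                  (\<lambda>s \<omega>. MAX i\<in>{1..n}. (X s (\<omega> i) - b n s) / a n s) M X))"

definition simple_max_stable :: "'w measure \<Rightarrow> 's set \<Rightarrow> ('s \<Rightarrow> 'w \<Rightarrow> real) \<Rightarrow> bool" where
  "simple_max_stable M S X \<longleftrightarrow>
     max_stable M S X \<and> (\<forall>s\<in>S. cdf (distr M borel (X s)) = frechet_cdf 1)"


section \<open>The random ingredients\<close>

definition frechet_family ::
  "real \<Rightarrow> 's set \<Rightarrow> 'w measure \<Rightarrow> ('s \<Rightarrow> 'w \<Rightarrow> real) \<Rightarrow> bool" where
  "frechet_family \<alpha> S M U \<longleftrightarrow> prob_space M \<and> prob_space.indep_vars M (\<lambda>s. borel) U S \<and>
     (\<forall>s\<in>S. cdf (distr M borel (U s)) = frechet_cdf \<alpha>)"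

text \<open>Positive \<open>\<beta>\<close>-stable laws, \<open>0 < \<beta> < 1\<close>.\<close>

definition stable_family ::
  "real \<Rightarrow> 's set \<Rightarrow> 'w measure \<Rightarrow> ('s \<Rightarrow> 'w \<Rightarrow> real) \<Rightarrow> bool" where
  "stable_family \<beta> S M T \<longleftrightarrow> prob_space M \<and> prob_space.indep_vars M (\<lambda>s. borel) T S \<and>
     (\<forall>s\<in>S. (AE \<omega> in M. T s \<omega> > 0) \<and>
        (\<forall>t\<ge>0. prob_space.expectation M (\<lambda>\<omega>. exp (- t * T s \<omega>)) = exp (- (t powr \<beta>))))"

text \<open>Number of points in \<open>B\<close>, counted with multiplicity, possibly infinite.\<close>

definition count_points :: "(nat \<Rightarrow> 'w \<Rightarrow> 'x) \<Rightarrow> 'x set \<Rightarrow> 'w \<Rightarrow> ennreal" where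
  "count_points A B \<omega> = emeasure (count_space UNIV) {i. A i \<omega> \<in> B}"

text \<open>\<open>A 0, A 1, \<dots>\<close> is an enumeration of the points of a Poisson point process on \<open>space \<mu>\<close> with
  intensity measure \<open>\<mu>\<close>; a Poisson variable with infinite mean is almost surely infinite. The order
  of the enumeration is left open.\<close>

definition poisson_points :: "'w measure \<Rightarrow> 'x measure \<Rightarrow> (nat \<Rightarrow> 'w \<Rightarrow> 'x) \<Rightarrow> bool" where
  "poisson_points M \<mu> A \<longleftrightarrow> prob_space M \<and> (\<forall>i. A i \<in> measurable M \<mu>) \<and>
     (\<forall>B\<in>sets \<mu>.
        if emeasure \<mu> B = \<infinity> then AE \<omega> in M. count_points A B \<omega> = \<infinity>
        else \<forall>k::nat. measure M {\<omega> \<in> space M. count_points A B \<omega> = of_nat k}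
               = measure \<mu> B ^ k / fact k * exp (- measure \<mu> B)) \<and>
     (\<forall>(B :: nat \<Rightarrow> 'x set) n. (\<forall>j<n. B j \<in> sets \<mu>) \<and> disjoint_family_on B {..<n} \<longrightarrow>
        prob_space.indep_vars M (\<lambda>j. borel) (\<lambda>j. count_points A (B j)) {..<n})"

definition intensity :: "real measure" where
  "intensity = density (restrict_space lborel {0<..}) (\<lambda>a. ennreal (1 / a\<^sup>2))"


section \<open>The two representations\<close>

text \<open>The convention \<open>infsum f = 0\<close> for divergent sums is harmless here: where a product
  \<open>lr_process r U A W\<close> is asserted to be equal in law to a process with Frechet marginals, it is
  almost surely positive, which forces the sum to converge.\<close>

definition lr_norm :: "real \<Rightarrow> (nat \<Rightarrow> real) \<Rightarrow> real" where
  "lr_norm r f = (\<Sum>\<^sub>\<infinity>i. f i powr r) powr (1 / r)"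

definition lr_process ::
  "real \<Rightarrow> ('s \<Rightarrow> 'w \<Rightarrow> real) \<Rightarrow> (nat \<Rightarrow> 'w \<Rightarrow> real) \<Rightarrow> (nat \<Rightarrow> 's \<Rightarrow> 'w \<Rightarrow> real) \<Rightarrow> 's \<Rightarrow> 'w \<Rightarrow> real" where
  "lr_process r U A W s \<omega> = U s \<omega> / Gamma (1 - 1 / r) * lr_norm r (\<lambda>i. A i \<omega> * W i s \<omega>)"

definition lr_ingredients ::
  "real \<Rightarrow> 's set \<Rightarrow> 'v measure \<Rightarrow> ('s \<Rightarrow> 'v \<Rightarrow> real) \<Rightarrow> (nat \<Rightarrow> 'v \<Rightarrow> real) \<Rightarrow>
   (nat \<Rightarrow> 's \<Rightarrow> 'v \<Rightarrow> real) \<Rightarrow> 'w measure \<Rightarrow> ('s \<Rightarrow> 'w \<Rightarrow> real) \<Rightarrow> bool" where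
  "lr_ingredients r S M U A W N Z \<longleftrightarrow>
     frechet_family r S M U \<and> poisson_points M intensity A \<and> indep_copies S M W N Z \<and>
     prob_space.indep_sets M
       (\<lambda>k. [gen_events M S U, gen_events M UNIV A, copies_events M S W] ! k) {..<3}"

text \<open>The maximum of a sequence, \<open>0\<close> if there is none. Again, equality in law with a process with
  Frechet marginals forces the maximum to exist almost surely.\<close>

definition seq_max :: "(nat \<Rightarrow> real) \<Rightarrow> real" where
  "seq_max f = (if \<exists>i. \<forall>j. f j \<le> f i then GREATEST m. m \<in> range f else 0)"

definition max_process ::
  "(nat \<Rightarrow> 'w \<Rightarrow> real) \<Rightarrow> (nat \<Rightarrow> 's \<Rightarrow> 'w \<Rightarrow> real) \<Rightarrow> 's \<Rightarrow> 'w \<Rightarrow> real" where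
  "max_process A V s \<omega> = seq_max (\<lambda>i. A i \<omega> * V i s \<omega>)"

definition max_ingredients ::
  "'s set \<Rightarrow> 'v measure \<Rightarrow> (nat \<Rightarrow> 'v \<Rightarrow> real) \<Rightarrow> (nat \<Rightarrow> 's \<Rightarrow> 'v \<Rightarrow> real) \<Rightarrow>
   'w measure \<Rightarrow> ('s \<Rightarrow> 'w \<Rightarrow> real) \<Rightarrow> bool" where
  "max_ingredients S M A V N Z \<longleftrightarrow>
     poisson_points M intensity A \<and> indep_copies S M V N Z \<and>
     prob_space.indep_set M (gen_events M UNIV A) (copies_events M S V)"

text \<open>On \<open>R\<close>, the family \<open>U\<close> consists of independent \<open>p\<close>-Frechet variables and is independent of
  \<open>W\<close>, which has the law of the process \<open>W0\<close> on \<open>K\<close>.\<close>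

definition frechet_factors ::
  "real \<Rightarrow> 's set \<Rightarrow> 'v measure \<Rightarrow> ('s \<Rightarrow> 'v \<Rightarrow> real) \<Rightarrow> ('s \<Rightarrow> 'v \<Rightarrow> real) \<Rightarrow>
   'w measure \<Rightarrow> ('s \<Rightarrow> 'w \<Rightarrow> real) \<Rightarrow> bool" where
  "frechet_factors p S R U W K W0 \<longleftrightarrow>
     frechet_family p S R U \<and> eq_law S R W K W0 \<and>
     prob_space.indep_set R (gen_events R S U) (gen_events R S W)"

definition V_process ::
  "real \<Rightarrow> ('s \<Rightarrow> 'w \<Rightarrow> real) \<Rightarrow> ('s \<Rightarrow> 'w \<Rightarrow> real) \<Rightarrow> 's \<Rightarrow> 'w \<Rightarrow> real" where
  "V_process p U W s \<omega> = U s \<omega> / Gamma (1 - 1 / p) * W s \<omega>"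

definition stable_factors ::
  "real \<Rightarrow> 's set \<Rightarrow> 'v measure \<Rightarrow> ('s \<Rightarrow> 'v \<Rightarrow> real) \<Rightarrow> ('s \<Rightarrow> 'v \<Rightarrow> real) \<Rightarrow>
   'w measure \<Rightarrow> ('s \<Rightarrow> 'w \<Rightarrow> real) \<Rightarrow> bool" where
  "stable_factors \<beta> S R T W K W0 \<longleftrightarrow>
     stable_family \<beta> S R T \<and> eq_law S R W K W0 \<and>
     prob_space.indep_set R (gen_events R S T) (gen_events R S W)"

definition Wq_process ::
  "real \<Rightarrow> real \<Rightarrow> ('s \<Rightarrow> 'w \<Rightarrow> real) \<Rightarrow> ('s \<Rightarrow> 'w \<Rightarrow> real) \<Rightarrow> 's \<Rightarrow> 'w \<Rightarrow> real" where
  "Wq_process p q T W s \<omega> =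
     Gamma (1 - 1 / q) / Gamma (1 - 1 / p) * T s \<omega> powr (1 / q) * W s \<omega>"

text \<open>A representation result asserts that suitable ingredients exist and that all choices of
  ingredients (on arbitrary probability spaces) give a process with the law of \<open>X\<close>. For existence,
  the sample space \<open>nat \<Rightarrow> 'b\<close> is used; it carries countably many independent copies of whatever
  lives on a space with points of type \<open>'b\<close>.\<close>

end

theory Submission
  imports Defs
begin

text \<open>Because \<open>X\<close> has unit Frechet marginals, its law is determined by the probabilities
  \<open>P(X(s) \<le> x(s) for s \<in> F)\<close> for finite \<open>F\<close> and strictly positive \<open>x\<close>: orthants generate the product
  sigma-algebra, and those with a non-positive corner are null (lemma \<open>eq_law_orthantI\<close>). So it is
  enough to see that all three representations give the same number, and for each of them this number is
  \<open>exp(- \<integral> (1 - \<phi>(a)) a\<^sup>-\<^sup>2 da)\<close>, where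
  \<open>\<phi>(a) = E exp(- \<Sum>s\<in>F. (a W(s) / (x(s) \<Gamma>(1 - 1/p)))\<^sup>p)\<close> with \<open>W\<close> the original spectral process.

  For the norm representation, condition on the points \<open>A\<close> and the processes \<open>W\<close>. A \<open>p\<close>-Frechet
  variable satisfies \<open>P(U n \<le> y) = exp(- (n / y)\<^sup>p)\<close>, so the conditional probability of the event is
  \<open>exp(- \<Sum>s. \<Sum>i. (A(i) W(i,s) / (x(s) \<Gamma>))\<^sup>p)\<close>: the \<open>p\<close>-norm was chosen to make the exponent additive
  over the points. Its expectation is the Laplace functional of a Poisson process whose points
  \<open>A(i)\<close> carry independent marks \<open>W(i)\<close> (lemmas \<open>frechet_orthant\<close>, \<open>marked_poisson_laplace\<close>).

  For the maximum representation the event says that no point has a coordinate \<open>A(i) V(i,s) > x(s)\<close>. This is the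
  same Laplace functional with the exponent infinite on the forbidden set, and integrating the Frechet
  factor out of \<open>V\<close> turns \<open>P(a V(s) \<le> x(s) for s \<in> F)\<close> into \<open>\<phi>(a)\<close>
  (lemmas \<open>max_process_orthant\<close>, \<open>spectral_exponent_frechet_factors\<close>).

  For \<open>q > p\<close> the norm representation has the exponent built from \<open>q\<close>-th powers of \<open>a W\<^sup>q(s)\<close>, which
  are \<open>T(s) b(s)\<^sup>q\<close> with \<open>b(s) = a W(s) / (x(s) \<Gamma>(1 - 1/p))\<close> after normalisation. Integrating out the
  stable variable replaces \<open>b(s)\<^sup>q\<close> by its power \<open>p/q\<close>, that is by \<open>b(s)\<^sup>p\<close>, and \<open>\<phi>(a)\<close>
  appears again (lemma \<open>spectral_exponent_stable_factors\<close>).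

  All sums and maxima must be shown to be almost surely finite or attained. Evaluating the given
  representation at a single \<open>s\<close> shows that the exponent is \<open>1 / x(s)\<close>, and a finite exponent
  forces finiteness of the sum over the points (lemma \<open>marked_poisson_sum_finite\<close>).

  For existence, the space \<open>N\<close> of the given representation already carries Frechet variables, Poisson
  points and a copy of \<open>W\<close>. Its points even give a positive stable variable: a suitable multiple of
  \<open>\<Sum>i. A(i)\<^sup>1\<^sup>/\<^sup>\<beta>\<close> is \<open>\<beta>\<close>-stable (lemma \<open>stable_variable_exists\<close>). The countable power of \<open>N\<close> is split
  into infinitely many independent blocks, each distributed like the whole power, and these blocks
  supply the independent copies.\<close>

section \<open>The exponential of an extended nonnegative exponent\<close>

text \<open>The exponents below are sums over infinitely many points and integrals over an infinite
  measure, and for the maximum they jump to \<open>\<infinity>\<close>. Reading \<open>exp(-\<infinity>)\<close> as \<open>0\<close> keeps the functional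
  equation and continuity, so the Laplace functionals hold
  without case distinctions on convergence.\<close>

definition nexp :: "ennreal \<Rightarrow> ennreal" where
  "nexp x = (if x = \<infinity> then 0 else ennreal (exp (- enn2real x)))"

lemma nexp_top [simp]: "nexp \<infinity> = 0" "nexp top = 0"
  by (simp_all add: nexp_def)

lemma nexp_0 [simp]: "nexp 0 = 1"
  by (simp add: nexp_def)

lemma nexp_ennreal: "0 \<le> r \<Longrightarrow> nexp (ennreal r) = ennreal (exp (- r))"
  by (simp add: nexp_def)

lemma nexp_le_1: "nexp x \<le> 1"
  by (cases x rule: ennreal_cases) (simp_all add: nexp_ennreal)

lemma nexp_eq_top_iff [simp]: "nexp x \<noteq> top" "nexp x < top"
  by (simp_all add: nexp_def less_top)

lemma nexp_add: "nexp (x + y) = nexp x * nexp y"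
proof (cases "x = \<infinity> \<or> y = \<infinity>")
  case False
  then obtain r t where rt: "x = ennreal r" "0 \<le> r" "y = ennreal t" "0 \<le> t"
    by (cases x y rule: ennreal2_cases) auto
  have "nexp (x + y) = ennreal (exp (- (r + t)))"
    using rt by (simp add: nexp_ennreal flip: ennreal_plus)
  also have "exp (- (r + t)) = exp (- r) * exp (- t)"
    by (simp flip: exp_add)
  also have "ennreal \<dots> = nexp x * nexp y"
    using rt by (simp add: nexp_ennreal ennreal_mult)
  finally show ?thesis .
qed auto

lemma nexp_sum: "nexp (\<Sum>i\<in>I. f i) = (\<Prod>i\<in>I. nexp (f i))"
  by (induction I rule: infinite_finite_induct) (simp_all add: nexp_add)

lemma nexp_antimono: "x \<le> y \<Longrightarrow> nexp y \<le> nexp x"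
  by (cases x y rule: ennreal2_cases) (auto simp: nexp_ennreal top_unique)

lemma nexp_inj: "nexp x = nexp y \<Longrightarrow> x = y"
  by (cases x y rule: ennreal2_cases) (auto simp: nexp_ennreal)

lemma nexp_tendsto:
  assumes "(f \<longlongrightarrow> l) G"
  shows "((\<lambda>x. nexp (f x)) \<longlongrightarrow> nexp l) G"
proof (cases "l = \<infinity>")
  case True
  have "\<forall>\<^sub>F x in G. nexp (f x) < e" if "e > 0" for e
  proof -
    obtain d where d: "0 < d" "ennreal d < e"
    proof -
      obtain z where z: "0 < z" "z < e" using dense[OF \<open>e > 0\<close>] by auto
      then have "z \<noteq> top" by auto
      then obtain d where "z = ennreal d" "d \<ge> 0" by (cases z rule: ennreal_cases) auto
      with z show ?thesis by (intro that[of d]) auto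
    qed
    have "\<forall>\<^sub>F x in G. ennreal (max 0 (- ln d)) < f x"
      using assms True by (intro order_tendstoD(1)[OF assms]) auto
    then show ?thesis
    proof eventually_elim
      case (elim x)
      have "nexp (f x) \<le> nexp (ennreal (max 0 (- ln d)))"
        using elim by (intro nexp_antimono) auto
      also have "\<dots> = ennreal (exp (- max 0 (- ln d)))" by (rule nexp_ennreal) simp
      also have "\<dots> \<le> ennreal d"
      proof (rule ennreal_leI)
        have "exp (- max 0 (- ln d)) \<le> exp (ln d)" by (subst exp_le_cancel_iff) simp
        then show "exp (- max 0 (- ln d)) \<le> d" using d by simp
      qed
      finally show ?case using d by simp
    qed
  qed
  then show ?thesis using True by (intro order_tendstoI) auto
next
  case False
  have ev: "\<forall>\<^sub>F x in G. f x < \<infinity>"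
    using False by (intro order_tendstoD(2)[OF assms]) (auto simp: less_top)
  have "((\<lambda>x. ennreal (exp (- enn2real (f x)))) \<longlongrightarrow> ennreal (exp (- enn2real l))) G"
    using False assms
    by (intro tendsto_intros tendsto_ennrealI tendsto_enn2real) (auto simp: less_top)
  moreover have "\<forall>\<^sub>F x in G. ennreal (exp (- enn2real (f x))) = nexp (f x)"
    using ev by eventually_elim (auto simp: nexp_def)
  ultimately have "((\<lambda>x. nexp (f x)) \<longlongrightarrow> ennreal (exp (- enn2real l))) G"
    by (rule Lim_transform_eventually)
  then show ?thesis using False by (simp add: nexp_def)
qed

lemma nexp_measurable [measurable]: "nexp \<in> borel_measurable borel"
  unfolding nexp_def[abs_def] by measurable

text \<open>The inverse of \<^const>\<open>nexp\<close> on \<open>[0, 1]\<close>. It rewrites a product of expectations over the points as a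
  sum, which is the form that the Laplace functional expects.\<close>

definition nln :: "ennreal \<Rightarrow> ennreal" where
  "nln y = (if y = 0 then \<infinity> else ennreal (- ln (enn2real y)))"

lemma nexp_nln: "y \<le> 1 \<Longrightarrow> nexp (nln y) = y"
  by (cases y rule: ennreal_cases) 
     (auto simp: nln_def nexp_ennreal top_unique ennreal_eq_0_iff)

lemma nln_measurable [measurable]: "nln \<in> borel_measurable borel"
  unfolding nln_def[abs_def] by measurable

lemma nexp_suminf:
  fixes f :: "nat \<Rightarrow> ennreal"
  shows "(\<lambda>n. \<Prod>i<n. nexp (f i)) \<longlonglongrightarrow> nexp (\<Sum>i. f i)"
  using nexp_tendsto[OF summable_LIMSEQ[of f]] by (simp add: nexp_sum)

lemma (in prob_space) nexp_le_1_integral: "(\<integral>\<^sup>+\<omega>. nexp (f \<omega>) \<partial>M) \<le> 1"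
proof -
  have "(\<integral>\<^sup>+\<omega>. nexp (f \<omega>) \<partial>M) \<le> (\<integral>\<^sup>+\<omega>. 1 \<partial>M)"
    by (intro nn_integral_mono nexp_le_1)
  then show ?thesis by (simp add: emeasure_space_1)
qed

lemma (in prob_space) nexp_integral_LIMSEQ:
  assumes [measurable]: "\<And>n. f n \<in> borel_measurable M" "g \<in> borel_measurable M"
    and "\<And>\<omega>. \<omega> \<in> space M \<Longrightarrow> (\<lambda>n. f n \<omega>) \<longlonglongrightarrow> g \<omega>"
  shows "(\<lambda>n. \<integral>\<^sup>+\<omega>. nexp (f n \<omega>) \<partial>M) \<longlonglongrightarrow> (\<integral>\<^sup>+\<omega>. nexp (g \<omega>) \<partial>M)"
  by (rule nn_integral_dominated_convergence[where w = "\<lambda>_. 1"])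
     (auto simp: nexp_le_1 emeasure_space_1 intro!: nexp_tendsto assms)

text \<open>On the event \<open>Z = \<infinity>\<close> the integrand vanishes however small the factor \<open>c(n)\<close> is, so every
  integral is bounded by the probability that \<open>Z\<close> is finite.\<close>

lemma (in prob_space) AE_finite_if_nexp_integral_tendsto_1:
  fixes Z :: "'a \<Rightarrow> ennreal"
  assumes Z [measurable]: "Z \<in> borel_measurable M"
    and c: "\<And>n. c n > 0"
    and lim: "(\<lambda>n::nat. \<integral>\<^sup>+\<omega>. nexp (ennreal (c n) * Z \<omega>) \<partial>M) \<longlonglongrightarrow> 1"
  shows "AE \<omega> in M. Z \<omega> < \<infinity>"
proof -
  let ?B = "{\<omega>\<in>space M. Z \<omega> < \<infinity>}"
  have "(\<integral>\<^sup>+\<omega>. nexp (ennreal (c n) * Z \<omega>) \<partial>M) \<le> emeasure M ?B" for n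
  proof -
    have "(\<integral>\<^sup>+\<omega>. nexp (ennreal (c n) * Z \<omega>) \<partial>M) \<le> (\<integral>\<^sup>+\<omega>. indicator ?B \<omega> \<partial>M)"
    proof (rule nn_integral_mono)
      fix \<omega> assume "\<omega> \<in> space M"
      show "nexp (ennreal (c n) * Z \<omega>) \<le> indicator ?B \<omega>"
      proof (cases "Z \<omega> = \<infinity>")
        case True
        then have "ennreal (c n) * Z \<omega> = \<infinity>"
          using c[of n] by (simp add: ennreal_mult_top)
        then show ?thesis by simp
      next
        case False
        then show ?thesis using \<open>\<omega> \<in> space M\<close> by (simp add: nexp_le_1 less_top)
      qed
    qed
    then show ?thesis by simp
  qed
  then have "1 \<le> emeasure M ?B"
    by (intro LIMSEQ_le_const2[OF lim]) auto
  then have "emeasure M ?B = 1" using measure_le_1 by (simp add: antisym)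
  then have "prob ?B = 1" by (simp add: measure_def)
  then show ?thesis by (simp add: prob_Collect_eq_1)
qed

section \<open>Decoupling independent random elements\<close>

definition vimage_events :: "'w measure \<Rightarrow> 'x measure \<Rightarrow> ('w \<Rightarrow> 'x) \<Rightarrow> 'w set set" where
  "vimage_events M L X = {X -` B \<inter> space M | B. B \<in> sets L}"

lemma vimage_events_subset: "X \<in> measurable M L \<Longrightarrow> vimage_events M L X \<subseteq> sets M"
  by (auto simp: vimage_events_def)

lemma Int_stable_vimage_events: "Int_stable (vimage_events M L X)"
proof (rule Int_stableI)
  fix a b assume "a \<in> vimage_events M L X" "b \<in> vimage_events M L X"
  then obtain B C where "a = X -` B \<inter> space M" "b = X -` C \<inter> space M" "B \<in> sets L" "C \<in> sets L"
    by (auto simp: vimage_events_def)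
  then show "a \<inter> b \<in> vimage_events M L X"
    unfolding vimage_events_def by (intro CollectI exI[of _ "B \<inter> C"]) auto
qed

text \<open>Independence used as a Fubini theorem on the sample space itself: in the inner
  integral the second element is frozen at \<open>\<omega>'\<close>. The two elements may have different value types, and that is
  why independence is stated for their generated events.\<close>

lemma nn_integral_indep_decouple:
  assumes "prob_space M" and [measurable]: "X \<in> measurable M N1" "Y \<in> measurable M N2"
    and ind: "prob_space.indep_set M (vimage_events M N1 X) (vimage_events M N2 Y)"
    and [measurable]: "f \<in> borel_measurable (N1 \<Otimes>\<^sub>M N2)"
  shows "(\<integral>\<^sup>+\<omega>. f (X \<omega>, Y \<omega>) \<partial>M) = (\<integral>\<^sup>+\<omega>'. (\<integral>\<^sup>+\<omega>. f (X \<omega>, Y \<omega>') \<partial>M) \<partial>M)"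
proof -
  interpret M: prob_space M by fact
  interpret X: prob_space "distr M N1 X" by (rule M.prob_space_distr) measurable
  interpret Y: prob_space "distr M N2 Y" by (rule M.prob_space_distr) measurable
  interpret pair_prob_space "distr M N1 X" "distr M N2 Y" ..
  have eq: "distr M N1 X \<Otimes>\<^sub>M distr M N2 Y = distr M (N1 \<Otimes>\<^sub>M N2) (\<lambda>x. (X x, Y x))"
  proof (rule pair_measure_eqI)
    fix B C assume "B \<in> sets (distr M N1 X)" "C \<in> sets (distr M N2 Y)"
    then have BC [measurable]: "B \<in> sets N1" "C \<in> sets N2" by simp_all
    have "measure M ((X -` B \<inter> space M) \<inter> (Y -` C \<inter> space M)) = measure M (X -` B \<inter> space M) * measure M (Y -` C \<inter> space M)"
      using ind BC unfolding M.indep_sets2_eq vimage_events_def by blast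
    moreover have "(\<lambda>x. (X x, Y x)) -` (B \<times> C) \<inter> space M = (X -` B \<inter> space M) \<inter> (Y -` C \<inter> space M)"
      by auto
    ultimately show "emeasure (distr M N1 X) B * emeasure (distr M N2 Y) C
        = emeasure (distr M (N1 \<Otimes>\<^sub>M N2) (\<lambda>x. (X x, Y x))) (B \<times> C)"
      by (simp add: emeasure_distr M.emeasure_eq_measure ennreal_mult)
  qed (auto intro: X.sigma_finite_measure_axioms Y.sigma_finite_measure_axioms)
  have "(\<integral>\<^sup>+\<omega>. f (X \<omega>, Y \<omega>) \<partial>M) = (\<integral>\<^sup>+z. f z \<partial>distr M (N1 \<Otimes>\<^sub>M N2) (\<lambda>x. (X x, Y x)))"
    by (simp add: nn_integral_distr)
  also have "\<dots> = (\<integral>\<^sup>+y. \<integral>\<^sup>+x. f (x, y) \<partial>distr M N1 X \<partial>distr M N2 Y)"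
    unfolding eq[symmetric] by (subst nn_integral_snd[symmetric]) auto
  also have "\<dots> = (\<integral>\<^sup>+\<omega>'. (\<integral>\<^sup>+\<omega>. f (X \<omega>, Y \<omega>') \<partial>M) \<partial>M)"
    by (subst nn_integral_distr, measurable, intro nn_integral_cong)
       (subst nn_integral_distr, auto intro: measurable_space)
  finally show ?thesis .
qed

section \<open>The Laplace functional of a Poisson process\<close>

lemma count_points_eq_suminf:
  "count_points A B \<omega> = (\<Sum>i. indicator B (A i \<omega>))"
proof -
  have "count_points A B \<omega> = (\<integral>\<^sup>+i. indicator {i. A i \<omega> \<in> B} i \<partial>count_space UNIV)"
    by (simp add: count_points_def)
  also have "\<dots> = (\<Sum>i. indicator {i. A i \<omega> \<in> B} i)"
    by (rule nn_integral_count_space_nat)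
  finally show ?thesis by (simp add: indicator_def)
qed

text \<open>The generating function of a Poisson variable. The stated probabilities sum to one, so \<open>N\<close> is
  almost surely a natural number although it takes values in \<^typ>\<open>ennreal\<close>.\<close>

lemma poisson_pgf:
  assumes "prob_space M" "m \<ge> 0" "c \<ge> 0"
    and N [measurable]: "N \<in> borel_measurable M"
    and pois: "\<And>k::nat. measure M {\<omega> \<in> space M. N \<omega> = of_nat k} = m ^ k / fact k * exp (- m)"
  shows "(\<integral>\<^sup>+\<omega>. nexp (ennreal c * N \<omega>) \<partial>M) = nexp ((1 - nexp (ennreal c)) * ennreal m)"
proof -
  interpret prob_space M by fact
  let ?E = "\<lambda>k::nat. {\<omega> \<in> space M. N \<omega> = of_nat k}"
  have exp_series: "(\<lambda>k. t ^ k / fact k) sums exp t" for t :: real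
    using exp_converges[of t] by (simp add: divide_inverse mult.commute)
  have "(\<lambda>k. prob (?E k)) sums (exp m * exp (- m))"
    unfolding pois by (intro sums_mult2 exp_series)
  then have "(\<lambda>k. prob (?E k)) sums 1" by (simp flip: exp_add)
  moreover have "(\<lambda>k. prob (?E k)) sums prob (\<Union>k. ?E k)"
    by (rule finite_measure_UNION) (auto simp: disjoint_family_on_def)
  ultimately have "prob (\<Union>k. ?E k) = 1" by (rule sums_unique2[symmetric])
  then have "AE \<omega> in M. \<omega> \<in> (\<Union>k. ?E k)" by (subst (asm) prob_eq_1) auto
  then have AE: "AE \<omega> in M. nexp (ennreal c * N \<omega>)
      = (\<Sum>k. ennreal (exp (- (c * real k))) * indicator (?E k) \<omega>)"
  proof eventually_elim
    case (elim \<omega>)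
    then obtain k where k: "\<omega> \<in> space M" "N \<omega> = of_nat k" by auto
    have "(\<Sum>j. ennreal (exp (- (c * real j))) * indicator (?E j) \<omega>)
        = (\<Sum>j. if j = k then ennreal (exp (- (c * real k))) else 0)"
      using k by (intro suminf_cong) (auto simp: indicator_def)
    also have "\<dots> = ennreal (exp (- (c * real k)))"
      by (rule sums_unique[symmetric], rule sums_single)
    also have "\<dots> = nexp (ennreal c * N \<omega>)"
      using \<open>c \<ge> 0\<close> k by (subst nexp_ennreal[symmetric])
        (auto simp: ennreal_mult ennreal_of_nat_eq_real_of_nat)
    finally show ?case ..
  qed
  have "(\<integral>\<^sup>+\<omega>. nexp (ennreal c * N \<omega>) \<partial>M)
      = (\<Sum>k. ennreal (exp (- (c * real k))) * emeasure M (?E k))"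
    using AE by (subst nn_integral_cong_AE[OF AE]) (simp add: nn_integral_suminf nn_integral_cmult)
  also have "\<dots> = (\<Sum>k. ennreal (exp (- m) * ((exp (- c) * m) ^ k / fact k)))"
  proof (intro suminf_cong)
    fix k
    have c_pow: "exp (- (c * real k)) = exp (- c) ^ k"
      by (simp add: exp_of_nat_mult[symmetric] mult.commute)
    have "ennreal (exp (- (c * real k))) * emeasure M (?E k)
        = ennreal (exp (- (c * real k)) * (m ^ k / fact k * exp (- m)))"
      by (subst ennreal_mult') (simp_all add: emeasure_eq_measure pois)
    then show "ennreal (exp (- (c * real k))) * emeasure M (?E k)
      = ennreal (exp (- m) * ((exp (- c) * m) ^ k / fact k))"
      unfolding c_pow by (simp add: power_mult_distrib mult_ac)
  qed
  also have "\<dots> = ennreal (exp (- m) * exp (exp (- c) * m))"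
    using \<open>m \<ge> 0\<close> sums_mult[OF exp_series, of "exp (- m)" "exp (- c) * m"]
    by (intro suminf_ennreal_eq) auto
  also have "exp (- m) * exp (exp (- c) * m) = exp (- ((1 - exp (- c)) * m))"
    by (simp add: algebra_simps flip: exp_add)
  also have "ennreal \<dots> = nexp (ennreal ((1 - exp (- c)) * m))"
    using \<open>m \<ge> 0\<close> \<open>c \<ge> 0\<close> by (intro nexp_ennreal[symmetric]) auto
  also have "ennreal ((1 - exp (- c)) * m) = (1 - nexp (ennreal c)) * ennreal m"
    using \<open>m \<ge> 0\<close> \<open>c \<ge> 0\<close>
    by (simp add: ennreal_mult'' nexp_ennreal ennreal_minus[symmetric])
  finally show ?thesis .
qed

lemma poisson_points_measurable:
  assumes "poisson_points M \<mu> A" shows "A i \<in> measurable M \<mu>"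
  using assms by (auto simp: poisson_points_def)

text \<open>The formula also holds for sets of infinite measure: the count is then almost surely
  infinite, and both sides are \<open>0\<close> unless \<open>c = 0\<close>.\<close>

lemma poisson_points_nexp_count:
  assumes P: "poisson_points M \<mu> A" and B [measurable]: "B \<in> sets \<mu>" and c: "c < \<infinity>"
  shows "(\<integral>\<^sup>+\<omega>. nexp (c * count_points A B \<omega>) \<partial>M) = nexp ((1 - nexp c) * emeasure \<mu> B)"
proof -
  interpret prob_space M using P by (simp add: poisson_points_def)
  note [measurable] = poisson_points_measurable[OF P]
  have [measurable]: "count_points A B \<in> borel_measurable M"
    unfolding count_points_eq_suminf[abs_def] by measurable
  obtain r where r: "c = ennreal r" "r \<ge> 0" using c by (cases c rule: ennreal_cases) auto
  show ?thesis
  proof (cases "emeasure \<mu> B = \<infinity>")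
    case True
    then have inf: "AE \<omega> in M. count_points A B \<omega> = \<infinity>"
      using P B unfolding poisson_points_def by (metis (no_types, lifting))
    have "(\<integral>\<^sup>+\<omega>. nexp (c * count_points A B \<omega>) \<partial>M) = (\<integral>\<^sup>+\<omega>. nexp (c * \<infinity>) \<partial>M)"
      using inf by (intro nn_integral_cong_AE) auto
    also have "\<dots> = nexp (c * \<infinity>)" by (simp add: emeasure_space_1)
    also have "\<dots> = nexp ((1 - nexp c) * emeasure \<mu> B)"
    proof (cases "c = 0")
      case False
      have "r > 0" using False r by (cases "r = 0") auto
      then have "1 - nexp c = ennreal (1 - exp (- r))" using r
        by (simp add: nexp_ennreal ennreal_minus flip: ennreal_1)
      moreover have "1 - exp (- r) > 0" using \<open>r > 0\<close> by simp
      ultimately show ?thesis using True False by (simp add: ennreal_mult_top)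
    qed simp
    finally show ?thesis .
  next
    case False
    then have "measure M {\<omega> \<in> space M. count_points A B \<omega> = of_nat k}
               = measure \<mu> B ^ k / fact k * exp (- measure \<mu> B)" for k :: nat
      using P B unfolding poisson_points_def by (metis (no_types, lifting))
    from poisson_pgf[OF prob_space_axioms _ \<open>r \<ge> 0\<close> _ this] False show ?thesis
      by (simp add: r emeasure_eq_ennreal_measure)
  qed
qed

text \<open>A simple function splits the space into finitely many disjoint level sets, whose counts
  are independent, so the expectation factorizes into Poisson generating functions.\<close>

lemma poisson_laplace_simple:
  assumes P: "poisson_points M \<mu> A" and f: "simple_function \<mu> f" and fin: "\<And>x. f x < \<infinity>"
  shows "(\<integral>\<^sup>+\<omega>. nexp (\<Sum>i. f (A i \<omega>)) \<partial>M) = nexp (\<integral>\<^sup>+x. 1 - nexp (f x) \<partial>\<mu>)"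
proof -
  interpret prob_space M using P by (simp add: poisson_points_def)
  note [measurable] = poisson_points_measurable[OF P] borel_measurable_simple_function[OF f]
  have finR: "finite (f ` space \<mu>)" using f by (simp add: simple_function_def)
  obtain y n where y: "bij_betw y {..<n::nat} (f ` space \<mu>)"
    using ex_bij_betw_nat_finite[OF finR] by (auto simp: atLeast0LessThan)
  define B where "B j = f -` {y j} \<inter> space \<mu>" for j
  have B [measurable]: "B j \<in> sets \<mu>" for j unfolding B_def by measurable
  have disj: "disjoint_family_on B {..<n}"
    using y by (auto simp: disjoint_family_on_def B_def bij_betw_def inj_on_def)
  have rep: "g (f x) = (\<Sum>j<n. g (y j) * indicator (B j) x)" if "x \<in> space \<mu>" for g :: "ennreal \<Rightarrow> ennreal" and x
  proof -
    obtain k where k: "k < n" "f x = y k" using y \<open>x \<in> space \<mu>\<close> by (force simp: bij_betw_def)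
    have "(\<Sum>j<n. g (y j) * indicator (B j) x) = (\<Sum>j<n. if j = k then g (y k) else 0)"
      using k y that
      by (intro sum.cong) (auto simp: B_def bij_betw_def inj_on_def indicator_def)
    then show ?thesis using k by simp
  qed
  have fin_y: "y j < \<infinity>" if "j < n" for j
  proof -
    have "y j \<in> f ` space \<mu>" using y that by (auto simp: bij_betw_def)
    then show ?thesis using fin by auto
  qed
  have A_sp: "A i \<omega> \<in> space \<mu>" if "\<omega> \<in> space M" for i \<omega>
    using measurable_space[OF poisson_points_measurable[OF P] that] .
  have "(\<Sum>i. f (A i \<omega>)) = (\<Sum>j<n. y j * count_points A (B j) \<omega>)" if "\<omega> \<in> space M" for \<omega>
  proof -
    have "(\<Sum>i. f (A i \<omega>)) = (\<Sum>i. \<Sum>j<n. y j * indicator (B j) (A i \<omega>))"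
      using rep[OF A_sp[OF that], of "\<lambda>x. x"] by simp
    also have "\<dots> = (\<Sum>j<n. \<Sum>i. y j * indicator (B j) (A i \<omega>))"
      by (rule suminf_sum) simp
    finally show ?thesis by (simp add: count_points_eq_suminf)
  qed
  then have "(\<integral>\<^sup>+\<omega>. nexp (\<Sum>i. f (A i \<omega>)) \<partial>M)
      = (\<integral>\<^sup>+\<omega>. (\<Prod>j<n. nexp (y j * count_points A (B j) \<omega>)) \<partial>M)"
    by (intro nn_integral_cong) (simp add: nexp_sum)
  also have "\<dots> = (\<Prod>j<n. \<integral>\<^sup>+\<omega>. nexp (y j * count_points A (B j) \<omega>) \<partial>M)"
  proof (rule indep_vars_nn_integral)
    have "indep_vars (\<lambda>j. borel) (\<lambda>j. count_points A (B j)) {..<n}"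
      using P disj B unfolding poisson_points_def by blast
    then show "indep_vars (\<lambda>_. borel) (\<lambda>j \<omega>. nexp (y j * count_points A (B j) \<omega>)) {..<n}"
      by (rule indep_vars_compose2[where Y = "\<lambda>j x. nexp (y j * x)"]) measurable
  qed auto
  also have "\<dots> = (\<Prod>j<n. nexp ((1 - nexp (y j)) * emeasure \<mu> (B j)))"
    by (intro prod.cong refl poisson_points_nexp_count[OF P B] fin_y) simp
  also have "\<dots> = nexp (\<Sum>j<n. (1 - nexp (y j)) * emeasure \<mu> (B j))"
    by (simp add: nexp_sum)
  also have "(\<Sum>j<n. (1 - nexp (y j)) * emeasure \<mu> (B j))
      = (\<integral>\<^sup>+x. (\<Sum>j<n. (1 - nexp (y j)) * indicator (B j) x) \<partial>\<mu>)"
    by (subst nn_integral_sum) (auto simp: nn_integral_cmult)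
  also have "\<dots> = (\<integral>\<^sup>+x. 1 - nexp (f x) \<partial>\<mu>)"
    using rep[of _ "\<lambda>x. 1 - nexp x"] by (intro nn_integral_cong) simp
  finally show ?thesis .
qed

text \<open>The limit is taken along simple functions increasing to \<open>f\<close>: the sums over the points increase, so
  dominated convergence applies on the left, and \<open>1 - exp(-f)\<close> increases on the right.\<close>

lemma poisson_laplace:
  assumes P: "poisson_points M \<mu> A" and f [measurable]: "f \<in> borel_measurable \<mu>"
  shows "(\<integral>\<^sup>+\<omega>. nexp (\<Sum>i. f (A i \<omega>)) \<partial>M) = nexp (\<integral>\<^sup>+x. 1 - nexp (f x) \<partial>\<mu>)"
proof -
  interpret prob_space M using P by (simp add: poisson_points_def)
  note [measurable] = poisson_points_measurable[OF P]
  obtain g where g: "\<And>n. simple_function \<mu> (g n)" "incseq g" "\<And>n x. g n x < top"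
      "\<And>x. (SUP n. g n x) = f x"
    using borel_measurable_implies_simple_function_sequence'[OF f] by metis
  note [measurable] = borel_measurable_simple_function[OF g(1)]
  have inc: "incseq (\<lambda>n. g n x)" for x
    using g(2) by (auto simp: incseq_def le_fun_def)
  have lim: "(\<lambda>n. g n x) \<longlonglongrightarrow> f x" for x
    using LIMSEQ_SUP[OF inc] g(4) by simp
  have "(\<lambda>n. \<Sum>i. g n (A i \<omega>)) \<longlonglongrightarrow> (\<Sum>i. f (A i \<omega>))" for \<omega>
  proof -
    \<comment> \<open>Monotonicity lets the limit in n pass through the sum over the points.\<close>
    have "(\<lambda>n. \<Sum>i. g n (A i \<omega>)) \<longlonglongrightarrow> (SUP n. \<Sum>i. g n (A i \<omega>))"
      using inc by (intro LIMSEQ_SUP) (auto simp: incseq_def intro!: suminf_le)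
    also have "(SUP n. \<Sum>i. g n (A i \<omega>)) = (\<Sum>i. SUP n. g n (A i \<omega>))"
      using inc by (intro ennreal_suminf_SUP_eq[symmetric])
    finally show ?thesis by (simp add: g(4))
  qed
  then have 1: "(\<lambda>n. \<integral>\<^sup>+\<omega>. nexp (\<Sum>i. g n (A i \<omega>)) \<partial>M)
      \<longlonglongrightarrow> (\<integral>\<^sup>+\<omega>. nexp (\<Sum>i. f (A i \<omega>)) \<partial>M)"
    by (intro nexp_integral_LIMSEQ) auto
  have "(\<lambda>n. \<integral>\<^sup>+x. 1 - nexp (g n x) \<partial>\<mu>) \<longlonglongrightarrow> (\<integral>\<^sup>+x. 1 - nexp (f x) \<partial>\<mu>)"
  proof (rule nn_integral_LIMSEQ)
    show "incseq (\<lambda>n x. 1 - nexp (g n x))"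
      using inc by (auto simp: incseq_def le_fun_def intro!: ennreal_minus_mono nexp_antimono)
    show "(\<lambda>n. 1 - nexp (g n x)) \<longlonglongrightarrow> 1 - nexp (f x)" for x
      by (intro tendsto_diff_ennreal nexp_tendsto lim tendsto_const) auto
  qed measurable
  then have 2: "(\<lambda>n. nexp (\<integral>\<^sup>+x. 1 - nexp (g n x) \<partial>\<mu>)) \<longlonglongrightarrow> nexp (\<integral>\<^sup>+x. 1 - nexp (f x) \<partial>\<mu>)"
    by (rule nexp_tendsto)
  have "(\<integral>\<^sup>+\<omega>. nexp (\<Sum>i. g n (A i \<omega>)) \<partial>M) = nexp (\<integral>\<^sup>+x. 1 - nexp (g n x) \<partial>\<mu>)" for n
    by (rule poisson_laplace_simple[OF P g(1)]) (use g(3) in auto)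
  with 1 2 show ?thesis by (auto intro: LIMSEQ_unique)
qed

section \<open>Independence of families and marked Poisson processes\<close>

lemma path_measurable:
  assumes "\<And>i. i \<in> I \<Longrightarrow> Y i \<in> borel_measurable M"
  shows "path I Y \<in> measurable M (\<Pi>\<^sub>M i\<in>I. borel)"
  unfolding path_def[abs_def] using assms by measurable

lemma indep_copies_measurable:
  "indep_copies S M W N Z \<Longrightarrow> s \<in> S \<Longrightarrow> W i s \<in> borel_measurable M"
  by (auto simp: indep_copies_def eq_law_def process_def)

lemma gen_events_eq_vimage_events: "gen_events M I Y = vimage_events M (\<Pi>\<^sub>M i\<in>I. borel) (path I Y)"
  by (simp add: gen_events_def vimage_events_def)

lemma indep_set_commute:
  assumes "prob_space M" "prob_space.indep_set M E F" shows "prob_space.indep_set M F E"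
proof -
  interpret prob_space M by fact
  show ?thesis using assms(2) by (metis indep_sets2_eq Int_commute mult.commute)
qed

lemma indep_sets_three_pair:
  assumes "prob_space M" and ind: "prob_space.indep_sets M (\<lambda>k. [E, F, G] ! k) {..<3}"
  shows "prob_space.indep_set M E F" "prob_space.indep_set M E G" "prob_space.indep_set M F G"
proof -
  interpret prob_space M by fact
  have sub: "E \<subseteq> events" "F \<subseteq> events" "G \<subseteq> events"
    using ind unfolding indep_sets_def by (auto simp: numeral_3_eq_3 lessThan_Suc)
  have prod: "prob (\<Inter>j\<in>{i, k}. a j) = (\<Prod>j\<in>{i, k}. prob (a j))"
    if "i < 3" "k < 3" "\<forall>j\<in>{i, k}. a j \<in> [E, F, G] ! j" for i k and a :: "nat \<Rightarrow> 'a set"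
    using that by (intro indep_setsD[OF ind]) auto
  show "indep_set E F" unfolding indep_sets2_eq
  proof (intro conjI ballI sub)
    fix x y assume "x \<in> E" "y \<in> F"
    then show "prob (x \<inter> y) = prob x * prob y"
      using prod[of 0 1 "\<lambda>j. if j = 0 then x else y"] by (simp add: Int_commute mult.commute)
  qed
  show "indep_set E G" unfolding indep_sets2_eq
  proof (intro conjI ballI sub)
    fix x y assume "x \<in> E" "y \<in> G"
    then show "prob (x \<inter> y) = prob x * prob y"
      using prod[of 0 2 "\<lambda>j. if j = 0 then x else y"] by (simp add: Int_commute mult.commute)
  qed
  show "indep_set F G" unfolding indep_sets2_eq
  proof (intro conjI ballI sub)
    fix x y assume "x \<in> F" "y \<in> G"
    then show "prob (x \<inter> y) = prob x * prob y"
      using prod[of 1 2 "\<lambda>j. if j = 1 then x else y"] by (simp add: Int_commute mult.commute)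
  qed
qed

text \<open>Joint independence of three elements lets the last two be treated as one. This separates
  the Frechet variables from the pair (points, processes).\<close>

lemma indep_sets_three_join:
  assumes "prob_space M"
    and X: "X \<in> measurable M L1" and Y: "Y \<in> measurable M L2" and Z: "Z \<in> measurable M L3"
    and ind: "prob_space.indep_sets M (\<lambda>k. [vimage_events M L1 X,
        vimage_events M L2 Y, vimage_events M L3 Z] ! k) {..<3}"
  shows "prob_space.indep_set M (vimage_events M L1 X)
    (vimage_events M (L2 \<Otimes>\<^sub>M L3) (\<lambda>\<omega>. (Y \<omega>, Z \<omega>)))"
proof -
  interpret prob_space M by fact
  let ?E = "\<lambda>k. [vimage_events M L1 X, vimage_events M L2 Y,
     vimage_events M L3 Z] ! k"
  let ?I = "\<lambda>b. if b then {0} else {1, 2::nat}"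
  have "(\<Union>b\<in>UNIV. ?I b) = {..<3::nat}" by (auto split: if_splits)
  then have "indep_sets ?E (\<Union>b\<in>UNIV. ?I b)" using ind by simp
  moreover have "Int_stable (?E i)" if "i \<in> ?I b" for i b
    using that by (auto split: if_splits simp: Int_stable_vimage_events)
  ultimately have "indep_sets (\<lambda>b. sigma_sets (space M) (\<Union>i\<in>?I b. ?E i)) UNIV"
    by (intro indep_sets_collect_sigma) (auto simp: disjoint_family_on_def)
  then have "indep_set (sigma_sets (space M) (\<Union>i\<in>?I True. ?E i))
      (sigma_sets (space M) (\<Union>i\<in>?I False. ?E i))"
    unfolding indep_set_def by (elim indep_sets_mono_sets) (auto split: bool.split)
  then have ind': "indep_set (sigma_sets (space M) (?E 0)) (sigma_sets (space M) (?E 1 \<union> ?E 2))"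
    by simp
  define \<Sigma> where "\<Sigma> = sigma (space M) (?E 1 \<union> ?E 2)"
  have [simp]: "space \<Sigma> = space M" by (simp add: \<Sigma>_def space_measure_of_conv)
  have sets_\<Sigma>: "sets \<Sigma> = sigma_sets (space M) (?E 1 \<union> ?E 2)"
    unfolding \<Sigma>_def by (rule sets_measure_of) (auto simp: vimage_events_def)
  have "Y \<in> measurable \<Sigma> L2" using Y
    by (intro measurableI)
       (auto simp: sets_\<Sigma> vimage_events_def dest: measurable_space intro!: sigma_sets.Basic)
  moreover have "Z \<in> measurable \<Sigma> L3" using Z
    by (intro measurableI)
       (auto simp: sets_\<Sigma> vimage_events_def dest: measurable_space intro!: sigma_sets.Basic)
  ultimately have YZ: "(\<lambda>\<omega>. (Y \<omega>, Z \<omega>)) \<in> measurable \<Sigma> (L2 \<Otimes>\<^sub>M L3)" by measurable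
  have sub: "vimage_events M (L2 \<Otimes>\<^sub>M L3) (\<lambda>\<omega>. (Y \<omega>, Z \<omega>)) \<subseteq> sigma_sets (space M) (?E 1 \<union> ?E 2)"
    using measurable_sets[OF YZ] by (auto simp: sets_\<Sigma> vimage_events_def)
  show ?thesis
    unfolding indep_sets2_eq
  proof (intro conjI ballI)
    show "vimage_events M L1 X \<subseteq> events" by (rule vimage_events_subset[OF X])
    show "vimage_events M (L2 \<Otimes>\<^sub>M L3) (\<lambda>\<omega>. (Y \<omega>, Z \<omega>)) \<subseteq> events"
      by (intro vimage_events_subset measurable_Pair Y Z)
    fix a b assume "a \<in> vimage_events M L1 X" "b \<in> vimage_events M (L2 \<Otimes>\<^sub>M L3) (\<lambda>\<omega>. (Y \<omega>, Z \<omega>))"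
    then show "prob (a \<inter> b) = prob a * prob b"
      using ind' sub unfolding indep_sets2_eq by (auto intro: sigma_sets.Basic)
  qed
qed

lemma measurable_intensity: "f \<in> borel_measurable borel \<Longrightarrow> f \<in> borel_measurable intensity"
  unfolding intensity_def by (simp add: measurable_restrict_space1)

lemma space_intensity [simp]: "space intensity = {0<..}"
  by (simp add: intensity_def space_restrict_space)

lemma poisson_points_intensity:
  assumes "poisson_points M intensity A"
  shows "A i \<in> borel_measurable M" "\<omega> \<in> space M \<Longrightarrow> A i \<omega> > 0"
proof -
  have A: "A i \<in> measurable M intensity" by (rule poisson_points_measurable[OF assms])
  then have "(\<lambda>x. x) \<circ> A i \<in> borel_measurable M"
    by (intro measurable_comp[OF A] measurable_intensity) simp
  then show "A i \<in> borel_measurable M" by (simp add: comp_def)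
  show "\<omega> \<in> space M \<Longrightarrow> A i \<omega> > 0" using measurable_space[OF A] by simp
qed

lemma eq_law_nn_integral:
  assumes "eq_law S M X N Y" "finite F" "F \<subseteq> S"
    and [measurable]: "g \<in> borel_measurable (\<Pi>\<^sub>M s\<in>F. borel)"
  shows "(\<integral>\<^sup>+\<omega>. g (path F X \<omega>) \<partial>M) = (\<integral>\<^sup>+\<omega>. g (path F Y \<omega>) \<partial>N)"
proof -
  have [measurable]: "path F X \<in> measurable M (\<Pi>\<^sub>M s\<in>F. borel)" "path F Y \<in> measurable N (\<Pi>\<^sub>M s\<in>F. borel)"
    using assms by (auto simp: eq_law_def process_def intro!: path_measurable)
  have "(\<integral>\<^sup>+\<omega>. g (path F X \<omega>) \<partial>M) = (\<integral>\<^sup>+y. g y \<partial>distr M (\<Pi>\<^sub>M s\<in>F. borel) (path F X))"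
    by (simp add: nn_integral_distr)
  also have "distr M (\<Pi>\<^sub>M s\<in>F. borel) (path F X) = distr N (\<Pi>\<^sub>M s\<in>F. borel) (path F Y)"
    using assms by (auto simp: eq_law_def)
  finally show ?thesis by (simp add: nn_integral_distr)
qed

lemma eq_law_AE:
  assumes "eq_law S M X N Y" "s \<in> S" and [measurable]: "Measurable.pred borel Q"
    and AE: "AE \<omega> in N. Q (Y s \<omega>)"
  shows "AE \<omega> in M. Q (X s \<omega>)"
proof -
  have [measurable]: "X s \<in> borel_measurable M" "Y s \<in> borel_measurable N"
    using assms by (auto simp: eq_law_def process_def)
  have "(\<integral>\<^sup>+\<omega>. indicator {x. \<not> Q x} (X s \<omega>) \<partial>M) = (\<integral>\<^sup>+\<omega>. indicator {x. \<not> Q x} (Y s \<omega>) \<partial>N)"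
    using eq_law_nn_integral[OF assms(1), of "{s}" "\<lambda>x. indicator {x. \<not> Q x} (x s)"] \<open>s \<in> S\<close>
    by (simp add: path_def)
  also have "\<dots> = 0"
    using AE by (subst nn_integral_0_iff_AE) (auto simp: indicator_def)
  finally show ?thesis
    by (subst (asm) nn_integral_0_iff_AE) (auto simp: indicator_eq_0_iff)
qed

text \<open>Freeze the points first. The marks are independent and identically distributed, so the
  conditional expectation is the product over \<open>i\<close> of \<open>L(A(i))\<close>, where \<open>L(a) = E exp(-f(a, Z))\<close>. Written as
  \<open>exp(-\<Sum>i. g(A(i)))\<close> with \<open>g = - ln L\<close>, it falls under the unmarked Laplace functional.\<close>

lemma marked_poisson_laplace:
  assumes P: "poisson_points M intensity A" and C: "indep_copies S M W N Z"
    and ind: "prob_space.indep_set M (gen_events M UNIV A) (copies_events M S W)"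
    and F: "finite F" "F \<subseteq> S" and f [measurable]: "f \<in> borel_measurable (borel \<Otimes>\<^sub>M (\<Pi>\<^sub>M s\<in>F. borel))"
  shows "(\<integral>\<^sup>+\<omega>. nexp (\<Sum>i. f (A i \<omega>, path F (W i) \<omega>)) \<partial>M)
    = nexp (\<integral>\<^sup>+a. 1 - (\<integral>\<^sup>+\<omega>. nexp (f (a, path F Z \<omega>)) \<partial>N) \<partial>intensity)"
proof -
  interpret prob_space M using P by (simp add: poisson_points_def)
  have N: "prob_space N" using C by (auto simp: indep_copies_def eq_law_def process_def)
  interpret N: prob_space N by (rule N)
  have Wm: "W i s \<in> borel_measurable M" if "s \<in> S" for i s
    using indep_copies_measurable[OF C that] .
  have Zm: "Z s \<in> borel_measurable N" if "s \<in> S" for s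
    using C that by (auto simp: indep_copies_def eq_law_def process_def)
  have [measurable]: "path F (W i) \<in> measurable M (\<Pi>\<^sub>M s\<in>F. borel)" for i
    using F by (intro path_measurable Wm) auto
  have [measurable]: "path F Z \<in> measurable N (\<Pi>\<^sub>M s\<in>F. borel)"
    using F by (intro path_measurable Zm) auto
  have [measurable]: "A i \<in> borel_measurable M" for i by (rule poisson_points_intensity[OF P])
  let ?W = "path (UNIV \<times> S) (\<lambda>(i, s). W i s)"
  have ind': "indep_set (vimage_events M (\<Pi>\<^sub>M i\<in>UNIV\<times>S. borel) ?W)
      (vimage_events M (\<Pi>\<^sub>M i\<in>UNIV. borel) (path UNIV A))"
    using indep_set_commute[OF prob_space_axioms ind]
    by (simp add: copies_events_def gen_events_eq_vimage_events)
  have W_path: "?W \<in> measurable M (\<Pi>\<^sub>M i\<in>UNIV\<times>S. borel)"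
    by (intro path_measurable) (auto intro: Wm)
  have A_path: "path UNIV A \<in> measurable M (\<Pi>\<^sub>M i\<in>UNIV. borel)"
    by (intro path_measurable) auto
  have res: "(\<lambda>s\<in>F. ?W \<omega> (i, s)) = path F (W i) \<omega>" for i \<omega>
    using F by (auto simp: path_def fun_eq_iff)
  define L where "L a = (\<integral>\<^sup>+\<omega>. nexp (f (a, path F Z \<omega>)) \<partial>N)" for a
  have [measurable]: "L \<in> borel_measurable borel" unfolding L_def by measurable
  have L_le: "L a \<le> 1" for a unfolding L_def by (rule N.nexp_le_1_integral)
  have inner: "(\<integral>\<^sup>+\<omega>. nexp (\<Sum>i. f (a i, path F (W i) \<omega>)) \<partial>M) = nexp (\<Sum>i. nln (L (a i)))" for a
  proof (rule LIMSEQ_unique)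
    have fin: "(\<integral>\<^sup>+\<omega>. nexp (\<Sum>i<n. f (a i, path F (W i) \<omega>)) \<partial>M) = (\<Prod>i<n. L (a i))" for n
    proof -
      have "(\<integral>\<^sup>+\<omega>. nexp (\<Sum>i<n. f (a i, path F (W i) \<omega>)) \<partial>M)
          = (\<integral>\<^sup>+\<omega>. (\<Prod>i<n. nexp (f (a i, path F (W i) \<omega>))) \<partial>M)"
        by (simp add: nexp_sum)
      also have "\<dots> = (\<Prod>i<n. \<integral>\<^sup>+\<omega>. nexp (f (a i, path F (W i) \<omega>)) \<partial>M)"
      proof (rule indep_vars_nn_integral)
        have "indep_vars (\<lambda>i. \<Pi>\<^sub>M s\<in>S. borel) (\<lambda>i. path S (W i)) {..<n}"
          using C unfolding indep_copies_def by (blast intro: indep_vars_subset)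
        then have "indep_vars (\<lambda>i. borel) (\<lambda>i x. nexp (f (a i, restrict (path S (W i) x) F))) {..<n}"
        proof (rule indep_vars_compose2)
          fix i
          have [measurable]: "(\<lambda>x. restrict x F) \<in> measurable (\<Pi>\<^sub>M s\<in>S. borel) (\<Pi>\<^sub>M s\<in>F. (borel :: real measure))"
            using F by (intro measurable_restrict_subset)
          show "(\<lambda>x. nexp (f (a i, restrict x F))) \<in> borel_measurable (\<Pi>\<^sub>M s\<in>S. borel)"
            by measurable
        qed
        moreover have "restrict (path S (W i) x) F = path F (W i) x" for i x
          using F by (auto simp: path_def fun_eq_iff)
        ultimately show "indep_vars (\<lambda>_. borel) (\<lambda>i \<omega>. nexp (f (a i, path F (W i) \<omega>))) {..<n}"
          by simp
      qed auto
      also have "\<dots> = (\<Prod>i<n. L (a i))"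
        unfolding L_def
      proof (intro prod.cong refl)
        fix i
        have "eq_law S M (W i) N Z" using C by (simp add: indep_copies_def)
        from eq_law_nn_integral[OF this F, of "\<lambda>x. nexp (f (a i, x))"]
        show "(\<integral>\<^sup>+\<omega>. nexp (f (a i, path F (W i) \<omega>)) \<partial>M) = (\<integral>\<^sup>+\<omega>. nexp (f (a i, path F Z \<omega>)) \<partial>N)"
          by simp
      qed
      finally show ?thesis .
    qed
    show "(\<lambda>n. \<integral>\<^sup>+\<omega>. nexp (\<Sum>i<n. f (a i, path F (W i) \<omega>)) \<partial>M)
        \<longlonglongrightarrow> (\<integral>\<^sup>+\<omega>. nexp (\<Sum>i. f (a i, path F (W i) \<omega>)) \<partial>M)"
      by (intro nexp_integral_LIMSEQ summable_LIMSEQ) auto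
    show "(\<lambda>n. \<integral>\<^sup>+\<omega>. nexp (\<Sum>i<n. f (a i, path F (W i) \<omega>)) \<partial>M) \<longlonglongrightarrow> nexp (\<Sum>i. nln (L (a i)))"
      unfolding fin using nexp_suminf[of "\<lambda>i. nln (L (a i))"] by (simp add: nexp_nln L_le)
  qed
  have "(\<integral>\<^sup>+\<omega>. nexp (\<Sum>i. f (A i \<omega>, path F (W i) \<omega>)) \<partial>M)
      = (\<integral>\<^sup>+\<omega>. (\<lambda>(w, a). nexp (\<Sum>i. f (a i, \<lambda>s\<in>F. w (i, s)))) (?W \<omega>, path UNIV A \<omega>) \<partial>M)"
    by (simp only: res prod.case) (simp add: path_def)
  also have "\<dots> = (\<integral>\<^sup>+\<omega>'. (\<integral>\<^sup>+\<omega>. (\<lambda>(w, a). nexp (\<Sum>i. f (a i, \<lambda>s\<in>F. w (i, s)))) (?W \<omega>, path UNIV A \<omega>') \<partial>M) \<partial>M)"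
  proof (rule nn_integral_indep_decouple[OF prob_space_axioms W_path A_path ind'])
    have [measurable]: "(\<lambda>w. w (i, s)) \<in> borel_measurable (\<Pi>\<^sub>M i\<in>UNIV\<times>S. (borel :: real measure))" if "s \<in> F" for i :: nat and s
      using F that by (intro measurable_component_singleton) auto
    show "(\<lambda>(w, a). nexp (\<Sum>i. f (a i, \<lambda>s\<in>F. w (i, s))))
        \<in> borel_measurable ((\<Pi>\<^sub>M i\<in>UNIV\<times>S. borel) \<Otimes>\<^sub>M (\<Pi>\<^sub>M i\<in>UNIV. borel))"
      by measurable
  qed
  also have "\<dots> = (\<integral>\<^sup>+\<omega>'. (\<integral>\<^sup>+\<omega>. nexp (\<Sum>i. f (A i \<omega>', path F (W i) \<omega>)) \<partial>M) \<partial>M)"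
    by (simp only: res prod.case) (simp add: path_def)
  also have "\<dots> = (\<integral>\<^sup>+\<omega>'. nexp (\<Sum>i. nln (L (A i \<omega>'))) \<partial>M)"
    by (simp only: inner)
  also have "\<dots> = nexp (\<integral>\<^sup>+a. 1 - nexp (nln (L a)) \<partial>intensity)"
    by (intro poisson_laplace[OF P] measurable_intensity) measurable
  finally show ?thesis by (simp add: nexp_nln L_le) (simp add: L_def)
qed

section \<open>Integrating out Frechet and stable variables\<close>

text \<open>Both conventions for divergence agree: \<^const>\<open>infsum\<close> and \<^const>\<open>enn2real\<close> return \<open>0\<close>. The right side is
  evidently measurable in the entries.\<close>

lemma lr_norm_eq_enn2real:
  "lr_norm r f = enn2real (\<Sum>i. ennreal (f i powr r)) powr (1 / r)"
proof (cases "summable (\<lambda>i. f i powr r)")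
  case True
  then have "(\<Sum>\<^sub>\<infinity>i. f i powr r) = (\<Sum>i. f i powr r)"
    by (intro infsumI norm_summable_imp_has_sum summable_sums) auto
  moreover have "(\<Sum>i. ennreal (f i powr r)) = ennreal (\<Sum>i. f i powr r)"
    using True by (intro suminf_ennreal2) auto
  ultimately show ?thesis using True by (simp add: lr_norm_def suminf_nonneg)
next
  case False
  then have "\<not> (\<lambda>i. f i powr r) summable_on UNIV"
    by (auto dest: summable_on_imp_summable)
  moreover have "(\<Sum>i. ennreal (f i powr r)) = top"
    by (rule ccontr) (use False summable_suminf_not_top[of "\<lambda>i. f i powr r"] powr_ge_zero in blast)
  ultimately show ?thesis by (simp add: lr_norm_def infsum_not_exists)
qed

text \<open>The common step behind the Frechet and the stable computation: given \<open>Y\<close>, the expectation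
  factorizes over \<open>s\<close>, and \<open>h\<close> records the exponent of each factor.\<close>

lemma indep_product_decouple:
  fixes g :: "'s \<Rightarrow> real \<Rightarrow> 'x \<Rightarrow> ennreal"
  assumes "prob_space M" and U: "prob_space.indep_vars M (\<lambda>s. borel) U S"
    and F: "finite F" "F \<subseteq> S" and Y [measurable]: "Y \<in> measurable M L"
    and ind: "prob_space.indep_set M (gen_events M S U) (vimage_events M L Y)"
    and g [measurable]: "\<And>s. s \<in> F \<Longrightarrow> case_prod (g s) \<in> borel_measurable (borel \<Otimes>\<^sub>M L)"
    and h: "AE \<omega>' in M. \<forall>s\<in>F. (\<integral>\<^sup>+\<omega>. g s (U s \<omega>) (Y \<omega>') \<partial>M) = nexp (h s (Y \<omega>'))"
  shows "(\<integral>\<^sup>+\<omega>. (\<Prod>s\<in>F. g s (U s \<omega>) (Y \<omega>)) \<partial>M) = (\<integral>\<^sup>+\<omega>. nexp (\<Sum>s\<in>F. h s (Y \<omega>)) \<partial>M)"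
proof -
  interpret prob_space M by fact
  have Um: "U s \<in> borel_measurable M" if "s \<in> S" for s using U that by (auto simp: indep_vars_def)
  have U_path: "path S U \<in> measurable M (\<Pi>\<^sub>M s\<in>S. borel)" by (intro path_measurable Um)
  let ?f = "\<lambda>(u, y). \<Prod>s\<in>F. g s (u s) y"
  have [measurable]: "(\<lambda>u. u s) \<in> borel_measurable (\<Pi>\<^sub>M s\<in>S. (borel :: real measure))" if "s \<in> F" for s
    using F that by (intro measurable_component_singleton) auto
  have "(\<lambda>(u, y). g s (u s) y) \<in> borel_measurable ((\<Pi>\<^sub>M s\<in>S. borel) \<Otimes>\<^sub>M L)" if "s \<in> F" for s
    using measurable_compose[OF _ g[OF that], of "\<lambda>(u, y). (u s, y)" "(\<Pi>\<^sub>M s\<in>S. borel) \<Otimes>\<^sub>M L"] that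
    by (simp add: case_prod_beta')
  then have "(\<lambda>z. g s (fst z s) (snd z)) \<in> borel_measurable ((\<Pi>\<^sub>M s\<in>S. borel) \<Otimes>\<^sub>M L)" if "s \<in> F" for s
    using that by (simp add: case_prod_beta')
  then have fm: "?f \<in> borel_measurable ((\<Pi>\<^sub>M s\<in>S. borel) \<Otimes>\<^sub>M L)"
    unfolding case_prod_beta' by (intro borel_measurable_prod_ennreal)
  have pathU: "path S U \<omega> s = U s \<omega>" if "s \<in> F" for s \<omega>
    using F that by (auto simp: path_def)
  have "(\<integral>\<^sup>+\<omega>. (\<Prod>s\<in>F. g s (U s \<omega>) (Y \<omega>)) \<partial>M) = (\<integral>\<^sup>+\<omega>. ?f (path S U \<omega>, Y \<omega>) \<partial>M)"
    by (simp add: pathU cong: prod.cong)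
  also have "\<dots> = (\<integral>\<^sup>+\<omega>'. (\<integral>\<^sup>+\<omega>. ?f (path S U \<omega>, Y \<omega>') \<partial>M) \<partial>M)"
    using ind by (intro nn_integral_indep_decouple[OF prob_space_axioms U_path Y _ fm])
      (simp add: gen_events_eq_vimage_events)
  also have "\<dots> = (\<integral>\<^sup>+\<omega>'. (\<integral>\<^sup>+\<omega>. (\<Prod>s\<in>F. g s (U s \<omega>) (Y \<omega>')) \<partial>M) \<partial>M)"
    by (simp add: pathU cong: prod.cong)
  also have "\<dots> = (\<integral>\<^sup>+\<omega>'. (\<Prod>s\<in>F. \<integral>\<^sup>+\<omega>. g s (U s \<omega>) (Y \<omega>') \<partial>M) \<partial>M)"
  proof (intro nn_integral_cong indep_vars_nn_integral F)
    fix \<omega>' assume "\<omega>' \<in> space M"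
    then have y: "Y \<omega>' \<in> space L" by (rule measurable_space[OF Y])
    show "indep_vars (\<lambda>_. borel) (\<lambda>s \<omega>. g s (U s \<omega>) (Y \<omega>')) F"
    proof (rule indep_vars_compose2[where X = U and M' = "\<lambda>_. borel" and Y = "\<lambda>s x. g s x (Y \<omega>')"])
      show "indep_vars (\<lambda>_. borel) U F" using U F by (blast intro: indep_vars_subset)
      fix s assume "s \<in> F"
      from measurable_compose[OF measurable_Pair[OF measurable_ident_sets[OF refl] measurable_const[OF y]] g[OF this]]
      show "(\<lambda>x. g s x (Y \<omega>')) \<in> borel_measurable borel" by simp
    qed
  qed simp
  also have "\<dots> = (\<integral>\<^sup>+\<omega>'. nexp (\<Sum>s\<in>F. h s (Y \<omega>')) \<partial>M)"
  proof (rule nn_integral_cong_AE)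
    show "AE \<omega>' in M. (\<Prod>s\<in>F. \<integral>\<^sup>+\<omega>. g s (U s \<omega>) (Y \<omega>') \<partial>M) = nexp (\<Sum>s\<in>F. h s (Y \<omega>'))"
      using h by eventually_elim (simp add: nexp_sum)
  qed
  finally show ?thesis .
qed

text \<open>For \<open>n = 0\<close> the event is certain and \<open>0 powr r = 0\<close>, so the formula extends to vanishing
  scale factors.\<close>

lemma frechet_scaled_cdf:
  assumes "prob_space M" and [measurable]: "u \<in> borel_measurable M"
    and cdf: "cdf (distr M borel u) = frechet_cdf r" and "n \<ge> 0" "c > 0" "r > 0"
  shows "(\<integral>\<^sup>+\<omega>. indicator {..c} (u \<omega> * n) \<partial>M) = nexp (ennreal (n powr r / c powr r))"
proof (cases "n = 0")
  case True
  interpret prob_space M by fact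
  show ?thesis using True \<open>c > 0\<close> by (simp add: emeasure_space_1)
next
  case False
  then have n: "n > 0" using \<open>n \<ge> 0\<close> by simp
  interpret prob_space M by fact
  have "(\<integral>\<^sup>+\<omega>. indicator {..c} (u \<omega> * n) \<partial>M) = (\<integral>\<^sup>+\<omega>. indicator {\<omega>\<in>space M. u \<omega> \<le> c / n} \<omega> \<partial>M)"
    using n by (intro nn_integral_cong) (auto simp: indicator_def pos_le_divide_eq)
  also have "\<dots> = emeasure M {\<omega>\<in>space M. u \<omega> \<le> c / n}"
    by (rule nn_integral_indicator) measurable
  also have "\<dots> = ennreal (cdf (distr M borel u) (c / n))"
  proof -
    have "{\<omega>\<in>space M. u \<omega> \<le> c / n} = u -` {..c / n} \<inter> space M" by auto
    then show ?thesis by (simp add: cdf_def emeasure_eq_measure measure_distr)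
  qed
  also have "\<dots> = ennreal (exp (- ((c / n) powr - r)))"
    unfolding cdf using n \<open>c > 0\<close> by (simp add: frechet_cdf_def)
  also have "(c / n) powr - r = n powr r / c powr r"
    using n \<open>c > 0\<close> by (simp add: powr_minus powr_divide field_simps)
  finally show ?thesis by (simp add: nexp_ennreal)
qed

text \<open>An orthant probability of independent scaled Frechet variables is the exponential of a sum of
  \<open>r\<close>-th powers of the scale factors, which is where the \<open>r\<close>-norm of the representation comes from.\<close>

lemma frechet_orthant:
  assumes U: "frechet_family r S M U" and "r > 0"
    and F: "finite F" "F \<subseteq> S" and Y [measurable]: "Y \<in> measurable M L"
    and ind: "prob_space.indep_set M (gen_events M S U) (vimage_events M L Y)"
    and n [measurable]: "\<And>s. s \<in> F \<Longrightarrow> n s \<in> borel_measurable L"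
    and n_nonneg: "AE \<omega> in M. \<forall>s\<in>F. n s (Y \<omega>) \<ge> 0" and c: "\<And>s. s \<in> F \<Longrightarrow> c s > 0"
  shows "emeasure M {\<omega>\<in>space M. \<forall>s\<in>F. U s \<omega> * n s (Y \<omega>) \<le> c s}
    = (\<integral>\<^sup>+\<omega>. nexp (\<Sum>s\<in>F. ennreal (n s (Y \<omega>) powr r / c s powr r)) \<partial>M)"
proof -
  interpret prob_space M using U by (simp add: frechet_family_def)
  have Uiv: "indep_vars (\<lambda>s. borel) U S" using U by (simp add: frechet_family_def)
  have Um [measurable]: "U s \<in> borel_measurable M" if "s \<in> F" for s
    using Uiv that F by (auto simp: indep_vars_def)
  have "emeasure M {\<omega>\<in>space M. \<forall>s\<in>F. U s \<omega> * n s (Y \<omega>) \<le> c s}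
      = (\<integral>\<^sup>+\<omega>. indicator {\<omega>\<in>space M. \<forall>s\<in>F. U s \<omega> * n s (Y \<omega>) \<le> c s} \<omega> \<partial>M)"
    using F by (intro nn_integral_indicator[symmetric]) measurable
  also have "\<dots> = (\<integral>\<^sup>+\<omega>. (\<Prod>s\<in>F. indicator {..c s} (U s \<omega> * n s (Y \<omega>))) \<partial>M)"
  proof (intro nn_integral_cong)
    fix \<omega> assume "\<omega> \<in> space M"
    then show "indicator {\<omega>\<in>space M. \<forall>s\<in>F. U s \<omega> * n s (Y \<omega>) \<le> c s} \<omega>
        = (\<Prod>s\<in>F. indicator {..c s} (U s \<omega> * n s (Y \<omega>)) :: ennreal)"
      using F(1) by (cases "\<forall>s\<in>F. U s \<omega> * n s (Y \<omega>) \<le> c s") (auto simp: indicator_def)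
  qed
  also have "\<dots> = (\<integral>\<^sup>+\<omega>. nexp (\<Sum>s\<in>F. ennreal (n s (Y \<omega>) powr r / c s powr r)) \<partial>M)"
  proof (rule indep_product_decouple[OF prob_space_axioms Uiv F Y ind])
    fix s assume "s \<in> F"
    then show "(\<lambda>(u, y). indicator {..c s} (u * n s y)) \<in> borel_measurable (borel \<Otimes>\<^sub>M L)"
      by measurable
  next
    show "AE \<omega>' in M. \<forall>s\<in>F. (\<integral>\<^sup>+\<omega>. indicator {..c s} (U s \<omega> * n s (Y \<omega>')) \<partial>M)
        = nexp (ennreal (n s (Y \<omega>') powr r / c s powr r))"
      using n_nonneg
    proof eventually_elim
      case (elim \<omega>')
      then show ?case using F c U \<open>r > 0\<close>
        by (auto simp: frechet_family_def intro!: frechet_scaled_cdf prob_space_axioms)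
    qed
  qed
  finally show ?thesis .
qed

text \<open>Integrating out stable variables of index \<open>\<beta>\<close> replaces the coefficients in the exponent by their
  powers of order \<open>\<beta>\<close>.\<close>

lemma stable_sum_laplace:
  assumes T: "stable_family \<beta> S M T"
    and F: "finite F" "F \<subseteq> S" and Y [measurable]: "Y \<in> measurable M L"
    and ind: "prob_space.indep_set M (gen_events M S T) (vimage_events M L Y)"
    and b [measurable]: "\<And>s. s \<in> F \<Longrightarrow> b s \<in> borel_measurable L"
    and b_nonneg: "\<And>s y. b s y \<ge> 0"
  shows "(\<integral>\<^sup>+\<omega>. nexp (\<Sum>s\<in>F. ennreal (T s \<omega> * b s (Y \<omega>))) \<partial>M)
    = (\<integral>\<^sup>+\<omega>. nexp (\<Sum>s\<in>F. ennreal (b s (Y \<omega>) powr \<beta>)) \<partial>M)"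
proof -
  interpret prob_space M using T by (simp add: stable_family_def)
  have Tiv: "indep_vars (\<lambda>s. borel) T S" using T by (simp add: stable_family_def)
  have Tm [measurable]: "T s \<in> borel_measurable M" if "s \<in> F" for s
    using Tiv that F by (auto simp: indep_vars_def)
  show ?thesis
    unfolding nexp_sum[of "\<lambda>s. ennreal (T s _ * b s _)"]
  proof (rule indep_product_decouple[OF prob_space_axioms Tiv F Y ind])
    fix s assume "s \<in> F"
    then show "(\<lambda>(t, y). nexp (ennreal (t * b s y))) \<in> borel_measurable (borel \<Otimes>\<^sub>M L)"
      by measurable
  next
    have "(\<integral>\<^sup>+\<omega>. nexp (ennreal (T s \<omega> * t)) \<partial>M) = nexp (ennreal (t powr \<beta>))"
      if s: "s \<in> F" and t: "t \<ge> 0" for s t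
    proof -
      have [measurable]: "T s \<in> borel_measurable M" by (rule Tm[OF s])
      have pos: "AE \<omega> in M. T s \<omega> > 0"
        and lap: "expectation (\<lambda>\<omega>. exp (- t * T s \<omega>)) = exp (- (t powr \<beta>))"
        using T s F t by (auto simp: stable_family_def)
      have "(\<integral>\<^sup>+\<omega>. nexp (ennreal (T s \<omega> * t)) \<partial>M) = (\<integral>\<^sup>+\<omega>. ennreal (exp (- t * T s \<omega>)) \<partial>M)"
      proof (rule nn_integral_cong_AE)
        show "AE \<omega> in M. nexp (ennreal (T s \<omega> * t)) = ennreal (exp (- t * T s \<omega>))"
          using pos by eventually_elim (use t in \<open>simp add: nexp_ennreal mult.commute\<close>)
      qed
      also have "\<dots> = ennreal (expectation (\<lambda>\<omega>. exp (- t * T s \<omega>)))"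
      proof (rule nn_integral_eq_integral)
        show "integrable M (\<lambda>\<omega>. exp (- t * T s \<omega>))"
        proof (rule integrable_const_bound[where B = 1])
          show "AE \<omega> in M. norm (exp (- t * T s \<omega>)) \<le> 1"
            using pos by eventually_elim (use t in simp)
        qed measurable
      qed simp
      finally show ?thesis unfolding lap by (simp add: nexp_ennreal)
    qed
    then show "AE \<omega>' in M. \<forall>s\<in>F. (\<integral>\<^sup>+\<omega>. nexp (ennreal (T s \<omega> * b s (Y \<omega>'))) \<partial>M)
        = nexp (ennreal (b s (Y \<omega>') powr \<beta>))"
      using b_nonneg by (intro AE_I2) blast
  qed
qed

section \<open>Finite sums over a marked Poisson process\<close>

text \<open>Scale \<open>f\<close> by \<open>1/n\<close>. The exponents of the Laplace functional are dominated by the one of \<open>f\<close> and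
  tend to \<open>0\<close>, so the expectations of \<open>exp(-(1/n) \<Sum>)\<close> tend to \<open>1\<close>, which is impossible if the sum is infinite
  with positive probability.\<close>

lemma marked_poisson_sum_finite:
  assumes P: "poisson_points M intensity A" and C: "indep_copies S M W N Z"
    and ind: "prob_space.indep_set M (gen_events M UNIV A) (copies_events M S W)"
    and F: "finite F" "F \<subseteq> S" and f [measurable]: "f \<in> borel_measurable (borel \<Otimes>\<^sub>M (\<Pi>\<^sub>M s\<in>F. borel))"
    and f_fin: "\<And>z. f z < \<infinity>"
    and fin: "(\<integral>\<^sup>+a. 1 - (\<integral>\<^sup>+\<omega>. nexp (f (a, path F Z \<omega>)) \<partial>N) \<partial>intensity) < \<infinity>"
  shows "AE \<omega> in M. (\<Sum>i. f (A i \<omega>, path F (W i) \<omega>)) < \<infinity>"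
proof -
  interpret prob_space M using P by (simp add: poisson_points_def)
  have N: "prob_space N" using C by (auto simp: indep_copies_def eq_law_def process_def)
  interpret N: prob_space N by (rule N)
  have [measurable]: "path F (W i) \<in> measurable M (\<Pi>\<^sub>M s\<in>F. borel)" for i
    using F by (intro path_measurable indep_copies_measurable[OF C]) auto
  have [measurable]: "path F Z \<in> measurable N (\<Pi>\<^sub>M s\<in>F. borel)"
    using F C by (intro path_measurable) (auto simp: indep_copies_def eq_law_def process_def)
  have [measurable]: "A i \<in> borel_measurable M" for i by (rule poisson_points_intensity[OF P])
  define c where "c n = 1 / real (Suc n)" for n
  have c: "c n > 0" "c n \<le> 1" for n by (auto simp: c_def)
  have c0: "c \<longlonglongrightarrow> 0" unfolding c_def using LIMSEQ_Suc[OF lim_1_over_n] by simp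
  let ?L = "\<lambda>n a. \<integral>\<^sup>+\<omega>. nexp (ennreal (c n) * f (a, path F Z \<omega>)) \<partial>N"
  have L_lim: "(\<lambda>n. ?L n a) \<longlonglongrightarrow> 1" for a
  proof -
    have "(\<lambda>n. ?L n a) \<longlonglongrightarrow> (\<integral>\<^sup>+\<omega>. nexp 0 \<partial>N)"
    proof (rule N.nexp_integral_LIMSEQ)
      fix \<omega>
      obtain t where t: "f (a, path F Z \<omega>) = ennreal t" "t \<ge> 0"
        using f_fin[of "(a, path F Z \<omega>)"] by (cases "f (a, path F Z \<omega>)" rule: ennreal_cases) auto
      have "(\<lambda>n. ennreal (c n * t)) \<longlonglongrightarrow> ennreal (0 * t)"
        by (intro tendsto_ennrealI tendsto_intros c0)
      then show "(\<lambda>n. ennreal (c n) * f (a, path F Z \<omega>)) \<longlonglongrightarrow> 0"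
        using t c(1) by (simp add: ennreal_mult less_imp_le)
    qed measurable
    then show ?thesis by (simp add: N.emeasure_space_1)
  qed
  have "(\<lambda>n. \<integral>\<^sup>+a. 1 - ?L n a \<partial>intensity) \<longlonglongrightarrow> (\<integral>\<^sup>+a. 0 \<partial>intensity)"
  proof (rule nn_integral_dominated_convergence)
    show "(\<lambda>a. 1 - (\<integral>\<^sup>+\<omega>. nexp (f (a, path F Z \<omega>)) \<partial>N)) \<in> borel_measurable intensity"
      by (rule measurable_intensity) measurable
    have "(\<lambda>a. 1 - ?L n a) \<in> borel_measurable borel" for n by measurable
    then show "(\<lambda>a. 1 - ?L n a) \<in> borel_measurable intensity" for n
      by (rule measurable_intensity)
    show "AE a in intensity. 1 - ?L n a \<le> 1 - (\<integral>\<^sup>+\<omega>. nexp (f (a, path F Z \<omega>)) \<partial>N)" for n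
    proof (intro AE_I2 ennreal_minus_mono nn_integral_mono nexp_antimono order_refl)
      fix a \<omega>
      have "ennreal (c n) * f (a, path F Z \<omega>) \<le> 1 * f (a, path F Z \<omega>)"
        using c by (intro mult_right_mono) auto
      then show "ennreal (c n) * f (a, path F Z \<omega>) \<le> f (a, path F Z \<omega>)" by simp
    qed
    show "AE a in intensity. (\<lambda>n. 1 - ?L n a) \<longlonglongrightarrow> 0"
    proof (intro AE_I2)
      fix a
      have "(\<lambda>n. 1 - ?L n a) \<longlonglongrightarrow> 1 - 1"
        by (intro tendsto_diff_ennreal tendsto_const L_lim) auto
      then show "(\<lambda>n. 1 - ?L n a) \<longlonglongrightarrow> 0" by simp
    qed
  qed (use fin in simp_all)
  then have "(\<lambda>n. nexp (\<integral>\<^sup>+a. 1 - ?L n a \<partial>intensity)) \<longlonglongrightarrow> 1"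
    using nexp_tendsto by force
  moreover have "(\<integral>\<^sup>+\<omega>. nexp (ennreal (c n) * (\<Sum>i. f (A i \<omega>, path F (W i) \<omega>))) \<partial>M)
      = nexp (\<integral>\<^sup>+a. 1 - ?L n a \<partial>intensity)" for n
    using marked_poisson_laplace[OF P C ind F, of "\<lambda>z. ennreal (c n) * f z"] by simp
  ultimately show ?thesis
    by (intro AE_finite_if_nexp_integral_tendsto_1[where c = c] c(1)) simp_all
qed

section \<open>Finite-dimensional distributions of the norm representation\<close>

lemma Gamma_norming_pos: "1 < r \<Longrightarrow> 0 < Gamma (1 - 1 / r :: real)"
  by (intro Gamma_real_pos) (simp add: field_simps)

text \<open>The exponent measure of the complement of an orthant for the norm representation with spectral
  process \<open>Z\<close>; the constants \<open>c\<close> absorb the normalization \<open>\<Gamma>(1 - 1/r)\<close>.\<close>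

definition spectral_exponent ::
  "real \<Rightarrow> 's set \<Rightarrow> 'w measure \<Rightarrow> ('s \<Rightarrow> 'w \<Rightarrow> real) \<Rightarrow> ('s \<Rightarrow> real) \<Rightarrow> ennreal" where
  "spectral_exponent r F N Z c = (\<integral>\<^sup>+a. 1 -
     (\<integral>\<^sup>+\<omega>. nexp (\<Sum>s\<in>F. ennreal ((a * Z s \<omega>) powr r / c s powr r)) \<partial>N) \<partial>intensity)"

text \<open>The form in which the exponent results from \<open>marked_poisson_laplace\<close>.\<close>

lemma spectral_exponent_path:
  assumes "F \<subseteq> S"
  shows "spectral_exponent r F N Z c = (\<integral>\<^sup>+a. 1 -
     (\<integral>\<^sup>+\<omega>. nexp ((\<lambda>(a, w). \<Sum>s\<in>F. ennreal ((a * w s) powr r / c s powr r)) (a, path F Z \<omega>)) \<partial>N) \<partial>intensity)"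
  unfolding spectral_exponent_def
  by (intro nn_integral_cong arg_cong2[where f = "(-)"] arg_cong[where f = nexp] sum.cong refl)
     (auto simp: path_def intro!: sum.cong)

lemma spectral_exponent_measurable:
  "(\<lambda>(a, w). \<Sum>s\<in>F. ennreal ((a * w s) powr r / c s powr r))
    \<in> borel_measurable (borel \<Otimes>\<^sub>M (\<Pi>\<^sub>M s\<in>F. borel))"
  by measurable

lemma lr_process_measurable:
  assumes "\<And>i. A i \<in> borel_measurable M" "\<And>i s. s \<in> S \<Longrightarrow> W i s \<in> borel_measurable M"
    "\<And>s. s \<in> S \<Longrightarrow> U s \<in> borel_measurable M" "s \<in> S"
  shows "lr_process r U A W s \<in> borel_measurable M"
proof -
  have [measurable]: "A i \<in> borel_measurable M" "W i s \<in> borel_measurable M" "U s \<in> borel_measurable M" for i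
    using assms by auto
  show ?thesis unfolding lr_process_def[abs_def] lr_norm_eq_enn2real by measurable
qed

lemma lr_ingredients_measurable:
  assumes "lr_ingredients r S M U A W N Z"
  shows "prob_space M" "A i \<in> borel_measurable M" "s \<in> S \<Longrightarrow> W i s \<in> borel_measurable M"
    "s \<in> S \<Longrightarrow> U s \<in> borel_measurable M"
proof -
  show M: "prob_space M" using assms by (simp add: lr_ingredients_def frechet_family_def)
  show "A i \<in> borel_measurable M"
    using assms by (auto simp: lr_ingredients_def intro: poisson_points_intensity)
  show "s \<in> S \<Longrightarrow> W i s \<in> borel_measurable M"
    using assms by (auto simp: lr_ingredients_def intro: indep_copies_measurable)
  show "s \<in> S \<Longrightarrow> U s \<in> borel_measurable M"
    using assms by (auto simp: lr_ingredients_def frechet_family_def prob_space.indep_vars_def[OF M])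
qed

lemma lr_ingredients_indep_pair:
  assumes "lr_ingredients r S M U A W N Z"
  shows "prob_space.indep_set M (gen_events M UNIV A) (copies_events M S W)"
  using assms by (intro indep_sets_three_pair(3)[where E = "gen_events M S U"])
    (auto simp: lr_ingredients_def frechet_family_def)

text \<open>Finiteness of the sums is needed because a divergent one makes \<^const>\<open>lr_process\<close> zero
  instead of infinite.\<close>

lemma lr_process_orthant:
  fixes U :: "'s \<Rightarrow> 'v \<Rightarrow> real"
  assumes r: "1 < r" and I: "lr_ingredients r S M U A W N Z"
    and F: "finite F" "F \<subseteq> S" and x: "\<And>s. s \<in> F \<Longrightarrow> x s > 0"
    and fin: "AE \<omega> in M. \<forall>s\<in>F. (\<Sum>i. ennreal ((A i \<omega> * W i s \<omega>) powr r)) < \<infinity>"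
  shows "emeasure M {\<omega>\<in>space M. \<forall>s\<in>F. lr_process r U A W s \<omega> \<le> x s}
    = nexp (spectral_exponent r F N Z (\<lambda>s. x s * Gamma (1 - 1 / r)))"
proof -
  note I' = lr_ingredients_measurable[OF I]
  interpret prob_space M by (rule I')
  have Um: "U s \<in> borel_measurable M" if "s \<in> S" for s using I'(4) that by auto
  have Wm: "W i s \<in> borel_measurable M" if "s \<in> S" for i s using I'(3) that by auto
  define G where "G = Gamma (1 - 1 / r)"
  define c where "c s = x s * G" for s
  have G: "G > 0" unfolding G_def by (rule Gamma_norming_pos[OF r])
  have c: "c s > 0" if "s \<in> F" for s using x[OF that] G by (simp add: c_def)
  let ?W = "path (UNIV \<times> S) (\<lambda>(i, s). W i s)" and ?A = "path UNIV A"
  let ?L = "(\<Pi>\<^sub>M i\<in>UNIV. borel) \<Otimes>\<^sub>M (\<Pi>\<^sub>M i\<in>UNIV\<times>S. borel) :: ((nat \<Rightarrow> real) \<times> (nat \<times> 's \<Rightarrow> real)) measure"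
  have paths: "path S U \<in> measurable M (\<Pi>\<^sub>M s\<in>S. borel)" "?A \<in> measurable M (\<Pi>\<^sub>M i\<in>UNIV. borel)"
      "?W \<in> measurable M (\<Pi>\<^sub>M i\<in>UNIV\<times>S. borel)"
    by (intro path_measurable; auto intro: I' Um Wm)+
  define Y where "Y \<omega> = (?A \<omega>, ?W \<omega>)" for \<omega>
  have Ym: "Y \<in> measurable M ?L" unfolding Y_def using paths by measurable
  define n where "n s = (\<lambda>(a :: nat \<Rightarrow> real, w). lr_norm r (\<lambda>i. a i * w (i, s)))" for s :: 's
  have nY: "n s (Y \<omega>) = lr_norm r (\<lambda>i. A i \<omega> * W i s \<omega>)" if "s \<in> F" for s \<omega>
    using that F by (auto simp: n_def Y_def path_def)
  have ind: "indep_set (gen_events M S U) (vimage_events M ?L Y)"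
    using indep_sets_three_join[OF prob_space_axioms paths] I
    unfolding lr_ingredients_def copies_events_def gen_events_eq_vimage_events Y_def by simp
  have "emeasure M {\<omega>\<in>space M. \<forall>s\<in>F. lr_process r U A W s \<omega> \<le> x s}
      = emeasure M {\<omega>\<in>space M. \<forall>s\<in>F. U s \<omega> * n s (Y \<omega>) \<le> c s}"
    using G by (intro arg_cong[where f = "emeasure M"] Collect_cong conj_cong ball_cong refl)
      (simp add: lr_process_def nY c_def pos_divide_le_eq flip: G_def)
  also have "\<dots> = (\<integral>\<^sup>+\<omega>. nexp (\<Sum>s\<in>F. ennreal (n s (Y \<omega>) powr r / c s powr r)) \<partial>M)"
  proof (rule frechet_orthant[OF _ _ F Ym ind _ _ c])
    show "frechet_family r S M U" using I by (simp add: lr_ingredients_def)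
    show "r > 0" using r by simp
    fix s assume "s \<in> F"
    then have [measurable]: "(\<lambda>w. w (i, s)) \<in> borel_measurable (\<Pi>\<^sub>M i\<in>UNIV\<times>S. (borel :: real measure))" for i :: nat
      using F by (intro measurable_component_singleton) auto
    show "n s \<in> borel_measurable ?L" unfolding n_def lr_norm_eq_enn2real by measurable
  next
    show "AE \<omega> in M. \<forall>s\<in>F. n s (Y \<omega>) \<ge> 0" by (simp add: nY lr_norm_def)
  qed auto
  also have "\<dots> = (\<integral>\<^sup>+\<omega>. nexp (\<Sum>i. (\<lambda>(a, w). \<Sum>s\<in>F. ennreal ((a * w s) powr r / c s powr r)) (A i \<omega>, path F (W i) \<omega>)) \<partial>M)"
  proof (rule nn_integral_cong_AE)
    show "AE \<omega> in M. nexp (\<Sum>s\<in>F. ennreal (n s (Y \<omega>) powr r / c s powr r))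
      = nexp (\<Sum>i. (\<lambda>(a, w). \<Sum>s\<in>F. ennreal ((a * w s) powr r / c s powr r)) (A i \<omega>, path F (W i) \<omega>))"
      using fin
    proof eventually_elim
      case (elim \<omega>)
      have "ennreal (n s (Y \<omega>) powr r / c s powr r) = (\<Sum>i. ennreal ((A i \<omega> * W i s \<omega>) powr r / c s powr r))"
        if s: "s \<in> F" for s
      proof -
        let ?t = "\<Sum>i. ennreal ((A i \<omega> * W i s \<omega>) powr r)"
        have "n s (Y \<omega>) powr r = enn2real ?t"
          using r by (simp add: nY s lr_norm_eq_enn2real powr_powr)
        then have "ennreal (n s (Y \<omega>) powr r / c s powr r) = ennreal (1 / c s powr r) * ennreal (enn2real ?t)"
          by (subst ennreal_mult[symmetric]) auto
        also have "ennreal (enn2real ?t) = ?t" using elim s by auto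
        also have "ennreal (1 / c s powr r) * ?t = (\<Sum>i. ennreal (1 / c s powr r) * ennreal ((A i \<omega> * W i s \<omega>) powr r))"
          by simp
        also have "\<dots> = (\<Sum>i. ennreal ((A i \<omega> * W i s \<omega>) powr r / c s powr r))"
          by (subst ennreal_mult[symmetric]) auto
        finally show ?thesis .
      qed
      then have "(\<Sum>s\<in>F. ennreal (n s (Y \<omega>) powr r / c s powr r))
          = (\<Sum>s\<in>F. \<Sum>i. ennreal ((A i \<omega> * W i s \<omega>) powr r / c s powr r))"
        by (intro sum.cong) auto
      also have "\<dots> = (\<Sum>i. \<Sum>s\<in>F. ennreal ((A i \<omega> * W i s \<omega>) powr r / c s powr r))"
        by (rule suminf_sum[symmetric]) simp
      finally show ?case by (simp add: path_def)
    qed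
  qed
  also have "\<dots> = nexp (spectral_exponent r F N Z c)"
    unfolding spectral_exponent_path[OF F(2)]
    using I by (intro marked_poisson_laplace[OF _ _ lr_ingredients_indep_pair[OF I] F]
        spectral_exponent_measurable) (auto simp: lr_ingredients_def)
  finally show ?thesis by (simp add: c_def[abs_def] G_def)
qed

lemma lr_sum_finite:
  assumes I: "lr_ingredients r S M U A W N Z" and s: "s \<in> S" and c: "c s > 0"
    and fin: "spectral_exponent r {s} N Z c < \<infinity>"
  shows "AE \<omega> in M. (\<Sum>i. ennreal ((A i \<omega> * W i s \<omega>) powr r)) < \<infinity>"
proof -
  have "{s} \<subseteq> S" using s by simp
  have "AE \<omega> in M. (\<Sum>i. (\<lambda>(a, w). \<Sum>s\<in>{s}. ennreal ((a * w s) powr r / c s powr r)) (A i \<omega>, path {s} (W i) \<omega>)) < \<infinity>"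
    using I s fin unfolding spectral_exponent_path[OF \<open>{s} \<subseteq> S\<close>]
    by (intro marked_poisson_sum_finite[OF _ _ lr_ingredients_indep_pair[OF I] _ _ spectral_exponent_measurable])
       (auto simp: lr_ingredients_def)
  then show ?thesis
  proof eventually_elim
    case (elim \<omega>)
    have "(\<Sum>i. ennreal ((A i \<omega> * W i s \<omega>) powr r))
        = (\<Sum>i. ennreal (c s powr r) * ennreal ((A i \<omega> * W i s \<omega>) powr r / c s powr r))"
      using c by (subst ennreal_mult[symmetric]) auto
    also have "\<dots> = ennreal (c s powr r) * (\<Sum>i. ennreal ((A i \<omega> * W i s \<omega>) powr r / c s powr r))"
      by simp
    also have "\<dots> < \<infinity>" using elim by (simp add: path_def ennreal_mult_less_top)
    finally show ?case .
  qed
qed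

section \<open>Finite-dimensional distributions of the maximum representation\<close>

lemma seq_max_le_iff:
  assumes "\<exists>i. \<forall>j. f j \<le> f i"
  shows "seq_max f \<le> c \<longleftrightarrow> (\<forall>i. f i \<le> c)"
proof -
  obtain i where i: "\<forall>j. f j \<le> f i" using assms by auto
  then have "(GREATEST m. m \<in> range f) = f i"
    by (intro Greatest_equality) auto
  then have "seq_max f = f i" using assms by (simp add: seq_max_def)
  then show ?thesis using i by (auto intro: order_trans)
qed

text \<open>Either the sequence vanishes, or only finitely many terms compete with a given positive one.\<close>

lemma ex_max_if_few_large:
  fixes f :: "nat \<Rightarrow> real"
  assumes nonneg: "\<And>i. f i \<ge> 0" and fin: "\<And>n. finite {i. f i > 1 / real (Suc n)}"
  shows "\<exists>i. \<forall>j. f j \<le> f i"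
proof (cases "\<exists>k. f k > 0")
  case False
  then show ?thesis using nonneg by (metis not_less order_trans)
next
  case True
  then obtain k where "f k > 0" by auto
  then obtain n where n: "1 / real (Suc n) < f k"
    using nat_approx_posE by (metis inverse_eq_divide)
  let ?I = "{i. f i > 1 / real (Suc n)}"
  have ne: "finite (f ` ?I)" "f ` ?I \<noteq> {}" using fin n by auto
  then have "Max (f ` ?I) \<in> f ` ?I" by (rule Max_in)
  then obtain i where i: "i \<in> ?I" "Max (f ` ?I) = f i" by (elim imageE)
  have "f j \<le> f i" for j
  proof (cases "j \<in> ?I")
    case True
    then have "f j \<le> Max (f ` ?I)" using ne by (intro Max_ge imageI)
    then show ?thesis using i(2) by simp
  next
    case False
    then show ?thesis using i(1) by simp
  qed
  then show ?thesis by blast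
qed

lemma seq_max_measurable [measurable (raw)]:
  assumes [measurable]: "\<And>i. g i \<in> borel_measurable M"
  shows "(\<lambda>\<omega>. seq_max (\<lambda>i. g i \<omega>)) \<in> borel_measurable M"
  unfolding borel_measurable_iff_le
proof
  fix c
  have "{\<omega> \<in> space M. seq_max (\<lambda>i. g i \<omega>) \<le> c}
      = {\<omega> \<in> space M. (\<exists>i. \<forall>j. g j \<omega> \<le> g i \<omega>) \<and> (\<forall>i. g i \<omega> \<le> c) \<or> \<not> (\<exists>i. \<forall>j. g j \<omega> \<le> g i \<omega>) \<and> 0 \<le> c}"
  proof (intro Collect_cong conj_cong refl)
    fix \<omega>
    show "seq_max (\<lambda>i. g i \<omega>) \<le> c \<longleftrightarrow>
        ((\<exists>i. \<forall>j. g j \<omega> \<le> g i \<omega>) \<and> (\<forall>i. g i \<omega> \<le> c) \<or> \<not> (\<exists>i. \<forall>j. g j \<omega> \<le> g i \<omega>) \<and> 0 \<le> c)"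
    proof (cases "\<exists>i. \<forall>j. g j \<omega> \<le> g i \<omega>")
      case True
      then show ?thesis using seq_max_le_iff[OF True, of c] by blast
    next
      case False
      then have "seq_max (\<lambda>i. g i \<omega>) = 0" unfolding seq_max_def by (rule if_not_P)
      then show ?thesis using False by (simp del: not_ex not_all)
    qed
  qed
  also have "\<dots> \<in> sets M" by measurable
  finally show "{\<omega> \<in> space M. seq_max (\<lambda>i. g i \<omega>) \<le> c} \<in> sets M" .
qed

lemma max_ingredients_measurable:
  assumes "max_ingredients S P A V R Z"
  shows "prob_space P" "prob_space R" "A i \<in> borel_measurable P" "s \<in> S \<Longrightarrow> V i s \<in> borel_measurable P"
    "s \<in> S \<Longrightarrow> Z s \<in> borel_measurable R"
  using assms
  by (auto simp: max_ingredients_def indep_copies_def eq_law_def process_def intro: poisson_points_intensity)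

text \<open>The process stays below \<open>x\<close> iff no marked point lies in the set where some \<open>a w(s) > x(s)\<close>. This is the
  Laplace functional of a function that is \<open>\<infinity>\<close> on this set and \<open>0\<close> elsewhere. The finiteness assumption
  guarantees that the supremum over the points is attained.\<close>

lemma max_process_orthant:
  fixes V :: "nat \<Rightarrow> 's \<Rightarrow> 'v \<Rightarrow> real"
  assumes I: "max_ingredients S P A V R Z"
    and nonneg: "\<And>s. s \<in> S \<Longrightarrow> AE \<omega> in R. Z s \<omega> \<ge> 0"
    and F: "finite F" "F \<subseteq> S" and x: "\<And>s. s \<in> F \<Longrightarrow> x s > 0"
    and fin: "\<And>s e. s \<in> F \<Longrightarrow> e > 0 \<Longrightarrow>
      (\<integral>\<^sup>+a. 1 - emeasure R {\<omega>\<in>space R. a * Z s \<omega> \<le> e} \<partial>intensity) < \<infinity>"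
  shows "emeasure P {\<omega>\<in>space P. \<forall>s\<in>F. max_process A V s \<omega> \<le> x s}
    = nexp (\<integral>\<^sup>+a. 1 - emeasure R {\<omega>\<in>space R. \<forall>s\<in>F. a * Z s \<omega> \<le> x s} \<partial>intensity)"
proof -
  note I' = max_ingredients_measurable[OF I]
  interpret prob_space P by (rule I')
  interpret R: prob_space R by (rule I')
  have Pp: "poisson_points P intensity A" and C: "indep_copies S P V R Z"
    and ind: "indep_set (gen_events P UNIV A) (copies_events P S V)"
    using I by (auto simp: max_ingredients_def)
  have [measurable]: "A i \<in> borel_measurable P" for i by (rule I')
  have [measurable]: "V i s \<in> borel_measurable P" if "s \<in> F" for i s using I'(4) F that by auto
  have [measurable]: "Z s \<in> borel_measurable R" if "s \<in> F" for s using I'(5) F that by auto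
  have V_nonneg: "AE \<omega> in P. V i s \<omega> \<ge> 0" if "s \<in> F" for i s
    using C F that nonneg[of s]
    by (intro eq_law_AE[of S P "V i" R Z s "\<lambda>x. x \<ge> 0"]) (auto simp: indep_copies_def)
  have few: "AE \<omega> in P. finite {i. A i \<omega> * V i s \<omega> > e}" if s: "s \<in> F" and e: "e > 0" for s e
  proof -
    let ?f = "\<lambda>(a :: real, w :: 's \<Rightarrow> real). indicator {e<..} (a * w s) :: ennreal"
    have "AE \<omega> in P. (\<Sum>i. ?f (A i \<omega>, path {s} (V i) \<omega>)) < \<infinity>"
    proof (rule marked_poisson_sum_finite[OF Pp C ind])
      show "{s} \<subseteq> S" using s F by auto
      show "?f \<in> borel_measurable (borel \<Otimes>\<^sub>M (\<Pi>\<^sub>M s\<in>{s}. borel))" by measurable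
      show "?f z < \<infinity>" for z by (auto simp: indicator_def split: prod.split)
      have "(\<integral>\<^sup>+a. 1 - (\<integral>\<^sup>+\<omega>. nexp (?f (a, path {s} Z \<omega>)) \<partial>R) \<partial>intensity)
        \<le> (\<integral>\<^sup>+a. 1 - emeasure R {\<omega>\<in>space R. a * Z s \<omega> \<le> e} \<partial>intensity)"
      proof (intro nn_integral_mono ennreal_minus_mono order_refl)
        fix a
        have "emeasure R {\<omega>\<in>space R. a * Z s \<omega> \<le> e} = (\<integral>\<^sup>+\<omega>. indicator {\<omega>\<in>space R. a * Z s \<omega> \<le> e} \<omega> \<partial>R)"
          using s by (intro nn_integral_indicator[symmetric]) measurable
        also have "\<dots> \<le> (\<integral>\<^sup>+\<omega>. nexp (?f (a, path {s} Z \<omega>)) \<partial>R)"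
          by (intro nn_integral_mono) (auto simp: indicator_def path_def)
        finally show "emeasure R {\<omega>\<in>space R. a * Z s \<omega> \<le> e} \<le> (\<integral>\<^sup>+\<omega>. nexp (?f (a, path {s} Z \<omega>)) \<partial>R)" .
      qed
      also have "\<dots> < \<infinity>" by (rule fin[OF s e])
      finally show "(\<integral>\<^sup>+a. 1 - (\<integral>\<^sup>+\<omega>. nexp (?f (a, path {s} Z \<omega>)) \<partial>R) \<partial>intensity) < \<infinity>" .
    qed simp
    then show ?thesis
    proof eventually_elim
      case (elim \<omega>)
      have "(\<Sum>i. ?f (A i \<omega>, path {s} (V i) \<omega>)) = (\<integral>\<^sup>+i. indicator {i. A i \<omega> * V i s \<omega> > e} i \<partial>count_space UNIV)"
        by (subst nn_integral_count_space_nat) (auto simp: path_def indicator_def intro!: suminf_cong)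
      then have "emeasure (count_space UNIV) {i. A i \<omega> * V i s \<omega> > e} < \<infinity>"
        using elim by simp
      then show ?case by (auto simp: emeasure_count_space less_top split: if_splits)
    qed
  qed
  let ?B = "\<lambda>(a :: real, w :: 's \<Rightarrow> real). if \<forall>s\<in>F. a * w s \<le> x s then 0 else \<infinity> :: ennreal"
  have Bm: "?B \<in> borel_measurable (borel \<Otimes>\<^sub>M (\<Pi>\<^sub>M s\<in>F. borel))"
    using F by measurable
  have "AE \<omega> in P. \<forall>s\<in>F. \<forall>i. V i s \<omega> \<ge> 0"
    using F V_nonneg by (intro AE_finite_allI) (auto simp: AE_all_countable)
  moreover have "AE \<omega> in P. \<forall>s\<in>F. \<forall>n. finite {i. A i \<omega> * V i s \<omega> > 1 / real (Suc n)}"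
    using F few by (intro AE_finite_allI) (auto simp: AE_all_countable)
  ultimately have AE: "AE \<omega> in P. indicator {\<omega>\<in>space P. \<forall>s\<in>F. max_process A V s \<omega> \<le> x s} \<omega>
      = nexp (\<Sum>i. ?B (A i \<omega>, path F (V i) \<omega>))"
    using AE_space
  proof eventually_elim
    case (elim \<omega>)
    have le: "max_process A V s \<omega> \<le> x s \<longleftrightarrow> (\<forall>i. A i \<omega> * V i s \<omega> \<le> x s)" if "s \<in> F" for s
      unfolding max_process_def
    proof (intro seq_max_le_iff ex_max_if_few_large)
      show "A i \<omega> * V i s \<omega> \<ge> 0" for i
        using elim that poisson_points_intensity(2)[OF Pp, of \<omega> i] by simp
    qed (use elim that in blast)
    have p: "path F (V i) \<omega> s = V i s \<omega>" if "s \<in> F" for i s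
      using that by (simp add: path_def)
    show ?case
    proof (cases "\<forall>s\<in>F. max_process A V s \<omega> \<le> x s")
      case True
      then have "?B (A i \<omega>, path F (V i) \<omega>) = 0" for i using le by (simp add: p)
      then have "(\<Sum>i. ?B (A i \<omega>, path F (V i) \<omega>)) = 0" by simp
      then show ?thesis using True elim by simp
    next
      case False
      then obtain i s where "s \<in> F" "\<not> A i \<omega> * V i s \<omega> \<le> x s" using le by blast
      then have "\<not> (\<forall>s\<in>F. A i \<omega> * path F (V i) \<omega> s \<le> x s)" by (auto simp: p)
      then have "?B (A i \<omega>, path F (V i) \<omega>) = \<infinity>" by simp
      then have "(\<Sum>i. ?B (A i \<omega>, path F (V i) \<omega>)) = \<infinity>"
        using sum_le_suminf[of "\<lambda>i. ?B (A i \<omega>, path F (V i) \<omega>)" "{i}"]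
        by (simp only: summableI finite.intros sum.insert sum.empty empty_iff not_False_eq_True
            add_0_right zero_le infinity_ennreal_def top_unique simp_thms)
      then have "nexp (\<Sum>i. ?B (A i \<omega>, path F (V i) \<omega>)) = 0" by (simp only: nexp_top)
      then show ?thesis using False by simp
    qed
  qed
  have "emeasure P {\<omega>\<in>space P. \<forall>s\<in>F. max_process A V s \<omega> \<le> x s}
      = (\<integral>\<^sup>+\<omega>. indicator {\<omega>\<in>space P. \<forall>s\<in>F. max_process A V s \<omega> \<le> x s} \<omega> \<partial>P)"
    using F unfolding max_process_def by (intro nn_integral_indicator[symmetric]) measurable
  also have "\<dots> = (\<integral>\<^sup>+\<omega>. nexp (\<Sum>i. ?B (A i \<omega>, path F (V i) \<omega>)) \<partial>P)"
    using AE by (rule nn_integral_cong_AE)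
  also have "\<dots> = nexp (\<integral>\<^sup>+a. 1 - (\<integral>\<^sup>+\<omega>. nexp (?B (a, path F Z \<omega>)) \<partial>R) \<partial>intensity)"
    by (rule marked_poisson_laplace[OF Pp C ind F Bm])
  also have "(\<integral>\<^sup>+a. 1 - (\<integral>\<^sup>+\<omega>. nexp (?B (a, path F Z \<omega>)) \<partial>R) \<partial>intensity)
      = (\<integral>\<^sup>+a. 1 - emeasure R {\<omega>\<in>space R. \<forall>s\<in>F. a * Z s \<omega> \<le> x s} \<partial>intensity)"
  proof (intro nn_integral_cong arg_cong2[where f = "(-)"] refl)
    fix a :: real
    have "(\<integral>\<^sup>+\<omega>. nexp (?B (a, path F Z \<omega>)) \<partial>R)
        = (\<integral>\<^sup>+\<omega>. indicator {\<omega>\<in>space R. \<forall>s\<in>F. a * Z s \<omega> \<le> x s} \<omega> \<partial>R)"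
    proof (intro nn_integral_cong)
      fix \<omega> assume "\<omega> \<in> space R"
      then show "nexp (?B (a, path F Z \<omega>)) = indicator {\<omega>\<in>space R. \<forall>s\<in>F. a * Z s \<omega> \<le> x s} \<omega>"
        by (cases "\<forall>s\<in>F. a * Z s \<omega> \<le> x s") (auto simp: path_def)
    qed
    also have "\<dots> = emeasure R {\<omega>\<in>space R. \<forall>s\<in>F. a * Z s \<omega> \<le> x s}"
      using F by (intro nn_integral_indicator) measurable
    finally show "(\<integral>\<^sup>+\<omega>. nexp (?B (a, path F Z \<omega>)) \<partial>R) = emeasure R {\<omega>\<in>space R. \<forall>s\<in>F. a * Z s \<omega> \<le> x s}" .
  qed
  finally show ?thesis .
qed

section \<open>The spectral exponents coincide\<close>

lemma eq_law_sym: "eq_law S M X N Y \<Longrightarrow> eq_law S N Y M X"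
  unfolding eq_law_def by auto

lemma spectral_exponent_eq_law:
  assumes "eq_law S R W' K W0" "finite F" "F \<subseteq> S"
  shows "spectral_exponent r F R W' c = spectral_exponent r F K W0 c"
  unfolding spectral_exponent_path[OF assms(3)]
proof (intro nn_integral_cong arg_cong2[where f = "(-)"] refl eq_law_nn_integral[OF assms])
  show "(\<lambda>w. nexp ((\<lambda>(a, w). \<Sum>s\<in>F. ennreal ((a * w s) powr r / c s powr r)) (a, w)))
      \<in> borel_measurable (\<Pi>\<^sub>M s\<in>F. borel)" for a
    by measurable
qed

text \<open>The event \<open>a V(s) \<le> x(s)\<close> is \<open>U(s) (a W(s)) \<le> x(s) \<Gamma>(1 - 1/p)\<close>, an orthant for the Frechet
  variables with scale factors \<open>a W(s)\<close>.\<close>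

lemma spectral_exponent_frechet_factors:
  assumes p: "1 < p" and R: "frechet_factors p S R U' W' K W0"
    and nonneg: "\<And>s. s \<in> S \<Longrightarrow> AE \<omega> in K. W0 s \<omega> \<ge> 0"
    and F: "finite F" "F \<subseteq> S" and x: "\<And>s. s \<in> F \<Longrightarrow> x s > 0"
  shows "(\<integral>\<^sup>+a. 1 - emeasure R {\<omega>\<in>space R. \<forall>s\<in>F. a * V_process p U' W' s \<omega> \<le> x s} \<partial>intensity)
    = spectral_exponent p F K W0 (\<lambda>s. x s * Gamma (1 - 1 / p))"
proof -
  define G where "G = Gamma (1 - 1 / p)"
  have G: "G > 0" unfolding G_def by (rule Gamma_norming_pos[OF p])
  have U: "frechet_family p S R U'" and W: "eq_law S R W' K W0"
    and ind: "prob_space.indep_set R (gen_events R S U') (gen_events R S W')"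
    using R by (auto simp: frechet_factors_def)
  have W_path: "path S W' \<in> measurable R (\<Pi>\<^sub>M s\<in>S. borel)"
    using W by (intro path_measurable) (auto simp: eq_law_def process_def)
  have "AE \<omega> in R. W' s \<omega> \<ge> 0" if "s \<in> S" for s
    using nonneg[OF that] that by (intro eq_law_AE[OF W, of s "\<lambda>x. x \<ge> 0"]) auto
  then have W_nonneg: "AE \<omega> in R. \<forall>s\<in>F. W' s \<omega> \<ge> 0"
    using F by (intro AE_finite_allI) auto
  have pW: "path S W' \<omega> s = W' s \<omega>" if "s \<in> F" for s \<omega> using that F by (auto simp: path_def)
  have "emeasure R {\<omega>\<in>space R. \<forall>s\<in>F. a * V_process p U' W' s \<omega> \<le> x s}
      = (\<integral>\<^sup>+\<omega>. nexp (\<Sum>s\<in>F. ennreal ((a * W' s \<omega>) powr p / (x s * G) powr p)) \<partial>R)"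
    if a: "a > 0" for a
  proof -
    have "emeasure R {\<omega>\<in>space R. \<forall>s\<in>F. a * V_process p U' W' s \<omega> \<le> x s}
        = emeasure R {\<omega>\<in>space R. \<forall>s\<in>F. U' s \<omega> * (a * path S W' \<omega> s) \<le> x s * G}"
      using G by (intro arg_cong[where f = "emeasure R"] Collect_cong conj_cong ball_cong refl)
        (simp add: V_process_def pW pos_divide_le_eq mult_ac flip: G_def)
    also have "\<dots> = (\<integral>\<^sup>+\<omega>. nexp (\<Sum>s\<in>F. ennreal ((a * path S W' \<omega> s) powr p / (x s * G) powr p)) \<partial>R)"
    proof (rule frechet_orthant[OF U _ F W_path, where n = "\<lambda>s w. a * w s" and c = "\<lambda>s. x s * G"])
      show "p > 0" using p by simp
      show "prob_space.indep_set R (gen_events R S U') (vimage_events R (\<Pi>\<^sub>M s\<in>S. borel) (path S W'))"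
        using ind by (simp add: gen_events_eq_vimage_events)
      show "AE \<omega> in R. \<forall>s\<in>F. a * path S W' \<omega> s \<ge> 0"
        using W_nonneg by eventually_elim (use a in \<open>auto simp: pW\<close>)
      fix s assume s: "s \<in> F"
      then show "x s * G > 0" using x G by simp
      show "(\<lambda>w. a * w s) \<in> borel_measurable (\<Pi>\<^sub>M s\<in>S. borel)"
        using s F by (intro borel_measurable_times measurable_component_singleton) auto
    qed
    finally show ?thesis by (simp add: pW cong: sum.cong)
  qed
  then have "(\<integral>\<^sup>+a. 1 - emeasure R {\<omega>\<in>space R. \<forall>s\<in>F. a * V_process p U' W' s \<omega> \<le> x s} \<partial>intensity)
      = spectral_exponent p F R W' (\<lambda>s. x s * G)"
    unfolding spectral_exponent_def by (intro nn_integral_cong) auto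
  also have "\<dots> = spectral_exponent p F K W0 (\<lambda>s. x s * G)"
    by (rule spectral_exponent_eq_law[OF W F])
  finally show ?thesis by (simp add: G_def)
qed

text \<open>The constants in \<^const>\<open>Wq_process\<close> exchange the normalization \<open>\<Gamma>(1 - 1/q)\<close> for \<open>\<Gamma>(1 - 1/p)\<close>, and
  the stable factor of index \<open>p/q\<close> exchanges \<open>q\<close>-th for \<open>p\<close>-th powers.\<close>

lemma spectral_exponent_stable_factors:
  assumes p: "1 < p" and q: "p < q" and R: "stable_factors (p / q) S R T W' K W0"
    and nonneg: "\<And>s. s \<in> S \<Longrightarrow> AE \<omega> in K. W0 s \<omega> \<ge> 0"
    and F: "finite F" "F \<subseteq> S" and x: "\<And>s. s \<in> F \<Longrightarrow> x s > 0"
  shows "spectral_exponent q F R (Wq_process p q T W') (\<lambda>s. x s * Gamma (1 - 1 / q))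
    = spectral_exponent p F K W0 (\<lambda>s. x s * Gamma (1 - 1 / p))"
proof -
  define G where "G = Gamma (1 - 1 / p)"
  define H where "H = Gamma (1 - 1 / q)"
  have G: "G > 0" unfolding G_def by (rule Gamma_norming_pos[OF p])
  have H: "H > 0" unfolding H_def using p q by (intro Gamma_norming_pos) auto
  have T: "stable_family (p / q) S R T" and W: "eq_law S R W' K W0"
    and ind: "prob_space.indep_set R (gen_events R S T) (gen_events R S W')"
    using R by (auto simp: stable_factors_def)
  have W_path: "path S W' \<in> measurable R (\<Pi>\<^sub>M s\<in>S. borel)"
    using W by (intro path_measurable) (auto simp: eq_law_def process_def)
  have "AE \<omega> in R. W' s \<omega> \<ge> 0" if "s \<in> S" for s
    using nonneg[OF that] that by (intro eq_law_AE[OF W, of s "\<lambda>x. x \<ge> 0"]) auto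
  then have W_nonneg: "AE \<omega> in R. \<forall>s\<in>F. W' s \<omega> \<ge> 0"
    using F by (intro AE_finite_allI) auto
  have T_pos: "AE \<omega> in R. \<forall>s\<in>F. T s \<omega> > 0"
    using F T by (intro AE_finite_allI) (auto simp: stable_family_def)
  have pW: "path S W' \<omega> s = W' s \<omega>" if "s \<in> F" for s \<omega> using that F by (auto simp: path_def)
  have "(\<integral>\<^sup>+\<omega>. nexp (\<Sum>s\<in>F. ennreal ((a * Wq_process p q T W' s \<omega>) powr q / (x s * H) powr q)) \<partial>R)
      = (\<integral>\<^sup>+\<omega>. nexp (\<Sum>s\<in>F. ennreal ((a * W' s \<omega>) powr p / (x s * G) powr p)) \<partial>R)"
    if a: "a > 0" for a
  proof -
    let ?b = "\<lambda>s w. (a * w s / (x s * G)) powr q"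
    have "(\<integral>\<^sup>+\<omega>. nexp (\<Sum>s\<in>F. ennreal ((a * Wq_process p q T W' s \<omega>) powr q / (x s * H) powr q)) \<partial>R)
      = (\<integral>\<^sup>+\<omega>. nexp (\<Sum>s\<in>F. ennreal (T s \<omega> * ?b s (path S W' \<omega>))) \<partial>R)"
    proof (rule nn_integral_cong_AE)
      show "AE \<omega> in R. nexp (\<Sum>s\<in>F. ennreal ((a * Wq_process p q T W' s \<omega>) powr q / (x s * H) powr q))
        = nexp (\<Sum>s\<in>F. ennreal (T s \<omega> * ?b s (path S W' \<omega>)))"
        using W_nonneg T_pos
      proof eventually_elim
        case (elim \<omega>)
        have "(a * Wq_process p q T W' s \<omega>) powr q / (x s * H) powr q = T s \<omega> * ?b s (path S W' \<omega>)"
          if s: "s \<in> F" for s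
        proof -
          have pos: "W' s \<omega> \<ge> 0" "T s \<omega> > 0" "x s > 0" using elim x s by auto
          have "a * Wq_process p q T W' s \<omega> = (x s * H) * (T s \<omega> powr (1 / q) * (a * W' s \<omega> / (x s * G)))"
            using pos G by (simp add: Wq_process_def G_def H_def field_simps)
          also have "\<dots> powr q = (x s * H) powr q * ((T s \<omega> powr (1 / q)) powr q * (a * W' s \<omega> / (x s * G)) powr q)"
            by (simp only: powr_mult)
          also have "(T s \<omega> powr (1 / q)) powr q = T s \<omega>"
            using pos p q by (simp add: powr_powr)
          finally show ?thesis using pos H s by (simp add: pW)
        qed
        then show ?case by (simp cong: sum.cong)
      qed
    qed
    also have "\<dots> = (\<integral>\<^sup>+\<omega>. nexp (\<Sum>s\<in>F. ennreal (?b s (path S W' \<omega>) powr (p / q))) \<partial>R)"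
    proof (rule stable_sum_laplace[OF T F W_path])
      show "prob_space.indep_set R (gen_events R S T) (vimage_events R (\<Pi>\<^sub>M s\<in>S. borel) (path S W'))"
        using ind by (simp add: gen_events_eq_vimage_events)
      fix s assume s: "s \<in> F"
      then have [measurable]: "(\<lambda>w. w s) \<in> borel_measurable (\<Pi>\<^sub>M s\<in>S. (borel :: real measure))"
        using F by (intro measurable_component_singleton) auto
      show "?b s \<in> borel_measurable (\<Pi>\<^sub>M s\<in>S. borel)" by measurable
    qed simp
    also have "\<dots> = (\<integral>\<^sup>+\<omega>. nexp (\<Sum>s\<in>F. ennreal ((a * W' s \<omega>) powr p / (x s * G) powr p)) \<partial>R)"
    proof (rule nn_integral_cong_AE)
      show "AE \<omega> in R. nexp (\<Sum>s\<in>F. ennreal (?b s (path S W' \<omega>) powr (p / q)))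
        = nexp (\<Sum>s\<in>F. ennreal ((a * W' s \<omega>) powr p / (x s * G) powr p))"
        using W_nonneg
      proof eventually_elim
        case (elim \<omega>)
        have "?b s (path S W' \<omega>) powr (p / q) = (a * W' s \<omega>) powr p / (x s * G) powr p" if s: "s \<in> F" for s
        proof -
          have "?b s (path S W' \<omega>) powr (p / q) = (a * W' s \<omega> / (x s * G)) powr p"
            using p q s by (simp add: powr_powr pW)
          then show ?thesis using elim x[OF s] G a s by (simp add: powr_divide)
        qed
        then show ?case by (simp cong: sum.cong)
      qed
    qed
    finally show ?thesis .
  qed
  then have "spectral_exponent q F R (Wq_process p q T W') (\<lambda>s. x s * H)
      = spectral_exponent p F R W' (\<lambda>s. x s * G)"
    unfolding spectral_exponent_def by (intro nn_integral_cong) auto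
  also have "\<dots> = spectral_exponent p F K W0 (\<lambda>s. x s * G)"
    by (rule spectral_exponent_eq_law[OF W F])
  finally show ?thesis by (simp add: G_def H_def)
qed

section \<open>Laws determined by orthants\<close>

lemma sets_PiM_orthants:
  assumes "finite F"
  shows "sets (\<Pi>\<^sub>M s\<in>F. (borel :: real measure)) = sigma_sets (\<Pi>\<^sub>E s\<in>F. UNIV)
    (range (\<lambda>x. {f \<in> \<Pi>\<^sub>E s\<in>F. UNIV. \<forall>s\<in>F. f s \<le> x s}))"
proof -
  let ?P = "{{f \<in> \<Pi>\<^sub>E s\<in>F. UNIV. \<forall>s\<in>j. f s \<in> A s} | A j. j \<in> {F} \<and> A \<in> Pi j (\<lambda>_. range (\<lambda>a :: real. {..a}))}"
  have "sets (\<Pi>\<^sub>M s\<in>F. (borel :: real measure)) = sets (\<Pi>\<^sub>M s\<in>F. sigma UNIV (range (\<lambda>a :: real. {..a})))"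
    by (simp add: borel_eq_atMost)
  also have "\<dots> = sets (sigma (\<Pi>\<^sub>E s\<in>F. UNIV) ?P)"
  proof (rule sets_PiM_sigma)
    have "(\<Union>n::nat. {..real n}) = UNIV" using real_arch_simple by auto
    then show "\<exists>S\<subseteq>range (\<lambda>a :: real. {..a}). countable S \<and> UNIV = \<Union> S"
      by (intro exI[of _ "range (\<lambda>n::nat. {..real n})"]) auto
  qed (use assms in auto)
  also have "\<dots> = sigma_sets (\<Pi>\<^sub>E s\<in>F. UNIV) ?P"
    by (rule sets_measure_of) auto
  also have "?P = range (\<lambda>x. {f \<in> \<Pi>\<^sub>E s\<in>F. UNIV. \<forall>s\<in>F. f s \<le> x s})"
  proof (intro equalityI subsetI)
    fix B assume "B \<in> ?P"
    then obtain A where A: "A \<in> Pi F (\<lambda>_. range (\<lambda>a :: real. {..a}))"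
      "B = {f \<in> \<Pi>\<^sub>E s\<in>F. UNIV. \<forall>s\<in>F. f s \<in> A s}" by auto
    then have "\<forall>s\<in>F. \<exists>a. A s = {..a}" by auto
    then obtain x where "\<forall>s\<in>F. A s = {..x s}" by metis
    then have "B = {f \<in> \<Pi>\<^sub>E s\<in>F. UNIV. \<forall>s\<in>F. f s \<le> x s}" using A(2) by auto
    then show "B \<in> range (\<lambda>x. {f \<in> \<Pi>\<^sub>E s\<in>F. UNIV. \<forall>s\<in>F. f s \<le> x s})" by blast
  next
    fix B assume "B \<in> range (\<lambda>x. {f \<in> \<Pi>\<^sub>E s\<in>F. UNIV. \<forall>s\<in>F. f s \<le> (x s :: real)})"
    then obtain x where "B = {f \<in> \<Pi>\<^sub>E s\<in>F. UNIV. \<forall>s\<in>F. f s \<le> (x s :: real)}" by auto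
    then show "B \<in> ?P"
      by (intro CollectI exI[of _ "\<lambda>s. {..x s}"] exI[of _ F]) auto
  qed
  finally show ?thesis .
qed

lemma emeasure_frechet_cdf:
  assumes "process M S X" "s \<in> S" "cdf (distr M borel (X s)) = frechet_cdf \<alpha>"
  shows "emeasure M {\<omega>\<in>space M. X s \<omega> \<le> y} = ennreal (frechet_cdf \<alpha> y)"
proof -
  interpret prob_space M using assms by (simp add: process_def)
  have [measurable]: "X s \<in> borel_measurable M" using assms by (simp add: process_def)
  have "{\<omega>\<in>space M. X s \<omega> \<le> y} = X s -` {..y} \<inter> space M" by auto
  then have "measure M {\<omega>\<in>space M. X s \<omega> \<le> y} = cdf (distr M borel (X s)) y"
    by (simp add: cdf_def measure_distr)
  then show ?thesis using assms(3) by (simp add: emeasure_eq_measure)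
qed

lemma frechet_family_measurable:
  assumes "frechet_family \<alpha> S M U" "s \<in> S" shows "U s \<in> borel_measurable M"
  using assms by (auto simp: frechet_family_def prob_space.indep_vars_def)

lemma frechet_family_AE_pos:
  assumes U: "frechet_family \<alpha> S M U" and s: "s \<in> S"
  shows "AE \<omega> in M. U s \<omega> > 0"
proof -
  have P: "process M S U" using U by (auto simp: process_def frechet_family_def frechet_family_measurable[OF U])
  have [measurable]: "U s \<in> borel_measurable M" by (rule frechet_family_measurable[OF U s])
  have "cdf (distr M borel (U s)) = frechet_cdf \<alpha>" using U s by (simp add: frechet_family_def)
  then have "emeasure M {\<omega>\<in>space M. \<not> U s \<omega> > 0} = 0"
    using emeasure_frechet_cdf[OF P s, of \<alpha> 0] by (simp add: frechet_cdf_def not_less)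
  then show ?thesis by (intro AE_I'[of "{\<omega>\<in>space M. \<not> U s \<omega> > 0}"]) auto
qed

text \<open>The Frechet marginals settle the orthants with a non-positive corner: letting \<open>x\<close> decrease to
  \<open>0\<close> shows that \<open>Y(s)\<close>, too, is almost surely positive.\<close>

lemma eq_law_orthantI:
  assumes X: "process M S X" and cdf: "\<forall>s\<in>S. cdf (distr M borel (X s)) = frechet_cdf 1"
    and Y: "process N S Y"
    and eq: "\<And>F x. finite F \<Longrightarrow> F \<subseteq> S \<Longrightarrow> (\<And>s. s \<in> F \<Longrightarrow> x s > 0) \<Longrightarrow>
      emeasure M {\<omega>\<in>space M. \<forall>s\<in>F. X s \<omega> \<le> x s} = emeasure N {\<omega>\<in>space N. \<forall>s\<in>F. Y s \<omega> \<le> x s}"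
  shows "eq_law S M X N Y"
  unfolding eq_law_def
proof (intro conjI X Y allI impI; elim conjE)
  fix F assume F: "finite F" "F \<subseteq> S"
  interpret M: prob_space M using X by (simp add: process_def)
  interpret N: prob_space N using Y by (simp add: process_def)
  have Xm [measurable]: "path F X \<in> measurable M (\<Pi>\<^sub>M s\<in>F. borel)"
    using F X by (intro path_measurable) (auto simp: process_def)
  have Ym [measurable]: "path F Y \<in> measurable N (\<Pi>\<^sub>M s\<in>F. borel)"
    using F Y by (intro path_measurable) (auto simp: process_def)
  have X_m: "X s \<in> borel_measurable M" and Y_m: "Y s \<in> borel_measurable N" if "s \<in> S" for s
    using X Y that by (auto simp: process_def)
  let ?O = "\<lambda>x. {f \<in> \<Pi>\<^sub>E s\<in>F. UNIV. \<forall>s\<in>F. f s \<le> (x s :: real)}"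
  have Y0: "emeasure N {\<omega>\<in>space N. Y s \<omega> \<le> 0} = 0" if s: "s \<in> S" for s
  proof -
    have "emeasure N {\<omega>\<in>space N. Y s \<omega> \<le> 0} \<le> ennreal (exp (- real (Suc n)))" for n
    proof -
      have "emeasure N {\<omega>\<in>space N. Y s \<omega> \<le> 0} \<le> emeasure N {\<omega>\<in>space N. Y s \<omega> \<le> 1 / real (Suc n)}"
        using Y_m[OF s] by (intro emeasure_mono) (auto intro: order_trans)
      also have "\<dots> = emeasure M {\<omega>\<in>space M. X s \<omega> \<le> 1 / real (Suc n)}"
        using eq[of "{s}" "\<lambda>_. 1 / real (Suc n)"] s by simp
      also have "\<dots> = ennreal (exp (- real (Suc n)))"
      proof -
        have "(1 / real (Suc n)) powr - 1 = real (Suc n)" by (simp add: powr_minus)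
        then show ?thesis
          using emeasure_frechet_cdf[OF X s, of 1 "1 / real (Suc n)"] cdf s
          by (simp add: frechet_cdf_def del: of_nat_Suc)
      qed
      finally show ?thesis .
    qed
    moreover have "(\<lambda>n. ennreal (exp (- real (Suc n)))) \<longlonglongrightarrow> ennreal 0"
    proof (rule tendsto_ennrealI, rule LIMSEQ_Suc)
      show "(\<lambda>n. exp (- real n)) \<longlonglongrightarrow> 0"
        by (rule filterlim_compose[OF exp_at_bot])
           (simp add: filterlim_uminus_at_bot filterlim_real_sequentially)
    qed
    ultimately have "emeasure N {\<omega>\<in>space N. Y s \<omega> \<le> 0} \<le> ennreal 0"
      by (intro LIMSEQ_le_const) auto
    then show ?thesis by simp
  qed
  have X0: "emeasure M {\<omega>\<in>space M. X s \<omega> \<le> 0} = 0" if s: "s \<in> S" for s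
    using emeasure_frechet_cdf[OF X s, of 1] cdf s by (simp add: frechet_cdf_def)
  have orth: "emeasure M {\<omega>\<in>space M. \<forall>s\<in>F. X s \<omega> \<le> x s} = emeasure N {\<omega>\<in>space N. \<forall>s\<in>F. Y s \<omega> \<le> x s}" for x
  proof (cases "\<forall>s\<in>F. x s > 0")
    case True
    then show ?thesis by (intro eq F) auto
  next
    case False
    then obtain s where s: "s \<in> F" "x s \<le> 0" by (auto simp: not_less)
    have "emeasure M {\<omega>\<in>space M. \<forall>s\<in>F. X s \<omega> \<le> x s} \<le> emeasure M {\<omega>\<in>space M. X s \<omega> \<le> 0}"
      using s F X_m by (intro emeasure_mono) (auto intro: order_trans)
    moreover have "emeasure N {\<omega>\<in>space N. \<forall>s\<in>F. Y s \<omega> \<le> x s} \<le> emeasure N {\<omega>\<in>space N. Y s \<omega> \<le> 0}"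
      using s F Y_m by (intro emeasure_mono) (auto intro: order_trans)
    ultimately show ?thesis using X0[of s] Y0[of s] s F by auto
  qed
  show "distr M (\<Pi>\<^sub>M s\<in>F. borel) (path F X) = distr N (\<Pi>\<^sub>M s\<in>F. borel) (path F Y)"
  proof (rule measure_eqI_generator_eq)
    show "Int_stable (range ?O)"
    proof (rule Int_stableI_image)
      fix x y
      show "\<exists>z\<in>UNIV. ?O x \<inter> ?O y = ?O z"
        by (intro bexI[of _ "\<lambda>s. min (x s) (y s)"]) auto
    qed
    show "range ?O \<subseteq> Pow (\<Pi>\<^sub>E s\<in>F. UNIV)" by auto
    show "sets (distr M (\<Pi>\<^sub>M s\<in>F. borel) (path F X)) = sigma_sets (\<Pi>\<^sub>E s\<in>F. UNIV) (range ?O)"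
      "sets (distr N (\<Pi>\<^sub>M s\<in>F. borel) (path F Y)) = sigma_sets (\<Pi>\<^sub>E s\<in>F. UNIV) (range ?O)"
      by (simp_all add: sets_PiM_orthants[OF F(1)])
    show "range (\<lambda>n::nat. ?O (\<lambda>_. real n)) \<subseteq> range ?O" by auto
    show "(\<Union>n::nat. ?O (\<lambda>_. real n)) = (\<Pi>\<^sub>E s\<in>F. UNIV)"
    proof (intro equalityI subsetI)
      fix f :: "_ \<Rightarrow> real" assume f: "f \<in> (\<Pi>\<^sub>E s\<in>F. UNIV)"
      obtain n where n: "Max (insert 0 (f ` F)) \<le> real n" using real_arch_simple by blast
      have "f s \<le> real n" if "s \<in> F" for s
        using n Max_ge[of "insert 0 (f ` F)" "f s"] F(1) that by auto
      then show "f \<in> (\<Union>n::nat. ?O (\<lambda>_. real n))" using f by auto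
    qed auto
    show "emeasure (distr M (\<Pi>\<^sub>M s\<in>F. borel) (path F X)) (?O (\<lambda>_. real n)) \<noteq> \<infinity>" for n
      by (rule finite_measure.emeasure_finite[OF prob_space.finite_measure, OF M.prob_space_distr[OF Xm], unfolded infinity_ennreal_def[symmetric]])
    fix B assume "B \<in> range ?O"
    then obtain x where B: "B = ?O x" by auto
    have Bs: "B \<in> sets (\<Pi>\<^sub>M s\<in>F. borel)"
      unfolding B sets_PiM_orthants[OF F(1)] by (rule sigma_sets.Basic) auto
    have "path F X -` B \<inter> space M = {\<omega>\<in>space M. \<forall>s\<in>F. X s \<omega> \<le> x s}"
      "path F Y -` B \<inter> space N = {\<omega>\<in>space N. \<forall>s\<in>F. Y s \<omega> \<le> x s}"
      unfolding B by (auto simp: path_def)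
    then show "emeasure (distr M (\<Pi>\<^sub>M s\<in>F. borel) (path F X)) B = emeasure (distr N (\<Pi>\<^sub>M s\<in>F. borel) (path F Y)) B"
      using orth[of x] by (simp add: emeasure_distr[OF Xm Bs] emeasure_distr[OF Ym Bs])
  qed
qed

section \<open>All ingredients give the same law\<close>

text \<open>Here the sums converge for free: the process is almost surely positive since \<open>X\<close> is, and a
  divergent sum would make it zero.\<close>

lemma lr_representation_orthant:
  assumes p: "1 < p" and X: "simple_max_stable M S X"
    and I: "lr_ingredients p S N U A W K W0" and rep: "eq_law S M X N (lr_process p U A W)"
    and F: "finite F" "F \<subseteq> S" and x: "\<And>s. s \<in> F \<Longrightarrow> x s > 0"
  shows "emeasure M {\<omega>\<in>space M. \<forall>s\<in>F. X s \<omega> \<le> x s}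
    = nexp (spectral_exponent p F K W0 (\<lambda>s. x s * Gamma (1 - 1 / p)))"
proof -
  have XP: "process M S X" and cdf: "\<forall>s\<in>S. cdf (distr M borel (X s)) = frechet_cdf 1"
    using X by (auto simp: simple_max_stable_def max_stable_def)
  note I' = lr_ingredients_measurable[OF I]
  have lr_m [measurable]: "lr_process p U A W s \<in> borel_measurable N" if "s \<in> S" for s
    by (rule lr_process_measurable[OF I'(2,3,4) that]) auto
  have fin: "AE \<omega> in N. (\<Sum>i. ennreal ((A i \<omega> * W i s \<omega>) powr p)) < \<infinity>" if s: "s \<in> S" for s
  proof -
    have [measurable]: "X s \<in> borel_measurable M" using XP s by (simp add: process_def)
    have "emeasure M {\<omega>\<in>space M. \<not> X s \<omega> > 0} = 0"
      using emeasure_frechet_cdf[OF XP s, of 1 0] cdf s by (simp add: frechet_cdf_def not_less)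
    then have "AE \<omega> in M. X s \<omega> > 0" by (intro AE_I'[of "{\<omega>\<in>space M. \<not> X s \<omega> > 0}"]) auto
    then have "AE \<omega> in N. lr_process p U A W s \<omega> > 0"
      by (intro eq_law_AE[OF eq_law_sym[OF rep] s, of "\<lambda>x. x > 0"]) auto
    then show ?thesis
    proof eventually_elim
      case (elim \<omega>)
      show ?case
      proof (rule ccontr)
        assume "\<not> (\<Sum>i. ennreal ((A i \<omega> * W i s \<omega>) powr p)) < \<infinity>"
        then have "(\<Sum>i. ennreal ((A i \<omega> * W i s \<omega>) powr p)) = top"
          by (simp add: not_less top_unique)
        then have "lr_process p U A W s \<omega> = 0" by (simp add: lr_process_def lr_norm_eq_enn2real)
        with elim show False by simp
      qed
    qed
  qed
  have "emeasure M {\<omega>\<in>space M. \<forall>s\<in>F. X s \<omega> \<le> x s}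
      = (\<integral>\<^sup>+\<omega>. indicator {f \<in> space (\<Pi>\<^sub>M s\<in>F. borel). \<forall>s\<in>F. f s \<le> x s} (path F X \<omega>) \<partial>M)"
  proof (subst nn_integral_indicator[symmetric])
    have [measurable]: "X s \<in> borel_measurable M" if "s \<in> F" for s using XP F that by (auto simp: process_def)
    show "{\<omega>\<in>space M. \<forall>s\<in>F. X s \<omega> \<le> x s} \<in> sets M" using F by measurable
  qed (auto intro!: nn_integral_cong simp: indicator_def path_def space_PiM)
  also have "\<dots> = (\<integral>\<^sup>+\<omega>. indicator {f \<in> space (\<Pi>\<^sub>M s\<in>F. borel). \<forall>s\<in>F. f s \<le> x s} (path F (lr_process p U A W) \<omega>) \<partial>N)"
  proof (rule eq_law_nn_integral[OF rep F])
    have [measurable]: "{f \<in> space (\<Pi>\<^sub>M s\<in>F. borel). \<forall>s\<in>F. f s \<le> x s} \<in> sets (\<Pi>\<^sub>M s\<in>F. borel)"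
      using F by measurable
    show "indicator {f \<in> space (\<Pi>\<^sub>M s\<in>F. borel). \<forall>s\<in>F. f s \<le> x s} \<in> borel_measurable (\<Pi>\<^sub>M s\<in>F. borel)"
      by measurable
  qed
  also have "\<dots> = emeasure N {\<omega>\<in>space N. \<forall>s\<in>F. lr_process p U A W s \<omega> \<le> x s}"
  proof (subst nn_integral_indicator[symmetric])
    have [measurable]: "lr_process p U A W s \<in> borel_measurable N" if "s \<in> F" for s using lr_m F that by auto
    show "{\<omega>\<in>space N. \<forall>s\<in>F. lr_process p U A W s \<omega> \<le> x s} \<in> sets N" using F by measurable
  qed (auto intro!: nn_integral_cong simp: indicator_def path_def space_PiM)
  also have "\<dots> = nexp (spectral_exponent p F K W0 (\<lambda>s. x s * Gamma (1 - 1 / p)))"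
  proof (rule lr_process_orthant[OF p I F x])
    show "AE \<omega> in N. \<forall>s\<in>F. (\<Sum>i. ennreal ((A i \<omega> * W i s \<omega>) powr p)) < \<infinity>"
      using F fin by (intro AE_finite_allI) auto
  qed
  finally show ?thesis .
qed

text \<open>Comparison with the unit Frechet marginal evaluates the exponent at a single site. Its finiteness is the
  source of all later finiteness statements.\<close>

lemma lr_representation_exponent_single:
  assumes p: "1 < p" and X: "simple_max_stable M S X"
    and I: "lr_ingredients p S N U A W K W0" and rep: "eq_law S M X N (lr_process p U A W)"
    and s: "s \<in> S" and y: "y > 0"
  shows "spectral_exponent p {s} K W0 (\<lambda>_. y * Gamma (1 - 1 / p)) = ennreal (1 / y)"
proof -
  have XP: "process M S X" and cdf: "\<forall>s\<in>S. cdf (distr M borel (X s)) = frechet_cdf 1"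
    using X by (auto simp: simple_max_stable_def max_stable_def)
  have "nexp (spectral_exponent p {s} K W0 (\<lambda>_. y * Gamma (1 - 1 / p))) = emeasure M {\<omega>\<in>space M. X s \<omega> \<le> y}"
    using lr_representation_orthant[OF p X I rep, of "{s}" "\<lambda>_. y"] s y by simp
  also have "\<dots> = nexp (ennreal (1 / y))"
    using emeasure_frechet_cdf[OF XP s, of 1 y] cdf s y
    by (simp add: nexp_ennreal frechet_cdf_def powr_minus field_simps)
  finally show ?thesis by (rule nexp_inj)
qed

lemma max_representation:
  assumes p: "1 < p" and X: "simple_max_stable M S X"
    and nonneg: "\<And>s. s \<in> S \<Longrightarrow> AE \<omega> in K. W0 s \<omega> \<ge> 0"
    and I: "lr_ingredients p S N U A W K W0" and rep: "eq_law S M X N (lr_process p U A W)"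
    and R: "frechet_factors p S R U' W' K W0" and P: "max_ingredients S P A' V R (V_process p U' W')"
  shows "eq_law S M X P (max_process A' V)"
proof (rule eq_law_orthantI)
  show "process M S X" "\<forall>s\<in>S. cdf (distr M borel (X s)) = frechet_cdf 1"
    using X by (auto simp: simple_max_stable_def max_stable_def)
  note P' = max_ingredients_measurable[OF P]
  show "process P S (max_process A' V)"
    unfolding process_def
  proof (intro conjI ballI P')
    fix s assume "s \<in> S"
    then have [measurable]: "V i s \<in> borel_measurable P" "A' i \<in> borel_measurable P" for i
      using P' by auto
    show "max_process A' V s \<in> borel_measurable P" unfolding max_process_def[abs_def] by measurable
  qed
  have V_nonneg: "AE \<omega> in R. V_process p U' W' s \<omega> \<ge> 0" if s: "s \<in> S" for s
  proof -
    have "AE \<omega> in R. U' s \<omega> > 0"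
      using R s by (intro frechet_family_AE_pos) (auto simp: frechet_factors_def)
    moreover have "AE \<omega> in R. W' s \<omega> \<ge> 0"
      using R nonneg[OF s] s
      by (intro eq_law_AE[of S R W' K W0 s "\<lambda>x. x \<ge> 0"]) (auto simp: frechet_factors_def)
    ultimately show ?thesis
      by eventually_elim (use Gamma_norming_pos[OF p] in \<open>auto simp: V_process_def less_imp_le\<close>)
  qed
  fix F and x :: "'b \<Rightarrow> real" assume F: "finite F" "F \<subseteq> S" and x: "\<And>s. s \<in> F \<Longrightarrow> x s > 0"
  have "emeasure P {\<omega>\<in>space P. \<forall>s\<in>F. max_process A' V s \<omega> \<le> x s}
    = nexp (\<integral>\<^sup>+a. 1 - emeasure R {\<omega>\<in>space R. \<forall>s\<in>F. a * V_process p U' W' s \<omega> \<le> x s} \<partial>intensity)"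
  proof (rule max_process_orthant[OF P V_nonneg F x])
    fix s and e :: real assume s: "s \<in> F" and e: "e > 0"
    have "(\<integral>\<^sup>+a. 1 - emeasure R {\<omega>\<in>space R. a * V_process p U' W' s \<omega> \<le> e} \<partial>intensity)
        = spectral_exponent p {s} K W0 (\<lambda>_. e * Gamma (1 - 1 / p))"
      using spectral_exponent_frechet_factors[OF p R nonneg, of "{s}" "\<lambda>_. e"] s F e by auto
    also have "\<dots> < \<infinity>"
      using lr_representation_exponent_single[OF p X I rep _ e, of s] s F by auto
    finally show "(\<integral>\<^sup>+a. 1 - emeasure R {\<omega>\<in>space R. a * V_process p U' W' s \<omega> \<le> e} \<partial>intensity) < \<infinity>" .
  qed auto
  also have "\<dots> = nexp (spectral_exponent p F K W0 (\<lambda>s. x s * Gamma (1 - 1 / p)))"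
    using spectral_exponent_frechet_factors[OF p R nonneg F x] by simp
  finally show "emeasure M {\<omega>\<in>space M. \<forall>s\<in>F. X s \<omega> \<le> x s}
      = emeasure P {\<omega>\<in>space P. \<forall>s\<in>F. max_process A' V s \<omega> \<le> x s}"
    using lr_representation_orthant[OF p X I rep F x] by simp
qed

lemma lr_representation_change_norm:
  assumes p: "1 < p" and q: "p < q" and X: "simple_max_stable M S X"
    and nonneg: "\<And>s. s \<in> S \<Longrightarrow> AE \<omega> in K. W0 s \<omega> \<ge> 0"
    and I: "lr_ingredients p S N U A W K W0" and rep: "eq_law S M X N (lr_process p U A W)"
    and R: "stable_factors (p / q) S R T W' K W0"
    and P: "lr_ingredients q S P Uq A' Wq R (Wq_process p q T W')"
  shows "eq_law S M X P (lr_process q Uq A' Wq)"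
proof (rule eq_law_orthantI)
  show "process M S X" "\<forall>s\<in>S. cdf (distr M borel (X s)) = frechet_cdf 1"
    using X by (auto simp: simple_max_stable_def max_stable_def)
  note P' = lr_ingredients_measurable[OF P]
  have q1: "1 < q" using p q by simp
  show "process P S (lr_process q Uq A' Wq)"
    unfolding process_def
  proof (intro conjI ballI P'(1))
    fix s assume s: "s \<in> S"
    show "lr_process q Uq A' Wq s \<in> borel_measurable P"
      by (rule lr_process_measurable[OF P'(2,3,4) s]) auto
  qed
  fix F and x :: "'b \<Rightarrow> real" assume F: "finite F" "F \<subseteq> S" and x: "\<And>s. s \<in> F \<Longrightarrow> x s > 0"
  have "emeasure P {\<omega>\<in>space P. \<forall>s\<in>F. lr_process q Uq A' Wq s \<omega> \<le> x s}
    = nexp (spectral_exponent q F R (Wq_process p q T W') (\<lambda>s. x s * Gamma (1 - 1 / q)))"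
  proof (rule lr_process_orthant[OF q1 P F x])
    have "AE \<omega> in P. (\<Sum>i. ennreal ((A' i \<omega> * Wq i s \<omega>) powr q)) < \<infinity>" if s: "s \<in> S" for s
    proof (rule lr_sum_finite[OF P s])
      show "1 * Gamma (1 - 1 / q) > 0" using Gamma_norming_pos[OF q1] by simp
      show "spectral_exponent q {s} R (Wq_process p q T W') (\<lambda>_. 1 * Gamma (1 - 1 / q)) < \<infinity>"
        using spectral_exponent_stable_factors[OF p q R nonneg, of "{s}" "\<lambda>_. 1"] s
          lr_representation_exponent_single[OF p X I rep s, of 1] by simp
    qed
    then show "AE \<omega> in P. \<forall>s\<in>F. (\<Sum>i. ennreal ((A' i \<omega> * Wq i s \<omega>) powr q)) < \<infinity>"
      using F by (intro AE_finite_allI) auto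
  qed
  also have "\<dots> = nexp (spectral_exponent p F K W0 (\<lambda>s. x s * Gamma (1 - 1 / p)))"
    using spectral_exponent_stable_factors[OF p q R nonneg F x] by simp
  finally show "emeasure M {\<omega>\<in>space M. \<forall>s\<in>F. X s \<omega> \<le> x s}
      = emeasure P {\<omega>\<in>space P. \<forall>s\<in>F. lr_process q Uq A' Wq s \<omega> \<le> x s}"
    using lr_representation_orthant[OF p X I rep F x] by simp
qed

section \<open>A positive stable variable from Poisson points\<close>

lemma nn_integral_intensity:
  assumes [measurable]: "g \<in> borel_measurable borel"
  shows "(\<integral>\<^sup>+a. g a \<partial>intensity) = (\<integral>\<^sup>+a. indicator {0<..} a * (ennreal (1 / a\<^sup>2) * g a) \<partial>lborel)"
proof -
  have m: "h \<in> borel_measurable (restrict_space lborel {0<..})" if "h \<in> borel_measurable borel" for h :: "real \<Rightarrow> ennreal"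
    using that by (intro measurable_restrict_space1) simp
  have "(\<integral>\<^sup>+a. g a \<partial>intensity) = (\<integral>\<^sup>+a. ennreal (1 / a\<^sup>2) * g a \<partial>restrict_space lborel {0<..})"
    unfolding intensity_def by (intro nn_integral_density m) measurable
  also have "\<dots> = (\<integral>\<^sup>+a. (ennreal (1 / a\<^sup>2) * g a) * indicator {0<..} a \<partial>lborel)"
    by (intro nn_integral_restrict_space) simp
  finally show ?thesis by (simp add: mult.commute)
qed

text \<open>The intensity \<open>a\<^sup>-\<^sup>2 da\<close> is homogeneous of order \<open>-1\<close>.\<close>

lemma nn_integral_intensity_scale:
  assumes [measurable]: "g \<in> borel_measurable borel" and c: "c > 0"
  shows "(\<integral>\<^sup>+a. g (c * a) \<partial>intensity) = ennreal c * (\<integral>\<^sup>+a. g a \<partial>intensity)"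
proof -
  have "ennreal c * (\<integral>\<^sup>+a. g a \<partial>intensity)
      = ennreal c * (ennreal c * (\<integral>\<^sup>+a. indicator {0<..} (c * a) * (ennreal (1 / (c * a)\<^sup>2) * g (c * a)) \<partial>lborel))"
    using c nn_integral_real_affine[of "\<lambda>a. indicator {0<..} a * (ennreal (1 / a\<^sup>2) * g a)" c 0]
    by (simp add: nn_integral_intensity)
  also have "\<dots> = (\<integral>\<^sup>+a. ennreal c * (ennreal c * (indicator {0<..} (c * a) * (ennreal (1 / (c * a)\<^sup>2) * g (c * a)))) \<partial>lborel)"
    by (simp add: nn_integral_cmult)
  also have "\<dots> = (\<integral>\<^sup>+a. indicator {0<..} a * (ennreal (1 / a\<^sup>2) * g (c * a)) \<partial>lborel)"
  proof (intro nn_integral_cong)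
    fix a :: real
    have "ennreal c * (ennreal c * ennreal (1 / (c * a)\<^sup>2)) = ennreal (c * (c * (1 / (c * a)\<^sup>2)))"
      using c by (simp only: ennreal_mult' less_imp_le)
    also have "c * (c * (1 / (c * a)\<^sup>2)) = 1 / a\<^sup>2"
      using c by (simp add: power2_eq_square)
    finally have "ennreal c * (ennreal c * ennreal (1 / (c * a)\<^sup>2)) = ennreal (1 / a\<^sup>2)" .
    moreover have "indicator {0<..} (c * a) = (indicator {0<..} a :: ennreal)"
      using c by (simp add: indicator_def zero_less_mult_iff)
    moreover have "ennreal c * (ennreal c * (indicator {0<..} (c * a) * (ennreal (1 / (c * a)\<^sup>2) * g (c * a))))
        = indicator {0<..} (c * a) * ((ennreal c * (ennreal c * ennreal (1 / (c * a)\<^sup>2))) * g (c * a))"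
      by (simp only: ac_simps)
    ultimately show "ennreal c * (ennreal c * (indicator {0<..} (c * a) * (ennreal (1 / (c * a)\<^sup>2) * g (c * a))))
        = indicator {0<..} a * (ennreal (1 / a\<^sup>2) * g (c * a))"
      by (simp only:)
  qed
  also have "\<dots> = (\<integral>\<^sup>+a. g (c * a) \<partial>intensity)"
    by (simp add: nn_integral_intensity)
  finally show ?thesis ..
qed

text \<open>The integral \<open>\<integral> (1 - exp(-a\<^sup>r)) a\<^sup>-\<^sup>2 da\<close> converges at \<open>0\<close> because \<open>1 - exp(-a\<^sup>r) \<le> a\<^sup>r\<close> with \<open>r > 1\<close>, and
  at infinity because the integrand is at most \<open>a\<^sup>-\<^sup>2\<close>.\<close>

lemma stable_constant:
  assumes r: "1 < r"
  shows "\<exists>J>0. (\<integral>\<^sup>+a. 1 - nexp (ennreal (a powr r)) \<partial>intensity) = ennreal J"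
proof -
  let ?g = "\<lambda>a. 1 - nexp (ennreal (a powr r))"
  let ?I = "\<integral>\<^sup>+a. ?g a \<partial>intensity"
  have g: "?g a = ennreal (1 - exp (- (a powr r)))" for a
    by (simp add: nexp_ennreal ennreal_minus flip: ennreal_1)
  have int0: "(\<integral>\<^sup>+a. ennreal (a powr (r - 2)) * indicator {0..1} a \<partial>lborel) = ennreal (1 / (r - 1))"
    using nn_integral_has_integral_lebesgue'[OF _ has_integral_powr_from_0[of "r - 2" 1]] r by simp
  have int1: "(\<integral>\<^sup>+a. ennreal (a powr - 2) * indicator {1..} a \<partial>lborel) = ennreal 1"
    using nn_integral_has_integral_lebesgue'[OF _ has_integral_powr_to_inf[of "- 2" 1]] by simp
  have "?I = (\<integral>\<^sup>+a. indicator {0<..} a * (ennreal (1 / a\<^sup>2) * ?g a) \<partial>lborel)"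
    by (rule nn_integral_intensity) measurable
  also have "\<dots> \<le> (\<integral>\<^sup>+a. ennreal (a powr (r - 2)) * indicator {0..1} a + ennreal (a powr - 2) * indicator {1..} a \<partial>lborel)"
  proof (intro nn_integral_mono)
    fix a :: real
    show "indicator {0<..} a * (ennreal (1 / a\<^sup>2) * ?g a)
        \<le> ennreal (a powr (r - 2)) * indicator {0..1} a + ennreal (a powr - 2) * indicator {1..} a"
    proof (cases "a > 0")
      case True
      have sq: "1 / a\<^sup>2 = a powr - 2" using True by (simp add: powr_minus powr_numeral field_simps)
      show ?thesis
      proof (cases "a \<le> 1")
        case a: True
        have "1 / a\<^sup>2 * (1 - exp (- (a powr r))) \<le> a powr - 2 * a powr r"
          unfolding sq using exp_ge_add_one_self[of "- (a powr r)"] by (intro mult_left_mono) auto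
        also have "\<dots> = a powr (r - 2)" by (simp add: powr_add[symmetric])
        finally have "ennreal (1 / a\<^sup>2 * (1 - exp (- (a powr r)))) \<le> ennreal (a powr (r - 2))"
          by (rule ennreal_leI)
        then have "indicator {0<..} a * (ennreal (1 / a\<^sup>2) * ?g a) \<le> ennreal (a powr (r - 2)) * indicator {0..1} a"
          using True a unfolding g by (subst ennreal_mult[symmetric]) auto
        then show ?thesis by (rule order_trans) simp
      next
        case False
        have "ennreal (1 / a\<^sup>2) * ?g a \<le> ennreal (a powr - 2) * 1"
          unfolding sq using diff_le_self_ennreal by (intro mult_left_mono) auto
        then show ?thesis using False True by simp
      qed
    qed simp
  qed
  also have "\<dots> = ennreal (1 / (r - 1)) + ennreal 1"
    by (subst nn_integral_add) (simp_all add: int0 int1)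
  also have "\<dots> < \<infinity>" by simp
  finally have fin: "?I < \<infinity>" .
  have "?I \<noteq> 0"
  proof
    assume "?I = 0"
    then have "(\<integral>\<^sup>+a. indicator {0<..} a * (ennreal (1 / a\<^sup>2) * ?g a) \<partial>lborel) = 0"
      by (subst (asm) nn_integral_intensity) auto
    then have "AE a in lborel. indicator {0<..} a * (ennreal (1 / a\<^sup>2) * ?g a) = 0"
      by (subst (asm) nn_integral_0_iff_AE) auto
    then have "AE a in lborel. a \<notin> {0<..1::real}"
    proof eventually_elim
      case (elim a)
      show ?case
      proof
        assume a: "a \<in> {0<..1}"
        then have "a powr r > 0" by simp
        then have "?g a > 0" unfolding g by simp
        moreover have "ennreal (1 / a\<^sup>2) > 0" using a by simp
        ultimately show False using elim a by simp
      qed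
    qed
    then have "emeasure lborel {0<..1::real} = 0"
      by (subst (asm) AE_iff_measurable[of "{0<..1}"]) auto
    then show False by simp
  qed
  then have "enn2real ?I > 0" "?I = ennreal (enn2real ?I)"
    using fin by (auto simp: enn2real_positive_iff less_top zero_less_iff_neq_zero)
  then show ?thesis by blast
qed

text \<open>For \<open>r = 1/\<beta>\<close>, the Laplace functional and the homogeneity of the intensity give
  \<open>E exp(-t \<kappa> \<Sum>i. A(i)\<^sup>r) = exp(-(t \<kappa>)\<^sup>\<beta> J)\<close>, where \<open>J\<close> is the constant of the previous lemma; choosing \<open>\<kappa>\<close>
  with \<open>\<kappa>\<^sup>\<beta> J = 1\<close> gives the standard stable law.\<close>

lemma stable_variable_exists:
  fixes \<beta> :: real
  assumes P: "poisson_points N intensity A" and \<beta>: "0 < \<beta>" "\<beta> < 1"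
  shows "\<exists>\<tau>\<in>borel_measurable N. (AE \<omega> in N. \<tau> \<omega> > 0) \<and>
     (\<forall>t\<ge>0. prob_space.expectation N (\<lambda>\<omega>. exp (- t * \<tau> \<omega>)) = exp (- (t powr \<beta>)))"
proof -
  interpret prob_space N using P by (simp add: poisson_points_def)
  have [measurable]: "A i \<in> borel_measurable N" for i by (rule poisson_points_intensity[OF P])
  define r where "r = 1 / \<beta>"
  have r: "1 < r" using \<beta> by (simp add: r_def)
  obtain J where J: "J > 0" "(\<integral>\<^sup>+a. 1 - nexp (ennreal (a powr r)) \<partial>intensity) = ennreal J"
    using stable_constant[OF r] by auto
  \<comment> \<open>chosen so that \<open>\<kappa>\<^sup>\<beta> J = 1\<close>\<close>
  define \<kappa> where "\<kappa> = J powr - r"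
  have \<kappa>: "\<kappa> > 0" using J by (simp add: \<kappa>_def)
  have "- r * \<beta> = - 1" using \<beta> by (simp add: r_def)
  then have "\<kappa> powr \<beta> = J powr - 1" unfolding \<kappa>_def powr_powr by (simp only:)
  then have \<kappa>J: "\<kappa> powr \<beta> * J = 1" using J by (simp add: powr_minus)
  define Z where "Z \<omega> = (\<Sum>i. ennreal (\<kappa> * A i \<omega> powr r))" for \<omega>
  have [measurable]: "Z \<in> borel_measurable N" unfolding Z_def by measurable
  have lap: "(\<integral>\<^sup>+\<omega>. nexp (ennreal t * Z \<omega>) \<partial>N) = nexp (ennreal (t powr \<beta>))" if t: "t > 0" for t
  proof -
    let ?c = "(t * \<kappa>) powr \<beta>"
    have c: "?c > 0" using t \<kappa> by simp
    have "(\<integral>\<^sup>+\<omega>. nexp (ennreal t * Z \<omega>) \<partial>N) = (\<integral>\<^sup>+\<omega>. nexp (\<Sum>i. ennreal (t * \<kappa> * A i \<omega> powr r)) \<partial>N)"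
    proof (intro nn_integral_cong arg_cong[where f = nexp])
      fix \<omega>
      have "ennreal (t * \<kappa> * A i \<omega> powr r) = ennreal t * ennreal (\<kappa> * A i \<omega> powr r)" for i
        using t by (simp only: mult.assoc ennreal_mult' less_imp_le)
      then show "ennreal t * Z \<omega> = (\<Sum>i. ennreal (t * \<kappa> * A i \<omega> powr r))"
        by (simp add: Z_def)
    qed
    also have "\<dots> = nexp (\<integral>\<^sup>+a. 1 - nexp (ennreal (t * \<kappa> * a powr r)) \<partial>intensity)"
      by (intro poisson_laplace[OF P] measurable_intensity) measurable
    also have "(\<integral>\<^sup>+a. 1 - nexp (ennreal (t * \<kappa> * a powr r)) \<partial>intensity)
        = (\<integral>\<^sup>+a. 1 - nexp (ennreal ((?c * a) powr r)) \<partial>intensity)"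
      using t \<kappa> \<beta> by (simp add: powr_mult powr_powr r_def)
    also have "\<dots> = ennreal ?c * ennreal J"
      using c J by (subst nn_integral_intensity_scale[of "\<lambda>a. 1 - nexp (ennreal (a powr r))"]) auto
    also have "\<dots> = ennreal (t powr \<beta>)"
      using J t \<kappa> \<kappa>J by (simp add: powr_mult mult.assoc flip: ennreal_mult)
    finally show ?thesis .
  qed
  have fin: "AE \<omega> in N. Z \<omega> < \<infinity>"
  proof (rule AE_finite_if_nexp_integral_tendsto_1)
    show "1 / real (Suc n) > 0" for n by simp
    have "(\<lambda>n. (1 / real (Suc n)) powr \<beta>) \<longlonglongrightarrow> 0"
      using \<beta> LIMSEQ_Suc[OF lim_1_over_n] by (intro tendsto_zero_powrI[where b = \<beta>]) auto
    then have "(\<lambda>n. nexp (ennreal ((1 / real (Suc n)) powr \<beta>))) \<longlonglongrightarrow> nexp (ennreal 0)"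
      by (intro nexp_tendsto tendsto_ennrealI)
    then show "(\<lambda>n. \<integral>\<^sup>+\<omega>. nexp (ennreal (1 / real (Suc n)) * Z \<omega>) \<partial>N) \<longlonglongrightarrow> 1"
      by (subst lap) auto
  qed measurable
  have pos: "AE \<omega> in N. enn2real (Z \<omega>) > 0"
    using fin AE_space
  proof eventually_elim
    case (elim \<omega>)
    have "0 < ennreal (\<kappa> * A 0 \<omega> powr r)"
      using \<kappa> poisson_points_intensity(2)[OF P elim(2), of 0] by simp
    also have "\<dots> \<le> Z \<omega>"
      unfolding Z_def using sum_le_suminf[of "\<lambda>i. ennreal (\<kappa> * A i \<omega> powr r)" "{0}"] by simp
    finally show ?case using elim by (simp add: enn2real_positive_iff)
  qed
  have "expectation (\<lambda>\<omega>. exp (- t * enn2real (Z \<omega>))) = exp (- (t powr \<beta>))" if t: "t \<ge> 0" for t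
  proof (cases "t = 0")
    case True
    then show ?thesis by (simp add: prob_space)
  next
    case False
    then have t: "t > 0" using t by simp
    have "ennreal (expectation (\<lambda>\<omega>. exp (- t * enn2real (Z \<omega>)))) = (\<integral>\<^sup>+\<omega>. ennreal (exp (- t * enn2real (Z \<omega>))) \<partial>N)"
    proof (rule nn_integral_eq_integral[symmetric])
      show "integrable N (\<lambda>\<omega>. exp (- t * enn2real (Z \<omega>)))"
        using t by (intro integrable_const_bound[where B = 1]) auto
    qed simp
    also have "\<dots> = (\<integral>\<^sup>+\<omega>. nexp (ennreal t * Z \<omega>) \<partial>N)"
    proof (rule nn_integral_cong_AE)
      show "AE \<omega> in N. ennreal (exp (- t * enn2real (Z \<omega>))) = nexp (ennreal t * Z \<omega>)"
        using fin
      proof eventually_elim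
        case (elim \<omega>)
        then obtain z where "Z \<omega> = ennreal z" "z \<ge> 0" by (cases "Z \<omega>" rule: ennreal_cases) auto
        then show ?case using t by (simp add: nexp_ennreal flip: ennreal_mult)
      qed
    qed
    also have "\<dots> = ennreal (exp (- (t powr \<beta>)))" by (simp add: lap[OF t] nexp_ennreal)
    finally show ?thesis by simp
  qed
  then show ?thesis using pos by (intro bexI[of _ "\<lambda>\<omega>. enn2real (Z \<omega>)"]) auto
qed

section \<open>Pulling back along measure-preserving maps\<close>

definition measure_preserving_map :: "'v measure \<Rightarrow> 'w measure \<Rightarrow> ('v \<Rightarrow> 'w) \<Rightarrow> bool" where
  "measure_preserving_map M M' f \<longleftrightarrow>
     prob_space M \<and> prob_space M' \<and> f \<in> measurable M M' \<and> distr M M' f = M'"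

lemma measure_preserving_mapD:
  assumes "measure_preserving_map M M' f"
  shows "prob_space M" "prob_space M'" "f \<in> measurable M M'" "distr M M' f = M'"
  using assms by (auto simp: measure_preserving_map_def)

lemma measure_preserving_map_comp:
  assumes f: "measure_preserving_map M M' f" and g: "measure_preserving_map M' M'' g"
  shows "measure_preserving_map M M'' (\<lambda>\<omega>. g (f \<omega>))"
proof -
  note f' = measure_preserving_mapD[OF f] and g' = measure_preserving_mapD[OF g]
  have "distr M M'' (\<lambda>\<omega>. g (f \<omega>)) = distr (distr M M' f) M'' g"
    using f' g' by (subst distr_distr) (auto simp: comp_def)
  then show ?thesis using f' g' by (auto simp: measure_preserving_map_def intro: measurable_compose)
qed

lemma path_compose: "path S (\<lambda>s \<omega>. X s (f \<omega>)) \<omega> = path S X (f \<omega>)"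
  by (simp add: path_def)

lemma distr_pullback:
  assumes f: "measure_preserving_map M M' f" and X: "X \<in> measurable M' L"
  shows "distr M L (\<lambda>\<omega>. X (f \<omega>)) = distr M' L X"
proof -
  note f' = measure_preserving_mapD[OF f]
  have "distr M L (\<lambda>\<omega>. X (f \<omega>)) = distr (distr M M' f) L X"
    using f' X by (subst distr_distr) (auto simp: comp_def)
  then show ?thesis by (simp add: f')
qed

lemma measure_pullback:
  assumes f: "measure_preserving_map M M' f" and E: "E \<in> sets M'"
  shows "measure M (f -` E \<inter> space M) = measure M' E"
  using measure_distr[OF measure_preserving_mapD(3)[OF f] E] measure_preserving_mapD(4)[OF f] by simp

lemma AE_pullback:
  assumes f: "measure_preserving_map M M' f" and "AE \<omega> in M'. Q \<omega>"
  shows "AE \<omega> in M. Q (f \<omega>)"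
  using assms(2) measure_preserving_mapD[OF f] by (metis AE_distrD)

lemma indep_vars_pullback:
  assumes f: "measure_preserving_map M M' f" and X: "prob_space.indep_vars M' L X I"
  shows "prob_space.indep_vars M L (\<lambda>i \<omega>. X i (f \<omega>)) I"
proof (cases "I = {}")
  case True
  interpret prob_space M by (rule measure_preserving_mapD[OF f])
  show ?thesis using True by (simp add: indep_vars_def2 indep_sets_def)
next
  case False
  interpret M: prob_space M by (rule measure_preserving_mapD[OF f])
  interpret M': prob_space M' by (rule measure_preserving_mapD[OF f])
  have Xm: "X i \<in> measurable M' (L i)" if "i \<in> I" for i
    using X that by (auto simp: M'.indep_vars_def2)
  have Xm': "(\<lambda>\<omega>. X i (f \<omega>)) \<in> measurable M (L i)" if "i \<in> I" for i
    using measurable_compose[OF measure_preserving_mapD(3)[OF f] Xm[OF that]] .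
  have "distr M (\<Pi>\<^sub>M i\<in>I. L i) (\<lambda>\<omega>. \<lambda>i\<in>I. X i (f \<omega>)) = distr M' (\<Pi>\<^sub>M i\<in>I. L i) (\<lambda>\<omega>. \<lambda>i\<in>I. X i \<omega>)"
    using Xm by (intro distr_pullback[OF f]) measurable
  also have "\<dots> = (\<Pi>\<^sub>M i\<in>I. distr M' (L i) (X i))"
    using X Xm False by (subst (asm) M'.indep_vars_iff_distr_eq_PiM') auto
  also have "\<dots> = (\<Pi>\<^sub>M i\<in>I. distr M (L i) (\<lambda>\<omega>. X i (f \<omega>)))"
    using distr_pullback[OF f Xm] by (intro PiM_cong) auto
  finally show ?thesis
    using Xm' False by (subst M.indep_vars_iff_distr_eq_PiM') auto
qed

lemma gen_events_pullback:
  assumes f: "f \<in> measurable M M'"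
  shows "gen_events M I (\<lambda>i \<omega>. Y i (f \<omega>)) = {f -` E \<inter> space M | E. E \<in> gen_events M' I Y}"
proof -
  have "path I (\<lambda>i \<omega>. Y i (f \<omega>)) -` B \<inter> space M = f -` (path I Y -` B \<inter> space M') \<inter> space M" for B
    using measurable_space[OF f] by (auto simp: path_compose)
  then show ?thesis unfolding gen_events_def by (auto; metis)
qed

lemma indep_set_pullback:
  assumes f: "measure_preserving_map M M' f"
    and ind: "prob_space.indep_set M' (gen_events M' I Y) (gen_events M' J Z)"
  shows "prob_space.indep_set M (gen_events M I (\<lambda>i \<omega>. Y i (f \<omega>))) (gen_events M J (\<lambda>i \<omega>. Z i (f \<omega>)))"
proof -
  interpret M: prob_space M by (rule measure_preserving_mapD[OF f])
  interpret M': prob_space M' by (rule measure_preserving_mapD[OF f])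
  note fm = measure_preserving_mapD(3)[OF f]
  note ind' = ind[unfolded M'.indep_sets2_eq]
  show ?thesis
    unfolding M.indep_sets2_eq gen_events_pullback[OF fm]
  proof (intro conjI ballI)
    show "{f -` E \<inter> space M | E. E \<in> gen_events M' I Y} \<subseteq> M.events"
      "{f -` E \<inter> space M | E. E \<in> gen_events M' J Z} \<subseteq> M.events"
      using ind' measurable_sets[OF fm] by blast+
    fix a b assume "a \<in> {f -` E \<inter> space M | E. E \<in> gen_events M' I Y}"
      "b \<in> {f -` E \<inter> space M | E. E \<in> gen_events M' J Z}"
    then obtain E G where EG: "E \<in> gen_events M' I Y" "G \<in> gen_events M' J Z"
      and ab: "a = f -` E \<inter> space M" "b = f -` G \<inter> space M" by auto
    then have s: "E \<in> sets M'" "G \<in> sets M'" using ind' by auto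
    have "a \<inter> b = f -` (E \<inter> G) \<inter> space M" using ab by auto
    then have "M.prob (a \<inter> b) = M'.prob (E \<inter> G)"
      using s by (simp only: measure_pullback[OF f] sets.Int)
    also have "\<dots> = M'.prob E * M'.prob G" using EG ind' by blast
    also have "\<dots> = M.prob a * M.prob b" using s by (simp only: ab measure_pullback[OF f])
    finally show "M.prob (a \<inter> b) = M.prob a * M.prob b" .
  qed
qed

lemma eq_law_pullback:
  assumes f: "measure_preserving_map M M' f" and X: "eq_law S M' X N Y"
  shows "eq_law S M (\<lambda>s \<omega>. X s (f \<omega>)) N Y"
  unfolding eq_law_def
proof (intro conjI allI impI)
  have Xm: "X s \<in> borel_measurable M'" if "s \<in> S" for s
    using X that by (auto simp: eq_law_def process_def)
  show "process M S (\<lambda>s \<omega>. X s (f \<omega>))"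
    using measurable_compose[OF measure_preserving_mapD(3)[OF f] Xm] measure_preserving_mapD[OF f]
    by (auto simp: process_def)
  show "process N S Y" using X by (simp add: eq_law_def)
  fix F assume F: "finite F \<and> F \<subseteq> S"
  have "path F X \<in> measurable M' (\<Pi>\<^sub>M s\<in>F. borel)"
    using F Xm by (intro path_measurable) auto
  from distr_pullback[OF f this] 
  have "distr M (\<Pi>\<^sub>M s\<in>F. borel) (path F (\<lambda>s \<omega>. X s (f \<omega>))) = distr M' (\<Pi>\<^sub>M s\<in>F. borel) (path F X)"
    by (simp add: path_compose[abs_def])
  also have "\<dots> = distr N (\<Pi>\<^sub>M s\<in>F. borel) (path F Y)" using X F by (simp add: eq_law_def)
  finally show "distr M (\<Pi>\<^sub>M s\<in>F. borel) (path F (\<lambda>s \<omega>. X s (f \<omega>))) = distr N (\<Pi>\<^sub>M s\<in>F. borel) (path F Y)" .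
qed

lemma eq_law_refl: "process M S X \<Longrightarrow> eq_law S M X M X"
  by (simp add: eq_law_def)

lemma frechet_family_pullback:
  assumes f: "measure_preserving_map M M' f" and U: "frechet_family \<alpha> S M' U"
  shows "frechet_family \<alpha> S M (\<lambda>s \<omega>. U s (f \<omega>))"
proof -
  interpret M': prob_space M' by (rule measure_preserving_mapD[OF f])
  have "U s \<in> borel_measurable M'" if "s \<in> S" for s
    using U that by (auto simp: frechet_family_def M'.indep_vars_def2)
  then show ?thesis
    using U measure_preserving_mapD[OF f] indep_vars_pullback[OF f, of "\<lambda>_. borel" U S]
    by (auto simp: frechet_family_def distr_pullback[OF f])
qed

lemma stable_family_pullback:
  assumes f: "measure_preserving_map M M' f" and T: "stable_family \<beta> S M' T"
  shows "stable_family \<beta> S M (\<lambda>s \<omega>. T s (f \<omega>))"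
proof -
  interpret M': prob_space M' by (rule measure_preserving_mapD[OF f])
  have Tm: "T s \<in> borel_measurable M'" if "s \<in> S" for s
    using T that by (auto simp: stable_family_def M'.indep_vars_def2)
  have "integral\<^sup>L M (\<lambda>\<omega>. exp (- t * T s (f \<omega>))) = integral\<^sup>L M' (\<lambda>\<omega>. exp (- t * T s \<omega>))"
    if "s \<in> S" for s t
  proof -
    have [measurable]: "T s \<in> borel_measurable M'" by (rule Tm[OF that])
    show ?thesis
      using integral_distr[OF measure_preserving_mapD(3)[OF f], of "\<lambda>\<omega>. exp (- t * T s \<omega>)"]
      by (simp add: measure_preserving_mapD(4)[OF f])
  qed
  then show ?thesis
    using T measure_preserving_mapD[OF f] indep_vars_pullback[OF f, of "\<lambda>_. borel" T S]
      AE_pullback[OF f]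
    by (auto simp: stable_family_def)
qed

lemma poisson_points_pullback:
  assumes f: "measure_preserving_map M M' f" and A: "poisson_points M' \<mu> A"
  shows "poisson_points M \<mu> (\<lambda>i \<omega>. A i (f \<omega>))"
  unfolding poisson_points_def
proof (intro conjI allI ballI impI)
  interpret M: prob_space M by (rule measure_preserving_mapD[OF f])
  note fm = measure_preserving_mapD(3)[OF f]
  note [measurable] = poisson_points_measurable[OF A]
  have cp: "count_points (\<lambda>i \<omega>. A i (f \<omega>)) B \<omega> = count_points A B (f \<omega>)" for B \<omega>
    by (simp add: count_points_def)
  show "prob_space M" by (rule measure_preserving_mapD[OF f])
  show "(\<lambda>\<omega>. A i (f \<omega>)) \<in> measurable M \<mu>" for i
    using measurable_compose[OF fm poisson_points_measurable[OF A]] .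
  show "if emeasure \<mu> B = \<infinity> then AE \<omega> in M. count_points (\<lambda>i \<omega>. A i (f \<omega>)) B \<omega> = \<infinity>
        else \<forall>k::nat. measure M {\<omega> \<in> space M. count_points (\<lambda>i \<omega>. A i (f \<omega>)) B \<omega> = of_nat k}
               = measure \<mu> B ^ k / fact k * exp (- measure \<mu> B)"
    if B [measurable]: "B \<in> sets \<mu>" for B
  proof (cases "emeasure \<mu> B = \<infinity>")
    case True
    then have "AE \<omega> in M'. count_points A B \<omega> = \<infinity>"
      using A B unfolding poisson_points_def by (metis (no_types, lifting))
    from AE_pullback[OF f this] show ?thesis using True by (simp add: cp)
  next
    case False
    have "measure M {\<omega> \<in> space M. count_points A B (f \<omega>) = of_nat k}
        = measure \<mu> B ^ k / fact k * exp (- measure \<mu> B)" for k :: nat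
    proof -
      have [measurable]: "count_points A B \<in> borel_measurable M'"
        unfolding count_points_eq_suminf[abs_def] by measurable
      have "measure M {\<omega> \<in> space M. count_points A B (f \<omega>) = of_nat k}
          = measure M (f -` {\<omega> \<in> space M'. count_points A B \<omega> = of_nat k} \<inter> space M)"
        using measurable_space[OF fm] by (intro arg_cong[where f = "measure M"]) auto
      also have "\<dots> = measure M' {\<omega> \<in> space M'. count_points A B \<omega> = of_nat k}"
        by (rule measure_pullback[OF f]) measurable
      also have "\<dots> = measure \<mu> B ^ k / fact k * exp (- measure \<mu> B)"
        using A B False unfolding poisson_points_def by (metis (no_types, lifting))
      finally show ?thesis .
    qed
    then show ?thesis using False by (simp add: cp)
  qed
  show "M.indep_vars (\<lambda>j. borel) (\<lambda>j. count_points (\<lambda>i \<omega>. A i (f \<omega>)) (B j)) {..<n}"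
    if "(\<forall>j<n. B j \<in> sets \<mu>) \<and> disjoint_family_on B {..<n}" for B :: "nat \<Rightarrow> _" and n
  proof -
    have "prob_space.indep_vars M' (\<lambda>j. borel) (\<lambda>j. count_points A (B j)) {..<n}"
      using A that unfolding poisson_points_def by blast
    from indep_vars_pullback[OF f this] show ?thesis by (simp add: cp[abs_def])
  qed
qed

section \<open>Independent blocks of an infinite power\<close>

text \<open>Coordinates are sorted into infinitely many infinite blocks, so that a block is again a point of
  the infinite power and can itself be split into blocks.\<close>

definition block :: "nat \<Rightarrow> (nat \<Rightarrow> 'b) \<Rightarrow> nat \<Rightarrow> 'b" where
  "block j \<omega> = (\<lambda>n. \<omega> (prod_encode (j, n)))"

context
  fixes N :: "'b measure" and Q :: "(nat \<Rightarrow> 'b) measure"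
  assumes N: "prob_space N"
  defines "Q \<equiv> \<Pi>\<^sub>M n\<in>(UNIV :: nat set). N"
begin

lemma prob_space_iid: "prob_space Q"
  unfolding Q_def by (intro prob_space_PiM N)

lemma coordinate_measure_preserving: "measure_preserving_map Q N (\<lambda>\<omega>. \<omega> n)"
  unfolding measure_preserving_map_def
proof (intro conjI N prob_space_iid)
  show "(\<lambda>\<omega>. \<omega> n) \<in> measurable Q N" unfolding Q_def by (rule measurable_component_singleton) simp
  show "distr Q N (\<lambda>\<omega>. \<omega> n) = N"
    unfolding Q_def by (rule distr_PiM_component) (auto intro: N)
qed

lemma coordinates_indep: "prob_space.indep_vars Q (\<lambda>_. N) (\<lambda>n \<omega>. \<omega> n) UNIV"
proof -
  interpret prob_space Q by (rule prob_space_iid)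
  note c = measure_preserving_mapD[OF coordinate_measure_preserving]
  have "distr Q (\<Pi>\<^sub>M n\<in>UNIV. N) (\<lambda>\<omega>. \<lambda>n\<in>UNIV. \<omega> n) = distr Q Q (\<lambda>\<omega>. \<omega>)"
    by (simp add: Q_def restrict_UNIV)
  also have "\<dots> = (\<Pi>\<^sub>M n\<in>UNIV. distr Q N (\<lambda>\<omega>. \<omega> n))"
    by (simp add: c(4)) (simp add: Q_def)
  finally show ?thesis by (subst indep_vars_iff_distr_eq_PiM') (auto intro: c(3))
qed

lemma block_measure_preserving: "measure_preserving_map Q Q (block j)"
  unfolding measure_preserving_map_def
proof (intro conjI prob_space_iid)
  have inj: "inj_on (\<lambda>n. prod_encode (j, n)) UNIV" by (auto simp: inj_on_def)
  show "block j \<in> measurable Q Q"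
    unfolding Q_def block_def
    by (rule measurable_PiM_single') (auto simp: space_PiM intro: measurable_component_singleton)
  have "distr (\<Pi>\<^sub>M n\<in>UNIV. N) (\<Pi>\<^sub>M n\<in>UNIV. N) (\<lambda>\<omega>. \<lambda>n\<in>UNIV. \<omega> (prod_encode (j, n))) = (\<Pi>\<^sub>M n\<in>(UNIV :: nat set). N)"
    by (rule distr_PiM_reindex[where M = "\<lambda>_. N", OF _ inj]) (auto intro: N)
  then show "distr Q Q (block j) = Q" by (simp add: Q_def block_def[abs_def] restrict_UNIV)
qed

lemma blocks_indep: "prob_space.indep_vars Q (\<lambda>_. Q) block UNIV"
proof -
  interpret prob_space Q by (rule prob_space_iid)
  \<comment> \<open>The blocks use disjoint sets of coordinates since the pairing is injective.\<close>
  let ?K = "\<lambda>j. range (\<lambda>n. prod_encode (j, n))"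
  have "indep_vars (\<lambda>j. \<Pi>\<^sub>M n\<in>?K j. N) (\<lambda>j \<omega>. restrict (\<lambda>n. \<omega> n) (?K j)) UNIV"
    by (rule indep_vars_restrict[OF coordinates_indep]) (auto simp: disjoint_family_on_def)
  then have "indep_vars (\<lambda>_. Q) (\<lambda>j \<omega>. (\<lambda>n. (restrict (\<lambda>n. \<omega> n) (?K j)) (prod_encode (j, n)))) UNIV"
  proof (rule indep_vars_compose2[where Y = "\<lambda>j \<omega> n. \<omega> (prod_encode (j, n))"])
    fix j
    show "(\<lambda>\<omega> n. \<omega> (prod_encode (j, n))) \<in> measurable (\<Pi>\<^sub>M n\<in>?K j. N) Q"
      unfolding Q_def
      by (rule measurable_PiM_single') (auto simp: space_PiM intro: measurable_component_singleton)
  qed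
  then show ?thesis by (simp add: block_def[abs_def])
qed

lemma iid_family_indep:
  assumes Y: "Y \<in> borel_measurable N" and g: "inj_on g I"
  shows "prob_space.indep_vars Q (\<lambda>_. borel) (\<lambda>i \<omega>. Y (\<omega> (g i))) I"
proof -
  interpret prob_space Q by (rule prob_space_iid)
  have "indep_vars (\<lambda>i. \<Pi>\<^sub>M n\<in>{g i}. N) (\<lambda>i \<omega>. restrict (\<lambda>n. \<omega> n) {g i}) I"
    using g by (intro indep_vars_restrict[OF coordinates_indep]) (auto simp: disjoint_family_on_def inj_on_def)
  then have "indep_vars (\<lambda>_. borel) (\<lambda>i \<omega>. Y (restrict (\<lambda>n. \<omega> n) {g i} (g i))) I"
  proof (rule indep_vars_compose2[where Y = "\<lambda>i y. Y (y (g i))"])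
    fix i
    show "(\<lambda>y. Y (y (g i))) \<in> borel_measurable (\<Pi>\<^sub>M n\<in>{g i}. N)"
      by (rule measurable_compose[OF _ Y], rule measurable_component_singleton) simp
  qed
  then show ?thesis by simp
qed

lemma block_events:
  assumes "\<And>i. i \<in> I \<Longrightarrow> Y i \<in> borel_measurable Q"
  shows "gen_events Q I (\<lambda>i \<omega>. Y i (block j \<omega>)) \<subseteq> vimage_events Q Q (block j)"
proof -
  have fm: "block j \<in> measurable Q Q" by (rule measure_preserving_mapD[OF block_measure_preserving])
  have "gen_events Q I Y \<subseteq> sets Q"
    unfolding gen_events_eq_vimage_events by (intro vimage_events_subset path_measurable assms)
  then show ?thesis unfolding gen_events_pullback[OF fm] vimage_events_def by blast
qed

lemma block_indep_sets:
  assumes "\<And>k. k < n \<Longrightarrow> E k \<subseteq> vimage_events Q Q (block k)"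
  shows "prob_space.indep_sets Q E {..<n}"
proof -
  interpret prob_space Q by (rule prob_space_iid)
  have "indep_sets (\<lambda>k. vimage_events Q Q (block k)) UNIV"
    using blocks_indep by (simp add: indep_vars_def2 vimage_events_def)
  then have "indep_sets (\<lambda>k. vimage_events Q Q (block k)) {..<n}"
    by (rule indep_sets_mono_index[rotated]) simp
  then show ?thesis by (rule indep_sets_mono_sets) (use assms in auto)
qed

lemma block_indep_set:
  assumes "E \<subseteq> vimage_events Q Q (block 0)"
    and "F \<subseteq> vimage_events Q Q (block 1)"
  shows "prob_space.indep_set Q E F"
proof (rule indep_sets_three_pair(1)[OF prob_space_iid])
  show "prob_space.indep_sets Q (\<lambda>k. [E, F, {}] ! k) {..<3}"
    by (rule block_indep_sets) (use assms in \<open>auto simp: less_Suc_eq numeral_3_eq_3\<close>)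
qed

text \<open>Block \<open>k\<close> is subdivided once more: its sub-blocks feed the copies, while the other blocks
  remain free for the points and for the Frechet variables.\<close>

lemma block_indep_copies:
  assumes Z: "process Q S Z"
  shows "indep_copies S Q (\<lambda>i s \<omega>. Z s (block i (block k \<omega>))) Q Z"
  unfolding indep_copies_def
proof (intro conjI allI)
  interpret prob_space Q by (rule prob_space_iid)
  show "eq_law S Q (\<lambda>s \<omega>. Z s (block i (block k \<omega>))) Q Z" for i
    by (rule eq_law_pullback[OF measure_preserving_map_comp[OF block_measure_preserving block_measure_preserving]
        eq_law_refl[OF Z]])
  have "path S Z \<in> measurable Q (\<Pi>\<^sub>M s\<in>S. borel)"
    using Z by (intro path_measurable) (auto simp: process_def)
  then have "indep_vars (\<lambda>_. \<Pi>\<^sub>M s\<in>S. borel) (\<lambda>i \<omega>. path S Z (block i \<omega>)) UNIV"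
    by (intro indep_vars_compose2[OF blocks_indep])
  from indep_vars_pullback[OF block_measure_preserving this]
  show "indep_vars (\<lambda>i. \<Pi>\<^sub>M s\<in>S. borel) (\<lambda>i. path S (\<lambda>s \<omega>. Z s (block i (block k \<omega>)))) UNIV"
    by (simp add: path_def[abs_def])
qed

lemma block_copies_events:
  assumes Z: "process Q S Z"
  shows "copies_events Q S (\<lambda>i s \<omega>. Z s (block i (block k \<omega>))) \<subseteq> vimage_events Q Q (block k)"
proof -
  have "gen_events Q (UNIV \<times> S) (\<lambda>p \<omega>. (\<lambda>(i, s) \<omega>. Z s (block i \<omega>)) p (block k \<omega>))
     \<subseteq> vimage_events Q Q (block k)"
  proof (rule block_events)
    fix p assume "p \<in> (UNIV :: nat set) \<times> S"
    then show "(\<lambda>(i, s) \<omega>. Z s (block i \<omega>)) p \<in> borel_measurable Q"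
      using Z measurable_compose[OF measure_preserving_mapD(3)[OF block_measure_preserving]]
      by (auto simp: process_def)
  qed
  then show ?thesis by (simp add: copies_events_def case_prod_beta')
qed

end

section \<open>Existence of the ingredients\<close>

lemma gen_events_subset_copies_events:
  "gen_events N S (W i) \<subseteq> copies_events N S W"
proof
  fix E assume "E \<in> gen_events N S (W i)"
  then obtain B where B: "B \<in> sets (\<Pi>\<^sub>M s\<in>S. borel)" and E: "E = path S (W i) -` B \<inter> space N"
    by (auto simp: gen_events_def)
  let ?g = "\<lambda>w :: nat \<times> _ \<Rightarrow> real. \<lambda>s\<in>S. w (i, s)"
  have "?g \<in> measurable (\<Pi>\<^sub>M p\<in>UNIV \<times> S. borel) (\<Pi>\<^sub>M s\<in>S. borel)"
    by (intro measurable_restrict measurable_component_singleton) auto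
  then have "?g -` B \<inter> space (\<Pi>\<^sub>M p\<in>UNIV \<times> S. borel) \<in> sets (\<Pi>\<^sub>M p\<in>UNIV \<times> S. borel)"
    using B by (rule measurable_sets)
  moreover have "E = path (UNIV \<times> S) (\<lambda>(i, s). W i s) -` (?g -` B \<inter> space (\<Pi>\<^sub>M p\<in>UNIV \<times> S. borel)) \<inter> space N"
  proof -
    have "?g (path (UNIV \<times> S) (\<lambda>(i, s). W i s) \<omega>) = path S (W i) \<omega>" for \<omega>
      by (auto simp: path_def fun_eq_iff)
    moreover have "path (UNIV \<times> S) (\<lambda>(i, s). W i s) \<omega> \<in> space (\<Pi>\<^sub>M p\<in>UNIV \<times> S. borel)" for \<omega>
      by (simp add: path_def space_PiM)
    ultimately show ?thesis unfolding E by (simp add: vimage_def)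
  qed
  ultimately show "E \<in> copies_events N S W" unfolding copies_events_def gen_events_def by blast
qed

lemma indep_set_mono:
  assumes "prob_space M" "prob_space.indep_set M E F" "E' \<subseteq> E" "F' \<subseteq> F"
  shows "prob_space.indep_set M E' F'"
proof -
  interpret prob_space M by fact
  show ?thesis using assms unfolding indep_sets2_eq by blast
qed

text \<open>Powers change the index of a Frechet law: \<open>U\<^sup>p\<^sup>/\<^sup>q \<le> y\<close> iff \<open>U \<le> y\<^sup>q\<^sup>/\<^sup>p\<close>.\<close>

lemma frechet_family_powr:
  assumes U: "frechet_family p S M U" and p: "0 < p" and q: "0 < q"
  shows "frechet_family q S M (\<lambda>s \<omega>. U s \<omega> powr (p / q))"
proof -
  interpret prob_space M using U by (simp add: frechet_family_def)
  have Uiv: "indep_vars (\<lambda>s. borel) U S" using U by (simp add: frechet_family_def)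
  have "indep_vars (\<lambda>s. borel) (\<lambda>s \<omega>. U s \<omega> powr (p / q)) S"
    by (rule indep_vars_compose2[OF Uiv]) measurable
  moreover have "cdf (distr M borel (\<lambda>\<omega>. U s \<omega> powr (p / q))) = frechet_cdf q" if s: "s \<in> S" for s
  proof
    fix y
    have [measurable]: "U s \<in> borel_measurable M" by (rule frechet_family_measurable[OF U s])
    have pU: "process M S U"
      using U by (auto simp: process_def frechet_family_def frechet_family_measurable[OF U])
    have cdfU: "cdf (distr M borel (U s)) = frechet_cdf p" using U s by (simp add: frechet_family_def)
    have iff: "AE \<omega> in M. U s \<omega> powr (p / q) \<le> y \<longleftrightarrow> (0 < y \<and> U s \<omega> \<le> y powr (q / p))"
      using frechet_family_AE_pos[OF U s]
    proof eventually_elim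
      case (elim \<omega>)
      show ?case
      proof (cases "0 < y")
        case True
        have u: "(U s \<omega> powr (p / q)) powr (q / p) = U s \<omega>" and y: "(y powr (q / p)) powr (p / q) = y"
          using p q True elim by (simp_all add: powr_powr)
        have "U s \<omega> \<le> y powr (q / p)" if "U s \<omega> powr (p / q) \<le> y"
          using powr_mono2[OF _ _ that, of "q / p"] p q by (simp add: u)
        moreover have "U s \<omega> powr (p / q) \<le> y" if "U s \<omega> \<le> y powr (q / p)"
          using powr_mono2[OF _ _ that, of "p / q"] p q elim by (simp add: y)
        ultimately show ?thesis using True by blast
      next
        case False
        have "U s \<omega> powr (p / q) > 0" using elim by simp
        then have "\<not> U s \<omega> powr (p / q) \<le> y" using False by linarith
        then show ?thesis using False by blast
      qed
    qed
    have "ennreal (cdf (distr M borel (\<lambda>\<omega>. U s \<omega> powr (p / q))) y) = emeasure M {\<omega>\<in>space M. U s \<omega> powr (p / q) \<le> y}"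
    proof -
      have "{\<omega>\<in>space M. U s \<omega> powr (p / q) \<le> y} = (\<lambda>\<omega>. U s \<omega> powr (p / q)) -` {..y} \<inter> space M" by auto
      then show ?thesis by (simp add: cdf_def measure_distr emeasure_eq_measure)
    qed
    also have "\<dots> = emeasure M {\<omega>\<in>space M. 0 < y \<and> U s \<omega> \<le> y powr (q / p)}"
      using iff by (intro emeasure_eq_AE) auto
    also have "\<dots> = ennreal (frechet_cdf q y)"
    proof (cases "0 < y")
      case True
      have "emeasure M {\<omega>\<in>space M. 0 < y \<and> U s \<omega> \<le> y powr (q / p)} = ennreal (frechet_cdf p (y powr (q / p)))"
        using True emeasure_frechet_cdf[OF pU s cdfU] by simp
      also have "frechet_cdf p (y powr (q / p)) = frechet_cdf q y"
        using True p by (simp add: frechet_cdf_def powr_powr)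
      finally show ?thesis .
    qed (simp add: frechet_cdf_def)
    finally show "cdf (distr M borel (\<lambda>\<omega>. U s \<omega> powr (p / q))) y = frechet_cdf q y"
      by (simp add: cdf_def frechet_cdf_def split: if_splits)
  qed
  ultimately show ?thesis by (simp add: frechet_family_def prob_space_axioms)
qed

text \<open>The sample space \<open>N\<close> of the given representation already supports independent \<open>U\<close> and \<open>W 0\<close>, hence
  one coordinate of its infinite power suffices for a copy of \<open>V\<close>.\<close>

lemma max_ingredients_exist:
  fixes N :: "'b measure" and A :: "nat \<Rightarrow> 'b \<Rightarrow> real"
  assumes I: "lr_ingredients p S N U A W K W0"
  shows "\<exists>(P :: (nat \<Rightarrow> 'b) measure) A' V (R :: (nat \<Rightarrow> 'b) measure) U' W'.
    frechet_factors p S R U' W' K W0 \<and> max_ingredients S P A' V R (V_process p U' W')"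
proof -
  note I' = lr_ingredients_measurable[OF I]
  have N: "prob_space N" by (rule I')
  define Q where "Q = (\<Pi>\<^sub>M n\<in>(UNIV :: nat set). N)"
  have coord: "measure_preserving_map Q N (\<lambda>\<omega>. \<omega> n)" for n
    unfolding Q_def by (rule coordinate_measure_preserving[OF N])
  have blk: "measure_preserving_map Q Q (block k)" for k
    unfolding Q_def by (rule block_measure_preserving[OF N])
  define U' where "U' s \<omega> = U s (\<omega> 0)" for s and \<omega> :: "nat \<Rightarrow> 'b"
  define W' where "W' s \<omega> = W 0 s (\<omega> 0)" for s and \<omega> :: "nat \<Rightarrow> 'b"
  define A' where "A' i \<omega> = A i (block 0 \<omega> 0)" for i and \<omega> :: "nat \<Rightarrow> 'b"
  define V where "V i s \<omega> = V_process p U' W' s (block i (block 1 \<omega>))" for i s and \<omega> :: "nat \<Rightarrow> 'b"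
  have factors: "frechet_factors p S Q U' W' K W0"
    unfolding frechet_factors_def
  proof (intro conjI)
    show "frechet_family p S Q U'"
      unfolding U'_def[abs_def] using I
      by (intro frechet_family_pullback[OF coord]) (simp add: lr_ingredients_def)
    show "eq_law S Q W' K W0"
      unfolding W'_def[abs_def] using I
      by (intro eq_law_pullback[OF coord]) (simp add: lr_ingredients_def indep_copies_def)
    have "prob_space.indep_set N (gen_events N S U) (copies_events N S W)"
      using I by (intro indep_sets_three_pair(2)[OF N, where F = "gen_events N UNIV A"]) (simp add: lr_ingredients_def)
    then have "prob_space.indep_set N (gen_events N S U) (gen_events N S (W 0))"
      by (rule indep_set_mono[OF N _ order_refl gen_events_subset_copies_events])
    then show "prob_space.indep_set Q (gen_events Q S U') (gen_events Q S W')"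
      unfolding U'_def[abs_def] W'_def[abs_def] by (rule indep_set_pullback[OF coord])
  qed
  have Vp: "process Q S (V_process p U' W')"
    unfolding process_def
  proof (intro conjI ballI)
    show "prob_space Q" by (rule measure_preserving_mapD(1)[OF coord])
    fix s assume "s \<in> S"
    then have [measurable]: "U' s \<in> borel_measurable Q" "W' s \<in> borel_measurable Q"
      unfolding U'_def[abs_def] W'_def[abs_def]
      by (auto intro!: measurable_compose[OF measure_preserving_mapD(3)[OF coord]] I')
    show "V_process p U' W' s \<in> borel_measurable Q" unfolding V_process_def[abs_def] by measurable
  qed
  have "max_ingredients S Q A' V Q (V_process p U' W')"
    unfolding max_ingredients_def
  proof (intro conjI)
    have "poisson_points N intensity A" using I by (simp add: lr_ingredients_def)
    then show "poisson_points Q intensity A'"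
      unfolding A'_def[abs_def] by (intro poisson_points_pullback[OF measure_preserving_map_comp[OF blk coord]])
    show "indep_copies S Q V Q (V_process p U' W')"
      using block_indep_copies[OF N, of S "V_process p U' W'" 1] Vp
      unfolding V_def[abs_def] Q_def by simp
    have "gen_events Q UNIV A' \<subseteq> vimage_events Q Q (block 0)"
      using block_events[OF N, of UNIV "\<lambda>i \<omega>. A i (\<omega> 0)" 0]
        measurable_compose[OF measure_preserving_mapD(3)[OF coord] I'(2)]
      unfolding A'_def[abs_def] Q_def by simp
    moreover have "copies_events Q S V \<subseteq> vimage_events Q Q (block 1)"
      using block_copies_events[OF N, of S "V_process p U' W'" 1] Vp
      unfolding V_def[abs_def] Q_def by simp
    ultimately show "prob_space.indep_set Q (gen_events Q UNIV A') (copies_events Q S V)"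
      by (rule block_indep_set[OF N, folded Q_def])
  qed
  then show ?thesis using factors by blast
qed

text \<open>Independent stable variables come from the Poisson points in distinct coordinates of one
  block, which is where countability of \<open>S\<close> enters; the \<open>q\<close>-Frechet variables are powers of the given ones.\<close>

lemma stable_lr_ingredients_exist:
  fixes N :: "'b measure" and A :: "nat \<Rightarrow> 'b \<Rightarrow> real"
  assumes S: "countable S" and p: "0 < p" and q: "p < q"
    and I: "lr_ingredients p S N U A W K W0"
  shows "\<exists>(P :: (nat \<Rightarrow> 'b) measure) Uq A' Wq (R :: (nat \<Rightarrow> 'b) measure) T W'.
    stable_factors (p / q) S R T W' K W0 \<and> lr_ingredients q S P Uq A' Wq R (Wq_process p q T W')"
proof -
  note I' = lr_ingredients_measurable[OF I]
  have N: "prob_space N" by (rule I')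
  have A: "poisson_points N intensity A" using I by (simp add: lr_ingredients_def)
  obtain \<tau> where \<tau> [measurable]: "\<tau> \<in> borel_measurable N" and \<tau>_pos: "AE \<omega> in N. \<tau> \<omega> > 0"
    and \<tau>_lap: "\<And>t. t \<ge> 0 \<Longrightarrow> prob_space.expectation N (\<lambda>\<omega>. exp (- t * \<tau> \<omega>)) = exp (- (t powr (p / q)))"
    using stable_variable_exists[OF A, of "p / q"] p q by auto
  define Q where "Q = (\<Pi>\<^sub>M n\<in>(UNIV :: nat set). N)"
  have coord: "measure_preserving_map Q N (\<lambda>\<omega>. \<omega> n)" for n
    unfolding Q_def by (rule coordinate_measure_preserving[OF N])
  have blk: "measure_preserving_map Q Q (block k)" for k
    unfolding Q_def by (rule block_measure_preserving[OF N])
  have Q: "prob_space Q" by (rule measure_preserving_mapD(1)[OF coord])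
  \<comment> \<open>On the space of the representation, block 0 feeds the Frechet variables, block 1 the points
    and block 2 the processes; on the space of the factors, block 0 feeds \<open>T\<close> and block 1 the process \<open>W\<close>.\<close>
  define T0 where "T0 s \<omega> = \<tau> (\<omega> (to_nat_on S s))" for s and \<omega> :: "nat \<Rightarrow> 'b"
  define T where "T s \<omega> = T0 s (block 0 \<omega>)" for s and \<omega> :: "nat \<Rightarrow> 'b"
  define W' where "W' s \<omega> = W 0 s (block 1 \<omega> 0)" for s and \<omega> :: "nat \<Rightarrow> 'b"
  define Uq where "Uq s \<omega> = U s (block 0 \<omega> 0) powr (p / q)" for s and \<omega> :: "nat \<Rightarrow> 'b"
  define A' where "A' i \<omega> = A i (block 1 \<omega> 0)" for i and \<omega> :: "nat \<Rightarrow> 'b"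
  define Wq where "Wq i s \<omega> = Wq_process p q T W' s (block i (block 2 \<omega>))" for i s and \<omega> :: "nat \<Rightarrow> 'b"
  have T0m: "T0 s \<in> borel_measurable Q" for s
    unfolding T0_def[abs_def] by (rule measurable_compose[OF measure_preserving_mapD(3)[OF coord] \<tau>])
  have W0m: "(\<lambda>\<omega>. W 0 s (\<omega> 0)) \<in> borel_measurable Q" if "s \<in> S" for s
    by (rule measurable_compose[OF measure_preserving_mapD(3)[OF coord] I'(3)[OF that]])
  have stable0: "stable_family (p / q) S Q T0"
    unfolding stable_family_def
  proof (intro conjI ballI allI impI Q)
    show "prob_space.indep_vars Q (\<lambda>s. borel) T0 S"
      using iid_family_indep[OF N \<tau> inj_on_to_nat_on[OF S]] unfolding T0_def[abs_def] Q_def .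
    show "AE \<omega> in Q. T0 s \<omega> > 0" for s
      unfolding T0_def by (rule AE_pullback[OF coord \<tau>_pos])
    fix s and t :: real assume t: "t \<ge> 0"
    have "prob_space.expectation Q (\<lambda>\<omega>. exp (- t * T0 s \<omega>)) = prob_space.expectation N (\<lambda>\<omega>. exp (- t * \<tau> \<omega>))"
      using integral_distr[OF measure_preserving_mapD(3)[OF coord[of "to_nat_on S s"]], of "\<lambda>\<omega>. exp (- t * \<tau> \<omega>)"]
      by (simp add: measure_preserving_mapD(4)[OF coord] T0_def)
    then show "prob_space.expectation Q (\<lambda>\<omega>. exp (- t * T0 s \<omega>)) = exp (- (t powr (p / q)))"
      using \<tau>_lap[OF t] by simp
  qed
  have T_events: "gen_events Q S T \<subseteq> vimage_events Q Q (block 0)"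
    using block_events[OF N, of S T0 0] T0m unfolding T_def[abs_def] Q_def by simp
  have W_events: "gen_events Q S W' \<subseteq> vimage_events Q Q (block 1)"
    using block_events[OF N, of S "\<lambda>s \<omega>. W 0 s (\<omega> 0)" 1] W0m unfolding W'_def[abs_def] Q_def by simp
  have factors: "stable_factors (p / q) S Q T W' K W0"
    unfolding stable_factors_def
  proof (intro conjI)
    show "stable_family (p / q) S Q T"
      unfolding T_def[abs_def] by (rule stable_family_pullback[OF blk stable0])
    show "eq_law S Q W' K W0"
      unfolding W'_def[abs_def] using I
      by (intro eq_law_pullback[OF measure_preserving_map_comp[OF blk coord]])
         (simp add: lr_ingredients_def indep_copies_def)
    show "prob_space.indep_set Q (gen_events Q S T) (gen_events Q S W')"
      by (rule block_indep_set[OF N, folded Q_def, OF T_events W_events])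
  qed
  have Zp: "process Q S (Wq_process p q T W')"
    unfolding process_def
  proof (intro conjI ballI Q)
    fix s assume s: "s \<in> S"
    have [measurable]: "T s \<in> borel_measurable Q"
      unfolding T_def[abs_def] by (rule measurable_compose[OF measure_preserving_mapD(3)[OF blk] T0m])
    have [measurable]: "W' s \<in> borel_measurable Q"
      unfolding W'_def[abs_def] by (rule measurable_compose[OF measure_preserving_mapD(3)[OF blk] W0m[OF s]])
    show "Wq_process p q T W' s \<in> borel_measurable Q" unfolding Wq_process_def[abs_def] by measurable
  qed
  have U_N: "frechet_family q S N (\<lambda>s \<omega>. U s \<omega> powr (p / q))"
    using I p q by (intro frechet_family_powr) (auto simp: lr_ingredients_def)
  have "lr_ingredients q S Q Uq A' Wq Q (Wq_process p q T W')"
    unfolding lr_ingredients_def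
  proof (intro conjI)
    show "frechet_family q S Q Uq"
      using frechet_family_pullback[OF measure_preserving_map_comp[OF blk coord] U_N]
      unfolding Uq_def[abs_def] .
    show "poisson_points Q intensity A'"
      unfolding A'_def[abs_def] by (rule poisson_points_pullback[OF measure_preserving_map_comp[OF blk coord] A])
    show "indep_copies S Q Wq Q (Wq_process p q T W')"
      using block_indep_copies[OF N, of S "Wq_process p q T W'" 2] Zp
      unfolding Wq_def[abs_def] Q_def by simp
    have "gen_events Q S Uq \<subseteq> vimage_events Q Q (block 0)"
      using block_events[OF N, of S "\<lambda>s \<omega>. U s (\<omega> 0) powr (p / q)" 0]
        measurable_compose[OF measure_preserving_mapD(3)[OF coord] frechet_family_measurable[OF U_N]]
      unfolding Uq_def[abs_def] Q_def by simp
    moreover have "gen_events Q UNIV A' \<subseteq> vimage_events Q Q (block 1)"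
      using block_events[OF N, of UNIV "\<lambda>i \<omega>. A i (\<omega> 0)" 1]
        measurable_compose[OF measure_preserving_mapD(3)[OF coord] I'(2)]
      unfolding A'_def[abs_def] Q_def by simp
    moreover have "copies_events Q S Wq \<subseteq> vimage_events Q Q (block 2)"
      using block_copies_events[OF N, of S "Wq_process p q T W'" 2] Zp
      unfolding Wq_def[abs_def] Q_def by simp
    ultimately have sub: "[gen_events Q S Uq, gen_events Q UNIV A', copies_events Q S Wq] ! k
        \<subseteq> vimage_events Q Q (block k)" if "k < 3" for k
      using that by (auto simp: less_Suc_eq numeral_3_eq_3 numeral_2_eq_2)
    show "prob_space.indep_sets Q
       (\<lambda>k. [gen_events Q S Uq, gen_events Q UNIV A', copies_events Q S Wq] ! k) {..<3}"
      using block_indep_sets[OF N, of 3] sub unfolding Q_def by blast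
  qed
  then show ?thesis using factors by blast
qed

theorem proposition2:
  fixes S :: "'s set" and p :: real
    and M :: "'a measure" and X :: "'s \<Rightarrow> 'a \<Rightarrow> real"
    and N :: "'b measure" and U :: "'s \<Rightarrow> 'b \<Rightarrow> real" and A :: "nat \<Rightarrow> 'b \<Rightarrow> real"
    and W :: "nat \<Rightarrow> 's \<Rightarrow> 'b \<Rightarrow> real"
    and K :: "'k measure" and W0 :: "'s \<Rightarrow> 'k \<Rightarrow> real"
  assumes "countable S" and "1 < p"
    and "simple_max_stable M S X"
    and "process K S W0"
    and "\<forall>s\<in>S. AE \<omega> in K. W0 s \<omega> \<ge> 0"
    and "\<forall>s\<in>S. prob_space.expectation K (W0 s) = 1"
    and "lr_ingredients p S N U A W K W0"
    and "eq_law S M X N (lr_process p U A W)"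
  shows
    "((\<exists>(P :: (nat \<Rightarrow> 'b) measure) A' V (R :: (nat \<Rightarrow> 'b) measure) U' W'.
         frechet_factors p S R U' W' K W0 \<and>
         max_ingredients S P A' V R (V_process p U' W') \<and>
         eq_law S M X P (max_process A' V)) \<and>
      (\<forall>(P :: 'c measure) A' V (R :: 'd measure) U' W'.
         frechet_factors p S R U' W' K W0 \<and>
         max_ingredients S P A' V R (V_process p U' W') \<longrightarrow>
         eq_law S M X P (max_process A' V))) \<and>
     (\<forall>q>p.
        (\<exists>(P :: (nat \<Rightarrow> 'b) measure) Uq A' Wq (R :: (nat \<Rightarrow> 'b) measure) T W'.
           stable_factors (p / q) S R T W' K W0 \<and>
           lr_ingredients q S P Uq A' Wq R (Wq_process p q T W') \<and>
           eq_law S M X P (lr_process q Uq A' Wq)) \<and>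
        (\<forall>(P :: 'c measure) Uq A' Wq (R :: 'd measure) T W'.
           stable_factors (p / q) S R T W' K W0 \<and>
           lr_ingredients q S P Uq A' Wq R (Wq_process p q T W') \<longrightarrow>
           eq_law S M X P (lr_process q Uq A' Wq)))"
proof -
  note p = \<open>1 < p\<close> and X = \<open>simple_max_stable M S X\<close> and I = \<open>lr_ingredients p S N U A W K W0\<close>
    and rep = \<open>eq_law S M X N (lr_process p U A W)\<close>
  have nonneg: "AE \<omega> in K. W0 s \<omega> \<ge> 0" if "s \<in> S" for s
    using \<open>\<forall>s\<in>S. AE \<omega> in K. W0 s \<omega> \<ge> 0\<close> that by blast
  note max_rep = max_representation[OF p X nonneg I rep]
  note lr_rep = lr_representation_change_norm[OF p _ X nonneg I rep]
  show ?thesis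
  proof (intro conjI allI impI; (elim conjE)?)
    show "\<exists>(P :: (nat \<Rightarrow> 'b) measure) A' V (R :: (nat \<Rightarrow> 'b) measure) U' W'.
         frechet_factors p S R U' W' K W0 \<and>
         max_ingredients S P A' V R (V_process p U' W') \<and>
         eq_law S M X P (max_process A' V)"
      using max_ingredients_exist[OF I] max_rep by meson
  next
    fix P :: "'c measure" and A' V and R :: "'d measure" and U' W'
    assume "frechet_factors p S R U' W' K W0" "max_ingredients S P A' V R (V_process p U' W')"
    then show "eq_law S M X P (max_process A' V)" by (rule max_rep[rotated -2])
  next
    fix q assume q: "p < q"
    have "0 < p" using p by simp
    show "\<exists>(P :: (nat \<Rightarrow> 'b) measure) Uq A' Wq (R :: (nat \<Rightarrow> 'b) measure) T W'.
           stable_factors (p / q) S R T W' K W0 \<and>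
           lr_ingredients q S P Uq A' Wq R (Wq_process p q T W') \<and>
           eq_law S M X P (lr_process q Uq A' Wq)"
      using stable_lr_ingredients_exist[OF \<open>countable S\<close> \<open>0 < p\<close> q I] lr_rep[OF q] by meson
  next
    fix q and P :: "'c measure" and Uq A' Wq and R :: "'d measure" and T W'
    assume q: "p < q" and "stable_factors (p / q) S R T W' K W0"
      "lr_ingredients q S P Uq A' Wq R (Wq_process p q T W')"
    then show "eq_law S M X P (lr_process q Uq A' Wq)" using lr_rep by blast
  qed
qed

end
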